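(* Let $\mathbb{F}$ be a field of characteristic $0$ and let $\mathcal{SV}$ be the Schrödinger-Virasoro Lie conformal algebra, i.e. the free $\mathbb{F}[\partial]$-module on $L,M,Y$ with non-zero $\lambda$-brackets on generators $[L_\lambda L]=(\partial+2\lambda)L$, $[L_\lambda M]=(\partial+\lambda)M$, $[L_\lambda Y]=(\partial+\tfrac32\lambda)Y$, $[M_\lambda L]=\lambda M$, $[Y_\lambda L]=(\tfrac12\partial+\tfrac32\lambda)Y$, $[Y_\lambda Y]=(\partial+2\lambda)M$. Then the basic and reduced cohomology of $\mathcal{SV}$ with coefficients in its adjoint module satisfy, for $q\ge 0$, $$\dim\widetilde{\mathrm{H}}^q(\mathcal{SV},\mathcal{SV})=\begin{cases}1,& q=1,3,\\ 2,& q=2,\\ 0,&\text{otherwise,}\end{cases}\qquad \dim\mathrm{H}^q(\mathcal{SV},\mathcal{SV})=\begin{cases}1,& q=0,3,\\ 3,& q=1,2,\\ 0,&\text{otherwise.}\end{cases}$$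
   Context: Lie conformal algebra (LCA): an $\mathbb{F}[\partial]$-module $\mathcal{A}$ with an $\mathbb{F}$-bilinear $\lambda$-bracket $\mathcal{A}\otimes\mathcal{A}\to\mathcal{A}[\lambda]$, $a\otimes b\mapsto[a_\lambda b]$, such that $[\partial a_\lambda b]=-\lambda[a_\lambda b]$, $[a_\lambda\partial b]=(\partial+\lambda)[a_\lambda b]$, $[a_\lambda b]=-[b_{-\lambda-\partial}a]$, and $[a_\lambda[b_\mu c]]=[[a_\lambda b]_{\lambda+\mu}c]+[b_\mu[a_\lambda c]]$. The $\lambda$-bracket on $\mathbb{F}[\partial]$-generators determines it everywhere. An $\mathcal{A}$-module is an $\mathbb{F}[\partial]$-module $V$ with an $\mathbb{F}$-bilinear $\lambda$-action $a\otimes v\mapsto a_\lambda v\in V[\lambda]$ such that $(\partial a)_\lambda v=-\lambda a_\lambda v$, $a_\lambda(\partial v)=(\partial+\lambda)a_\lambda v$, $a_\lambda(b_\mu v)-b_\mu(a_\lambda v)=[a_\lambda b]_{\lambda+\mu}v$. The adjoint module is $V=\mathcal{A}$ with $a_\lambda v=[a_\lambda v]$. Write $\partial^V$ for the action of $\partial$ on $V$. Basic complex: for $q\ge 1$, $\widetilde{C}^q(\mathcal{A},V)$ is the space of $\mathbb{F}$-linear maps $f:\mathcal{A}^{\otimes q}\to V[\lambda_1,\dots,\lambda_q]$, $a_1\otimes\cdots\otimes a_q\mapsto f_{\lambda_1,\dots,\lambda_q}(a_1,\dots,a_q)$, with $f_{\lambda_1,\dots,\lambda_q}(a_1,\dots,\partial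 a_i,\dots,a_q)=-\lambda_i f_{\lambda_1,\dots,\lambda_q}(a_1,\dots,a_q)$ for all $i$, and skew-symmetric under simultaneous permutations of the $a_i$ and the $\lambda_i$. Also $\widetilde{C}^0(\mathcal{A},V)=V$. The differential is $$(\mathbf{d}f)_{\lambda_1,\dots,\lambda_{q+1}}(a_1,\dots,a_{q+1})=\sum_{k}(-1)^{k+1}a_{k\,\lambda_k}f_{\lambda_1,\dots,\hat\lambda_k,\dots,\lambda_{q+1}}(a_1,\dots,\hat a_k,\dots,a_{q+1})+\sum_{k<l}(-1)^{k+l}f_{\lambda_k+\lambda_l,\lambda_1,\dots,\hat\lambda_k,\dots,\hat\lambda_l,\dots,\lambda_{q+1}}([a_{k\,\lambda_k}a_l],a_1,\dots,\hat a_k,\dots,\hat a_l,\dots,a_{q+1}),$$ with $(\mathbf{d}v)_\lambda(a)=a_\lambda v$ for $v\in V$; hats denote omission, and polynomial coefficients in the $\lambda$'s are extended linearly. One has $\mathbf{d}^2=0$. Define $(\partial f)_{\lambda_1,\dots,\lambda_q}(a_1,\dots,a_q)=(\partial^V+\sum_{k=1}^q\lambda_k)f_{\lambda_1,\dots,\lambda_q}(a_1,\dots,a_q)$; then $\mathbf{d}\partial=\partial\mathbf{d}$. The reduced complex is $C^\bullet(\mathcal{A},V)=\widetilde{C}^\bullet(\mathcal{A},V)/\partial\widetilde{C}^\bullet(\mathcal{A},V)$. The basic cohomology $\widetilde{\mathrm{H}}^\bullet(\mathcal{A},V)$ is the cohomology of $\widetilde{C}^\bullet(\mathcal{A},V)$;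 the reduced cohomology $\mathrm{H}^\bullet(\mathcal{A},V)$ is the cohomology of $C^\bullet(\mathcal{A},V)$. Dimensions are over $\mathbb{F}$. *)

theory Defs
  imports
    "HOL-Library.Poly_Mapping"
    "HOL-Library.Function_Algebras"
    "HOL-Computational_Algebra.Polynomial"
    "HOL-Combinatorics.Permutations"
    "HOL-Algebra.AbelCoset"
    "Jordan_Normal_Form.VS_Connect"
begin

section \<open>Polynomials in the formal variables with coefficients in a module\<close>

text \<open>
  \<open>'v lpoly\<close> is the space of polynomials in variables \<open>\<lambda>\<^sub>0, \<lambda>\<^sub>1, \<dots>\<close> (numbered from \<open>0\<close>) with
  coefficients in \<open>'v\<close>; its keys are the exponents of monomials. Polynomials in one variable
  \<open>\<lambda>\<close>, such as the values of a \<open>\<lambda>\<close>-bracket, are of type \<^typ>\<open>'v poly\<close>, where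
  \<open>pCons 0\<close> is the multiplication by \<open>\<lambda>\<close>.
\<close>

type_synonym 'v lpoly = "(nat \<Rightarrow>\<^sub>0 nat) \<Rightarrow>\<^sub>0 'v"

definition lam :: "nat \<Rightarrow> 'f::comm_ring_1 lpoly" where
  "lam i = Poly_Mapping.single (Poly_Mapping.single i 1) 1"

abbreviation const :: "'v::zero \<Rightarrow> 'v lpoly" where
  "const v \<equiv> Poly_Mapping.single 0 v"

text \<open>An \<open>F[\<partial>]\<close>-module is a vector space over \<open>F\<close> with an endomorphism \<open>D\<close>, the action of \<open>\<partial>\<close>.\<close>

locale partial_module = vector_space s
  for s :: "'f::field \<Rightarrow> 'v::ab_group_add \<Rightarrow> 'v" +
  fixes D :: "'v \<Rightarrow> 'v"
  assumes D_add: "D (v + w) = D v + D w"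
    and D_scale: "D (s c v) = s c (D v)"
begin

definition pscale :: "'f lpoly \<Rightarrow> 'v lpoly \<Rightarrow> 'v lpoly" where
  "pscale p P = (\<Sum>m\<in>Poly_Mapping.keys p. \<Sum>n\<in>Poly_Mapping.keys P.
     Poly_Mapping.single (m + n) (s (Poly_Mapping.lookup p m) (Poly_Mapping.lookup P n)))"

text \<open>
  \<open>\<Sum>\<^sub>n \<lambda>\<^sup>n w\<^sub>n \<mapsto> \<Sum>\<^sub>n \<sigma>\<^sup>n G(w\<^sub>n)\<close>, and the same for several variables: substitute \<open>\<sigma>\<close> (resp. \<open>\<sigma> i\<close>
  for \<open>\<lambda>\<^sub>i\<close>) and apply \<open>G\<close> to the coefficients.
\<close>

definition usubst :: "('w::zero \<Rightarrow> 'v lpoly) \<Rightarrow> 'f lpoly \<Rightarrow> 'w poly \<Rightarrow> 'v lpoly" where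
  "usubst G \<sigma> P = (\<Sum>n\<le>Polynomial.degree P. pscale (\<sigma> ^ n) (G (Polynomial.coeff P n)))"

definition msubst :: "('w::zero \<Rightarrow> 'v lpoly) \<Rightarrow> (nat \<Rightarrow> 'f lpoly) \<Rightarrow> 'w lpoly \<Rightarrow> 'v lpoly" where
  "msubst G \<sigma> P = (\<Sum>m\<in>Poly_Mapping.keys P.
     pscale (\<Prod>i\<in>Poly_Mapping.keys m. \<sigma> i ^ Poly_Mapping.lookup m i) (G (Poly_Mapping.lookup P m)))"

text \<open>
  \<open>at_lam act \<sigma> a P\<close> is \<open>a\<^bsub>\<sigma>\<^esub> P\<close> for a polynomial \<open>P\<close>, where \<open>act a v\<close> is the polynomial
  \<open>a\<^bsub>\<lambda>\<^esub> v\<close> and the action is extended linearly in the \<open>\<lambda>\<^sub>i\<close>.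
\<close>

definition at_lam :: "('a \<Rightarrow> 'v \<Rightarrow> 'v poly) \<Rightarrow> 'f lpoly \<Rightarrow> 'a \<Rightarrow> 'v lpoly \<Rightarrow> 'v lpoly" where
  "at_lam act \<sigma> a P = msubst (\<lambda>v. usubst const \<sigma> (act a v)) lam P"

text \<open>The substitution \<open>\<lambda> \<mapsto> -\<lambda> - \<partial>\<close>, with \<open>\<partial>\<close> acting on the coefficients.\<close>

definition skew_subst :: "'v poly \<Rightarrow> 'v poly" where
  "skew_subst P =
     (\<Sum>n\<le>Polynomial.degree P. ((\<lambda>R. - pCons 0 R - map_poly D R) ^^ n) [:Polynomial.coeff P n:])"

end


section \<open>Lie conformal algebras and their modules\<close>

locale lie_conformal_algebra = partial_module s D
  for s :: "'f::field \<Rightarrow> 'a::ab_group_add \<Rightarrow> 'a" and D :: "'a \<Rightarrow> 'a" +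
  fixes br :: "'a \<Rightarrow> 'a \<Rightarrow> 'a poly"
  assumes br_add_left: "br (a + b) c = br a c + br b c"
    and br_add_right: "br a (b + c) = br a b + br a c"
    and br_scale_left: "br (s k a) b = map_poly (s k) (br a b)"
    and br_scale_right: "br a (s k b) = map_poly (s k) (br a b)"
    and br_D_left: "br (D a) b = - pCons 0 (br a b)"
    and br_D_right: "br a (D b) = map_poly D (br a b) + pCons 0 (br a b)"
    and br_skew: "br a b = - skew_subst (br b a)"
    and br_jacobi:
      "at_lam br (lam 0) a (at_lam br (lam 1) b (const c)) =
         usubst (\<lambda>e. at_lam br (lam 0 + lam 1) e (const c)) (lam 0) (br a b)
         + at_lam br (lam 1) b (at_lam br (lam 0) a (const c))"

locale conformal_module =
  A: lie_conformal_algebra sA DA br + V: partial_module sV DV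
  for sA :: "'f::field \<Rightarrow> 'a::ab_group_add \<Rightarrow> 'a" and DA :: "'a \<Rightarrow> 'a"
    and br :: "'a \<Rightarrow> 'a \<Rightarrow> 'a poly"
    and sV :: "'f \<Rightarrow> 'v::ab_group_add \<Rightarrow> 'v" and DV :: "'v \<Rightarrow> 'v" +
  fixes act :: "'a \<Rightarrow> 'v \<Rightarrow> 'v poly"
  assumes act_add_left: "act (a + b) v = act a v + act b v"
    and act_add_right: "act a (v + w) = act a v + act a w"
    and act_scale_left: "act (sA k a) v = map_poly (sV k) (act a v)"
    and act_scale_right: "act a (sV k v) = map_poly (sV k) (act a v)"
    and act_D_left: "act (DA a) v = - pCons 0 (act a v)"
    and act_D_right: "act a (DV v) = map_poly DV (act a v) + pCons 0 (act a v)"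
    and act_bracket:
      "V.at_lam act (lam 0) a (V.at_lam act (lam 1) b (const v))
         - V.at_lam act (lam 1) b (V.at_lam act (lam 0) a (const v)) =
       V.usubst (\<lambda>e. V.at_lam act (lam 0 + lam 1) e (const v)) (lam 0) (br a b)"

lemma (in lie_conformal_algebra) adjoint_module: "conformal_module s D br s D br"
  by unfold_locales
    (simp_all add: br_add_left br_add_right br_scale_left br_scale_right br_D_left br_D_right
      br_jacobi[simplified])


section \<open>Quotients, cohomology and dimension\<close>

definition mod_quotient ::
  "('f, 'c, 'z) module_scheme \<Rightarrow> 'c set \<Rightarrow> ('f, 'c set) module" where
  "mod_quotient M N =
     \<lparr>carrier = a_rcosets\<^bsub>M\<^esub> N, mult = undefined, one = undefined, zero = N, add = set_add M,
      smult = (\<lambda>c X. \<Union>x\<in>X. N +>\<^bsub>M\<^esub> (c \<odot>\<^bsub>M\<^esub> x))\<rparr>"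

definition cocycles ::
  "(nat \<Rightarrow> ('f, 'c) module) \<Rightarrow> (nat \<Rightarrow> 'c \<Rightarrow> 'c) \<Rightarrow> nat \<Rightarrow> 'c set" where
  "cocycles C d q = {x \<in> carrier (C q). d q x = \<zero>\<^bsub>C (Suc q)\<^esub>}"

definition coboundaries ::
  "(nat \<Rightarrow> ('f, 'c) module) \<Rightarrow> (nat \<Rightarrow> 'c \<Rightarrow> 'c) \<Rightarrow> nat \<Rightarrow> 'c set" where
  "coboundaries C d q = (case q of 0 \<Rightarrow> {\<zero>\<^bsub>C 0\<^esub>} | Suc p \<Rightarrow> d p ` carrier (C p))"

definition cohomology ::
  "(nat \<Rightarrow> ('f, 'c) module) \<Rightarrow> (nat \<Rightarrow> 'c \<Rightarrow> 'c) \<Rightarrow> nat \<Rightarrow> ('f, 'c set) module" where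
  "cohomology C d q = mod_quotient ((C q)\<lparr>carrier := cocycles C d q\<rparr>) (coboundaries C d q)"

text \<open>
  The constant \<^const>\<open>vectorspace.dim\<close> is only meaningful for finite-dimensional vector spaces,
  hence the first two conjuncts.
\<close>

definition has_dimension :: "('f::field, 'c, 'z) module_scheme \<Rightarrow> nat \<Rightarrow> bool" where
  "has_dimension M n \<longleftrightarrow> vectorspace class_ring M \<and> vectorspace.fin_dim class_ring M \<and>
     vectorspace.dim class_ring M = n"


section \<open>Basic and reduced complexes\<close>

context conformal_module
begin

text \<open>
  A \<open>q\<close>-cochain is a function on lists of length \<open>q\<close> (extended by \<open>0\<close> to all lists); linear maps on
  the \<open>q\<close>-th tensor power are rendered as maps that are linear in each argument. A \<open>0\<close>-cochain is
  determined by its value on the empty list, a constant polynomial, i.e. an element of \<open>V\<close>.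
\<close>

type_synonym (in -) ('b, 'w) cochain = "'b list \<Rightarrow> 'w lpoly"

text \<open>\<open>cochain_at f [\<sigma>\<^sub>1, \<dots>, \<sigma>\<^sub>q] [a\<^sub>1, \<dots>, a\<^sub>q]\<close> is \<open>f\<^bsub>\<sigma>\<^sub>1,\<dots>,\<sigma>\<^sub>q\<^esub>(a\<^sub>1, \<dots>, a\<^sub>q)\<close>.\<close>

definition cochain_at :: "('a, 'v) cochain \<Rightarrow> 'f lpoly list \<Rightarrow> 'a list \<Rightarrow> 'v lpoly" where
  "cochain_at f \<sigma>s as = V.msubst const (\<lambda>i. \<sigma>s ! i) (f as)"

definition cochains :: "nat \<Rightarrow> ('a, 'v) cochain set" where
  "cochains q = {f.
     (\<forall>as. length as \<noteq> q \<longrightarrow> f as = 0) \<and>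
     (\<forall>as. \<forall>m\<in>Poly_Mapping.keys (f as). Poly_Mapping.keys m \<subseteq> {..<q}) \<and>
     (\<forall>as i a b. length as = q \<and> i < q \<longrightarrow>
        f (as[i := a + b]) = f (as[i := a]) + f (as[i := b])) \<and>
     (\<forall>as i c a. length as = q \<and> i < q \<longrightarrow>
        f (as[i := sA c a]) = Poly_Mapping.map (sV c) (f (as[i := a]))) \<and>
     (\<forall>as i a. length as = q \<and> i < q \<longrightarrow>
        f (as[i := DA a]) = - V.pscale (lam i) (f (as[i := a]))) \<and>
     (\<forall>as \<pi>. length as = q \<and> \<pi> permutes {..<q} \<longrightarrow>
        cochain_at f (map lam (permute_list \<pi> [0..<q])) (permute_list \<pi> as) =
          V.pscale (of_int (sign \<pi>)) (f as))}"

definition cochain_space :: "nat \<Rightarrow> ('f, ('a, 'v) cochain) module" where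
  "cochain_space q =
     \<lparr>carrier = cochains q, mult = undefined, one = undefined, zero = 0, add = (+),
      smult = (\<lambda>c f as. Poly_Mapping.map (sV c) (f as))\<rparr>"

text \<open>Indices are shifted by one with respect to \<open>1, \<dots>, q + 1\<close>, which turns \<open>(-1)\<^bsup>k+1\<^esup>\<close> into \<open>(-1)\<^bsup>k\<^esup>\<close>.\<close>

definition diff :: "nat \<Rightarrow> ('a, 'v) cochain \<Rightarrow> ('a, 'v) cochain" where
  "diff q f as =
     (if length as \<noteq> Suc q then 0 else
       (\<Sum>k<Suc q. V.pscale ((-1) ^ k)
          (V.at_lam act (lam k) (as ! k)
             (cochain_at f (map lam (nths [0..<Suc q] (- {k}))) (nths as (- {k}))))) +
       (\<Sum>l<Suc q. \<Sum>k<l. V.pscale ((-1) ^ (k + l))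
          (V.usubst
             (\<lambda>c. cochain_at f ((lam k + lam l) # map lam (nths [0..<Suc q] (- {k, l})))
                    (c # nths as (- {k, l})))
             (lam k) (br (as ! k) (as ! l)))))"

definition del :: "nat \<Rightarrow> ('a, 'v) cochain \<Rightarrow> ('a, 'v) cochain" where
  "del q f as = Poly_Mapping.map DV (f as) + V.pscale (\<Sum>k<q. lam k) (f as)"

definition reduced_space :: "nat \<Rightarrow> ('f, ('a, 'v) cochain set) module" where
  "reduced_space q = mod_quotient (cochain_space q) (del q ` cochains q)"

definition reduced_diff :: "nat \<Rightarrow> ('a, 'v) cochain set \<Rightarrow> ('a, 'v) cochain set" where
  "reduced_diff q X =
     (\<Union>f\<in>X. del (Suc q) ` cochains (Suc q) +>\<^bsub>cochain_space (Suc q)\<^esub> diff q f)"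

definition basic_cohomology :: "nat \<Rightarrow> ('f, ('a, 'v) cochain set) module" where
  "basic_cohomology = cohomology cochain_space diff"

definition reduced_cohomology :: "nat \<Rightarrow> ('f, ('a, 'v) cochain set set) module" where
  "reduced_cohomology = cohomology reduced_space reduced_diff"

end


section \<open>The Schr\<ouml>dinger-Virasoro Lie conformal algebra\<close>

datatype sv_gen = L_gen | M_gen | Y_gen

lemma UNIV_sv_gen: "UNIV = {L_gen, M_gen, Y_gen}"
  using sv_gen.exhaust by blast

text \<open>Free module over \<^typ>\<open>'f poly\<close>, the polynomial ring \<open>F[\<partial>]\<close>, on the three generators.\<close>

type_synonym 'f sv = "sv_gen \<Rightarrow>\<^sub>0 'f poly"

definition sv_mult :: "'f::field_char_0 poly \<Rightarrow> 'f sv \<Rightarrow> 'f sv" where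
  "sv_mult p v = Poly_Mapping.map ((*) p) v"

definition sv_scale :: "'f::field_char_0 \<Rightarrow> 'f sv \<Rightarrow> 'f sv" where
  "sv_scale c = sv_mult [:c:]"

definition sv_D :: "'f::field_char_0 sv \<Rightarrow> 'f sv" where
  "sv_D = sv_mult [:0, 1:]"

definition sv_of :: "sv_gen \<Rightarrow> 'f::field_char_0 sv" where
  "sv_of g = Poly_Mapping.single g 1"

text \<open>The coefficients of \<open>\<lambda>\<^sup>0\<close> and \<open>\<lambda>\<^sup>1\<close> of the brackets of generators.\<close>

fun sv_gen_bracket :: "sv_gen \<Rightarrow> sv_gen \<Rightarrow> 'f::field_char_0 sv poly" where
  "sv_gen_bracket L_gen L_gen = [:sv_D (sv_of L_gen), sv_scale 2 (sv_of L_gen):]"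
| "sv_gen_bracket L_gen M_gen = [:sv_D (sv_of M_gen), sv_of M_gen:]"
| "sv_gen_bracket L_gen Y_gen = [:sv_D (sv_of Y_gen), sv_scale (3/2) (sv_of Y_gen):]"
| "sv_gen_bracket M_gen L_gen = [:0, sv_of M_gen:]"
| "sv_gen_bracket Y_gen L_gen =
     [:sv_scale (1/2) (sv_D (sv_of Y_gen)), sv_scale (3/2) (sv_of Y_gen):]"
| "sv_gen_bracket Y_gen Y_gen = [:sv_D (sv_of M_gen), sv_scale 2 (sv_of M_gen):]"
| "sv_gen_bracket M_gen M_gen = 0"
| "sv_gen_bracket M_gen Y_gen = 0"
| "sv_gen_bracket Y_gen M_gen = 0"

text \<open>\<open>op_poly T p R\<close> is \<open>p(T) R\<close> for an operator \<open>T\<close>.\<close>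

definition op_poly ::
  "('f::field_char_0 sv poly \<Rightarrow> 'f sv poly) \<Rightarrow> 'f poly \<Rightarrow> 'f sv poly \<Rightarrow> 'f sv poly" where
  "op_poly T p R =
     (\<Sum>i\<le>Polynomial.degree p. map_poly (sv_scale (Polynomial.coeff p i)) ((T ^^ i) R))"

text \<open>
  Sesquilinear extension of the bracket of generators:
  \<open>[p(\<partial>)g\<^bsub>\<lambda>\<^esub> r(\<partial>)h] = p(-\<lambda>) r(\<partial> + \<lambda>) [g\<^bsub>\<lambda>\<^esub> h]\<close>.
\<close>

definition sv_bracket :: "'f::field_char_0 sv \<Rightarrow> 'f sv \<Rightarrow> 'f sv poly" where
  "sv_bracket a b = (\<Sum>g\<in>UNIV. \<Sum>h\<in>UNIV.
     op_poly (\<lambda>R. - pCons 0 R) (Poly_Mapping.lookup a g)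
       (op_poly (\<lambda>R. map_poly sv_D R + pCons 0 R) (Poly_Mapping.lookup b h)
         (sv_gen_bracket g h)))"


section \<open>Calculus of coefficientwise substitution\<close>

lemma lpoly_induct [case_names zero single add]:
  fixes P :: "'v::ab_group_add lpoly"
  assumes "Q 0" "\<And>m v. Q (Poly_Mapping.single m v)" "\<And>P R. Q P \<Longrightarrow> Q R \<Longrightarrow> Q (P + R)"
  shows "Q P"
proof (induction P rule: Poly_Mapping.update_induct)
  case const
  show ?case by (rule assms(1))
next
  case (update f a b)
  have "Poly_Mapping.update a b f = f + Poly_Mapping.single a b"
    using update(1) by (intro poly_mapping_eqI)
      (auto simp: lookup_update lookup_add lookup_single in_keys_iff when_def)
  then show ?case using assms(2,3) update by simp
qed

context partial_module
begin

lemma D_0 [simp]: "D 0 = 0"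
  using D_add[of 0 0] by simp

lemma D_minus: "D (- v) = - D v"
  using D_add[of v "- v"] by (simp add: eq_neg_iff_add_eq_0 add.commute)

lemma pscale_expand:
  assumes "finite A" "finite B" "Poly_Mapping.keys p \<subseteq> A" "Poly_Mapping.keys P \<subseteq> B"
  shows "pscale p P = (\<Sum>m\<in>A. \<Sum>n\<in>B.
     Poly_Mapping.single (m + n) (s (Poly_Mapping.lookup p m) (Poly_Mapping.lookup P n)))"
proof -
  have "pscale p P = (\<Sum>m\<in>Poly_Mapping.keys p. \<Sum>n\<in>B.
     Poly_Mapping.single (m + n) (s (Poly_Mapping.lookup p m) (Poly_Mapping.lookup P n)))"
    unfolding pscale_def using assms
    by (intro sum.cong refl sum.mono_neutral_left) (auto simp: in_keys_iff)
  also have "\<dots> = (\<Sum>m\<in>A. \<Sum>n\<in>B.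
     Poly_Mapping.single (m + n) (s (Poly_Mapping.lookup p m) (Poly_Mapping.lookup P n)))"
    using assms by (intro sum.mono_neutral_left) (auto simp: in_keys_iff)
  finally show ?thesis .
qed

lemma pscale_0 [simp]: "pscale 0 P = 0" "pscale p 0 = 0"
  by (simp_all add: pscale_def)

lemma pscale_add_left: "pscale (p + r) P = pscale p P + pscale r P"
proof -
  let ?A = "Poly_Mapping.keys p \<union> Poly_Mapping.keys r" and ?B = "Poly_Mapping.keys P"
  have "Poly_Mapping.keys (p + r) \<subseteq> ?A" by (rule keys_add)
  then show ?thesis
    by (simp add: pscale_expand[of ?A ?B] lookup_add scale_left_distrib single_add sum.distrib)
qed

lemma pscale_add_right: "pscale p (P + R) = pscale p P + pscale p R"
proof -
  let ?B = "Poly_Mapping.keys P \<union> Poly_Mapping.keys R" and ?A = "Poly_Mapping.keys p"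
  have "Poly_Mapping.keys (P + R) \<subseteq> ?B" by (rule keys_add)
  then show ?thesis
    by (simp add: pscale_expand[of ?A ?B] lookup_add scale_right_distrib single_add sum.distrib)
qed

lemma pscale_single:
  "pscale (Poly_Mapping.single m c) (Poly_Mapping.single n v) = Poly_Mapping.single (m + n) (s c v)"
  by (simp add: pscale_expand[of "{m}" "{n}"])

lemma pscale_minus_left: "pscale (- p) P = - pscale p P"
  using pscale_add_left[of p "- p" P] by (simp add: eq_neg_iff_add_eq_0 add.commute)

lemma pscale_minus_right: "pscale p (- P) = - pscale p P"
  using pscale_add_right[of p P "- P"] by (simp add: eq_neg_iff_add_eq_0 add.commute)

lemma pscale_mult: "pscale (p * r) P = pscale p (pscale r P)"
proof (induction p rule: lpoly_induct)
  case (single m c)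
  show ?case
  proof (induction r rule: lpoly_induct)
    case (single k d)
    show ?case
      by (induction P rule: lpoly_induct)
        (simp_all add: pscale_add_right pscale_single mult_single add.assoc)
  qed (simp_all add: pscale_add_left pscale_add_right algebra_simps)
qed (simp_all add: pscale_add_left algebra_simps)

lemma pscale_1 [simp]: "pscale 1 P = P"
  by (induction P rule: lpoly_induct)
    (simp_all add: pscale_add_right pscale_single flip: single_one)

lemma pscale_sum_right: "pscale p (sum f A) = (\<Sum>x\<in>A. pscale p (f x))"
  by (induction A rule: infinite_finite_induct) (simp_all add: pscale_add_right)

lemma usubst_expand:
  assumes "G 0 = 0" "Polynomial.degree P \<le> N"
  shows "usubst G \<sigma> P = (\<Sum>n\<le>N. pscale (\<sigma> ^ n) (G (Polynomial.coeff P n)))"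
  unfolding usubst_def using assms
  by (intro sum.mono_neutral_left) (auto simp: coeff_eq_0)

lemma usubst_0: "G 0 = 0 \<Longrightarrow> usubst G \<sigma> 0 = 0"
  by (simp add: usubst_def)

lemma usubst_pCons:
  assumes "G 0 = 0"
  shows "usubst G \<sigma> (pCons a P) = G a + pscale \<sigma> (usubst G \<sigma> P)"
proof -
  have "usubst G \<sigma> (pCons a P) =
      (\<Sum>n\<le>Suc (Polynomial.degree P). pscale (\<sigma> ^ n) (G (Polynomial.coeff (pCons a P) n)))"
    using assms by (intro usubst_expand degree_pCons_le)
  then show ?thesis
    by (simp add: sum.atMost_Suc_shift usubst_def pscale_sum_right pscale_mult del: sum.atMost_Suc)
qed

lemma usubst_add:
  assumes "\<And>v w. G (v + w) = G v + G w"
  shows "usubst G \<sigma> (P + R) = usubst G \<sigma> P + usubst G \<sigma> R"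
proof -
  have G0: "G 0 = 0" using assms[of 0 0] by simp
  let ?N = "max (Polynomial.degree P) (Polynomial.degree R)"
  have "Polynomial.degree (P + R) \<le> ?N" by (rule degree_add_le_max)
  then show ?thesis
    by (simp add: usubst_expand[of _ _ ?N] G0 assms pscale_add_right sum.distrib)
qed

lemma msubst_expand:
  assumes "G 0 = 0" "finite A" "Poly_Mapping.keys P \<subseteq> A"
  shows "msubst G \<sigma> P = (\<Sum>m\<in>A.
     pscale (\<Prod>i\<in>Poly_Mapping.keys m. \<sigma> i ^ Poly_Mapping.lookup m i) (G (Poly_Mapping.lookup P m)))"
  unfolding msubst_def using assms
  by (intro sum.mono_neutral_left) (auto simp: in_keys_iff)

lemma msubst_0 [simp]: "msubst G \<sigma> 0 = 0"
  by (simp add: msubst_def)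

lemma msubst_add:
  assumes "\<And>v w. G (v + w) = G v + G w"
  shows "msubst G \<sigma> (P + R) = msubst G \<sigma> P + msubst G \<sigma> R"
proof -
  have G0: "G 0 = 0" using assms[of 0 0] by simp
  let ?A = "Poly_Mapping.keys P \<union> Poly_Mapping.keys R"
  have "Poly_Mapping.keys (P + R) \<subseteq> ?A" by (rule keys_add)
  then show ?thesis
    by (simp add: msubst_expand[of _ ?A] G0 assms lookup_add pscale_add_right sum.distrib)
qed

lemma lam_power: "lam i ^ n = (Poly_Mapping.single (Poly_Mapping.single i n) 1 :: 'f lpoly)"
  by (induction n) (simp_all add: lam_def mult_single flip: single_add)

lemma lam_monomial:
  "(\<Prod>i\<in>Poly_Mapping.keys m. lam i ^ Poly_Mapping.lookup m i) =
     (Poly_Mapping.single m 1 :: 'f lpoly)"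
proof -
  have *: "(\<Prod>i\<in>A. lam i ^ Poly_Mapping.lookup m i) =
     (Poly_Mapping.single (\<Sum>i\<in>A. Poly_Mapping.single i (Poly_Mapping.lookup m i)) 1 :: 'f lpoly)"
    if "finite A" for A
    using that by (induction A) (simp_all add: lam_power mult_single)
  have "(\<Sum>i\<in>Poly_Mapping.keys m. Poly_Mapping.single i (Poly_Mapping.lookup m i)) = m"
    by (rule poly_mapping_eqI) (auto simp: lookup_sum lookup_single when_def in_keys_iff)
  with * show ?thesis by simp
qed

lemma msubst_lam_single:
  assumes "G 0 = 0"
  shows "msubst G lam (Poly_Mapping.single m v) = pscale (Poly_Mapping.single m 1) (G v)"
  by (simp add: msubst_expand[of G "{m}"] assms lam_monomial)

abbreviation mapD :: "'v lpoly \<Rightarrow> 'v lpoly" where "mapD \<equiv> Poly_Mapping.map D"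

lemma lookup_mapD: "Poly_Mapping.lookup (mapD P) m = D (Poly_Mapping.lookup P m)"
  by (simp add: Poly_Mapping.map.rep_eq when_def)

lemma mapD_0 [simp]: "mapD 0 = 0"
  by (rule poly_mapping_eqI) (simp add: lookup_mapD)

lemma mapD_add: "mapD (P + R) = mapD P + mapD R"
  by (rule poly_mapping_eqI) (simp add: lookup_mapD lookup_add D_add)

lemma mapD_single: "mapD (Poly_Mapping.single m v) = Poly_Mapping.single m (D v)"
  by (rule poly_mapping_eqI) (simp add: lookup_mapD lookup_single when_def)

lemma mapD_pscale: "mapD (pscale p P) = pscale p (mapD P)"
proof (induction p rule: lpoly_induct)
  case (single m c)
  show ?case
    by (induction P rule: lpoly_induct)
      (simp_all add: pscale_add_right mapD_add pscale_single mapD_single D_scale)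
qed (simp_all add: pscale_add_left mapD_add)

end


text \<open>The axioms of a Lie conformal algebra, except for skew-symmetry and the Jacobi identity.\<close>

locale lambda_bracket = partial_module s D
  for s :: "'f::field \<Rightarrow> 'a::ab_group_add \<Rightarrow> 'a" and D :: "'a \<Rightarrow> 'a" +
  fixes br :: "'a \<Rightarrow> 'a \<Rightarrow> 'a poly"
  assumes br_add_left: "br (a + b) c = br a c + br b c"
    and br_add_right: "br a (b + c) = br a b + br a c"
    and br_scale_left: "br (s k a) b = map_poly (s k) (br a b)"
    and br_scale_right: "br a (s k b) = map_poly (s k) (br a b)"
    and br_D_left: "br (D a) b = - pCons 0 (br a b)"
    and br_D_right: "br a (D b) = map_poly D (br a b) + pCons 0 (br a b)"
begin

abbreviation ev :: "'f lpoly \<Rightarrow> 'a poly \<Rightarrow> 'a lpoly" where "ev \<equiv> usubst const"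

lemma ev_add: "ev \<sigma> (P + R) = ev \<sigma> P + ev \<sigma> R"
  by (rule usubst_add) (rule single_add)

lemma ev_0: "ev \<sigma> 0 = 0" 
  by (rule usubst_0) simp

lemma ev_pCons: "ev \<sigma> (pCons a P) = const a + pscale \<sigma> (ev \<sigma> P)"
  by (rule usubst_pCons) simp

lemma ev_minus: "ev \<sigma> (- P) = - ev \<sigma> P"
  using ev_add[of \<sigma> P "- P"] by (simp add: ev_0 eq_neg_iff_add_eq_0 add.commute)

lemma ev_scale: "ev \<sigma> (map_poly (s c) P) = pscale (const c) (ev \<sigma> P)"
  by (induction P)
    (simp_all add: ev_0 map_poly_pCons ev_pCons pscale_add_right pscale_single mult.commute
      flip: pscale_mult)

lemma ev_D: "ev \<sigma> (map_poly D P) = mapD (ev \<sigma> P)"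
  by (induction P)
    (simp_all add: ev_0 map_poly_pCons ev_pCons mapD_add mapD_single mapD_pscale)

abbreviation app :: "'f lpoly \<Rightarrow> 'a \<Rightarrow> 'a lpoly \<Rightarrow> 'a lpoly" where "app \<equiv> at_lam br"

lemma br_0 [simp]: "br 0 b = 0" "br a 0 = 0"
  using br_add_left[of 0 0 b] br_add_right[of a 0 0] by simp_all

lemma app_0 [simp]: "app \<sigma> a 0 = 0"
  by (simp add: at_lam_def)

lemma app_add: "app \<sigma> a (P + R) = app \<sigma> a P + app \<sigma> a R"
  unfolding at_lam_def by (rule msubst_add) (simp add: br_add_right ev_add)

lemma app_minus: "app \<sigma> a (- P) = - app \<sigma> a P"
  using app_add[of \<sigma> a P "- P"] by (simp add: eq_neg_iff_add_eq_0 add.commute)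

lemma app_single:
  "app \<sigma> a (Poly_Mapping.single m v) = pscale (Poly_Mapping.single m 1) (ev \<sigma> (br a v))"
  unfolding at_lam_def by (rule msubst_lam_single) (simp add: ev_0)

lemma app_const: "app \<sigma> a (const v) = ev \<sigma> (br a v)"
  by (simp add: app_single)

lemma app_pscale: "app \<sigma> a (pscale p P) = pscale p (app \<sigma> a P)"
proof (induction p rule: lpoly_induct)
  case (single m c)
  show ?case
  proof (induction P rule: lpoly_induct)
    case (single n v)
    show ?case
      by (simp add: pscale_single app_single br_scale_right ev_scale mult_single flip: pscale_mult)
  qed (simp_all add: pscale_add_right app_add)
qed (simp_all add: pscale_add_left app_add)

lemma app_D_arg: "app \<sigma> a (mapD P) = mapD (app \<sigma> a P) + pscale \<sigma> (app \<sigma> a P)"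
  by (induction P rule: lpoly_induct)
    (simp_all add: app_add mapD_add mapD_single app_single br_D_right ev_add ev_D ev_pCons
      pscale_add_right mapD_pscale mult.commute flip: pscale_mult)

lemma app_add_left: "app \<sigma> (a + b) P = app \<sigma> a P + app \<sigma> b P"
  by (induction P rule: lpoly_induct)
    (simp_all add: app_add app_single br_add_left ev_add pscale_add_right)

lemma app_zero_left [simp]: "app \<sigma> 0 P = 0"
  using app_add_left[of \<sigma> 0 0 P] by simp

lemma app_minus_left: "app \<sigma> (- a) P = - app \<sigma> a P"
  using app_add_left[of \<sigma> a "- a" P] by (simp add: eq_neg_iff_add_eq_0 add.commute)

lemma app_scale_left: "app \<sigma> (s c a) P = pscale (const c) (app \<sigma> a P)"
  by (induction P rule: lpoly_induct)
    (simp_all add: app_add app_single br_scale_left ev_scale pscale_add_right mult.commute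
      flip: pscale_mult)

lemma app_D_left: "app \<sigma> (D a) P = - pscale \<sigma> (app \<sigma> a P)"
  by (induction P rule: lpoly_induct)
    (simp_all add: app_add app_single br_D_left ev_minus ev_pCons pscale_add_right 
      pscale_minus_right mult.commute flip: pscale_mult)

definition brapp :: "'f lpoly \<Rightarrow> 'f lpoly \<Rightarrow> 'a lpoly \<Rightarrow> 'a poly \<Rightarrow> 'a lpoly" where
  "brapp \<tau> \<sigma> P Q = usubst (\<lambda>e. app \<tau> e P) \<sigma> Q"

definition jac :: "'a \<Rightarrow> 'a \<Rightarrow> 'a \<Rightarrow> 'a lpoly" where
  "jac a b c = app (lam 0) a (app (lam 1) b (const c))
     - brapp (lam 0 + lam 1) (lam 0) (const c) (br a b)
     - app (lam 1) b (app (lam 0) a (const c))"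

lemma br_app_add:
  "brapp \<tau> \<sigma> P (Q + R) = brapp \<tau> \<sigma> P Q + brapp \<tau> \<sigma> P R"
  unfolding brapp_def by (rule usubst_add) (rule app_add_left)

lemma br_app_0: "brapp \<tau> \<sigma> P 0 = 0"
  unfolding brapp_def by (rule usubst_0) simp

lemma br_app_pCons:
  "brapp \<tau> \<sigma> P (pCons a Q) = app \<tau> a P + pscale \<sigma> (brapp \<tau> \<sigma> P Q)"
  unfolding brapp_def by (rule usubst_pCons) simp

lemma br_app_minus: "brapp \<tau> \<sigma> P (- Q) = - brapp \<tau> \<sigma> P Q"
  using br_app_add[of \<tau> \<sigma> P Q "- Q"] by (simp add: br_app_0 eq_neg_iff_add_eq_0 add.commute)

lemma br_app_scale:
  "brapp \<tau> \<sigma> P (map_poly (s c) Q) = pscale (const c) (brapp \<tau> \<sigma> P Q)"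
  by (induction Q)
    (simp_all add: br_app_0 map_poly_pCons br_app_pCons pscale_add_right app_scale_left mult.commute
      flip: pscale_mult)

lemma br_app_D:
  "brapp \<tau> \<sigma> P (map_poly D Q) = - pscale \<tau> (brapp \<tau> \<sigma> P Q)"
  by (induction Q)
    (simp_all add: br_app_0 map_poly_pCons br_app_pCons pscale_add_right app_D_left
      pscale_minus_right mult.commute flip: pscale_mult)

lemma br_app_add_arg:
  "brapp \<tau> \<sigma> (P + R) Q = brapp \<tau> \<sigma> P Q + brapp \<tau> \<sigma> R Q"
  by (induction Q) (simp_all add: br_app_0 br_app_pCons app_add pscale_add_right)

lemma br_app_pscale_arg:
  "brapp \<tau> \<sigma> (pscale p P) Q = pscale p (brapp \<tau> \<sigma> P Q)"
  by (induction Q)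
    (simp_all add: br_app_0 br_app_pCons app_pscale pscale_add_right mult.commute flip: pscale_mult)

lemma br_app_D_arg:
  "brapp \<tau> \<sigma> (mapD P) Q =
     mapD (brapp \<tau> \<sigma> P Q) + pscale \<tau> (brapp \<tau> \<sigma> P Q)"
  by (induction Q)
    (simp_all add: br_app_0 br_app_pCons app_D_arg mapD_add mapD_pscale pscale_add_right
      mult.commute flip: pscale_mult)

end

context lambda_bracket begin

lemma jac_add:
  "jac (a + a') b c = jac a b c + jac a' b c"
  "jac a (b + b') c = jac a b c + jac a b' c"
  "jac a b (c + c') = jac a b c + jac a b c'"
  by (simp_all add: jac_def app_add_left app_add br_app_add br_app_add_arg br_add_left br_add_right
      single_add)

lemma const_scale: "const (s k c) = pscale (const k) (const c)"
  by (simp add: pscale_single)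

lemma pscale_diff: "pscale p (P - R) = pscale p P - pscale p R"
  using pscale_add_right[of p P "- R"] by (simp add: pscale_minus_right)

lemma jac_scale:
  "jac (s k a) b c = pscale (const k) (jac a b c)"
  "jac a (s k b) c = pscale (const k) (jac a b c)"
  "jac a b (s k c) = pscale (const k) (jac a b c)"
  unfolding jac_def const_scale
  by (simp_all only: app_scale_left app_pscale br_app_scale br_app_pscale_arg br_scale_left
      br_scale_right pscale_diff)

lemma jac_D:
  "jac (D a) b c = - pscale (lam 0) (jac a b c)"
  "jac a (D b) c = - pscale (lam 1) (jac a b c)"
  "jac a b (D c) = mapD (jac a b c) + pscale (lam 0 + lam 1) (jac a b c)"
proof -
  show "jac (D a) b c = - pscale (lam 0) (jac a b c)"
    by (simp add: jac_def app_D_left app_minus app_pscale br_app_minus br_app_pCons br_app_0 br_D_left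
        pscale_diff pscale_minus_right)
  show "jac a (D b) c = - pscale (lam 1) (jac a b c)"
    by (simp add: jac_def app_D_left app_minus app_pscale br_app_minus br_app_pCons br_D_right
        pscale_diff pscale_minus_right br_app_add br_app_D pscale_add_left)
  have *: "mapD (P - R) = mapD P - mapD R" for P R
    by (rule poly_mapping_eqI)
      (metis D_add D_minus ab_group_add_class.ab_diff_conv_add_uminus lookup_mapD lookup_minus)
  show "jac a b (D c) = mapD (jac a b c) + pscale (lam 0 + lam 1) (jac a b c)"
    unfolding jac_def mapD_single[symmetric]
    by (simp add: app_D_arg app_add app_pscale br_app_D_arg
        * pscale_diff pscale_add_left pscale_add_right mapD_add algebra_simps del: map_single)
qed

definition skw :: "'a \<Rightarrow> 'a \<Rightarrow> 'a poly" where
  "skw a b = br a b + skew_subst (br b a)"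

lemma map_D_add: "map_poly D (P + R) = map_poly D P + map_poly D R"
  by (rule poly_eqI) (simp add: coeff_map_poly D_add)

lemma map_D_minus: "map_poly D (- P) = - map_poly D P"
  by (rule poly_eqI) (simp add: coeff_map_poly D_minus)

lemma map_s_add: "map_poly (s k) (P + R) = map_poly (s k) P + map_poly (s k) R"
  by (rule poly_eqI) (simp add: coeff_map_poly scale_right_distrib)

lemma map_s_minus: "map_poly (s k) (- P) = - map_poly (s k) P"
  by (rule poly_eqI) (simp add: coeff_map_poly)

lemma map_s_D: "map_poly (s k) (map_poly D P) = map_poly D (map_poly (s k) P)"
  by (rule poly_eqI) (simp add: coeff_map_poly D_scale)

definition skT :: "'a poly \<Rightarrow> 'a poly" where "skT R = - pCons 0 R - map_poly D R"

lemma skT_add: "skT (P + R) = skT P + skT R"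
proof -
  have "pCons 0 (P + R) = pCons 0 P + pCons (0::'a) R" by simp
  then show ?thesis by (simp only: skT_def map_D_add) (simp add: algebra_simps)
qed

lemma skT_0: "skT 0 = 0"
  by (simp add: skT_def)

lemma map_s_diff: "map_poly (s k) (P - R) = map_poly (s k) P - map_poly (s k) R"
  by (rule poly_eqI) (simp add: coeff_map_poly scale_right_diff_distrib)

lemma map_D_diff: "map_poly D (P - R) = map_poly D P - map_poly D R"
  using map_D_add[of P "- R"] by (simp add: map_D_minus)

lemma skT_s: "skT (map_poly (s k) P) = map_poly (s k) (skT P)"
  unfolding skT_def map_s_diff map_s_D map_s_minus by (simp add: map_poly_pCons)

lemma skT_D: "skT (map_poly D P) = map_poly D (skT P)"
  unfolding skT_def map_D_diff map_D_minus by (simp add: map_poly_pCons)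

lemma skTn_add: "(skT ^^ n) (P + R) = (skT ^^ n) P + (skT ^^ n) R"
  by (induction n) (simp_all add: skT_add)

lemma skTn_0: "(skT ^^ n) 0 = 0"
  by (induction n) (simp_all add: skT_0)

lemma skew_subst_skT:
  "skew_subst P = (\<Sum>n\<le>Polynomial.degree P. (skT ^^ n) [:Polynomial.coeff P n:])"
  by (simp only: skew_subst_def skT_def[abs_def])

lemma skew_expand:
  assumes "Polynomial.degree P \<le> N"
  shows "skew_subst P = (\<Sum>n\<le>N. (skT ^^ n) [:Polynomial.coeff P n:])"
  unfolding skew_subst_skT using assms
  by (intro sum.mono_neutral_left) (auto simp: coeff_eq_0 skTn_0)

lemma skew_0: "skew_subst 0 = 0"
  by (simp add: skew_subst_def)

lemma skew_add: "skew_subst (P + R) = skew_subst P + skew_subst R"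
proof -
  let ?N = "max (Polynomial.degree P) (Polynomial.degree R)"
  have *: "[:a + b:] = [:a:] + [:b:]" for a b :: 'a by simp
  have "Polynomial.degree (P + R) \<le> ?N" by (rule degree_add_le_max)
  then show ?thesis
    by (simp only: skew_expand[of _ ?N] max.cobounded1 max.cobounded2 coeff_add * skTn_add
        sum.distrib)
qed

lemma skT_sum: "skT (sum f A) = (\<Sum>x\<in>A. skT (f x))"
proof (induction A rule: infinite_finite_induct)
qed (simp_all add: skT_0 skT_add)

lemma skew_pCons: "skew_subst (pCons a P) = [:a:] + skT (skew_subst P)"
proof -
  have "skew_subst (pCons a P) =
      (\<Sum>n\<le>Suc (Polynomial.degree P). (skT ^^ n) [:Polynomial.coeff (pCons a P) n:])"
    by (intro skew_expand degree_pCons_le)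
  also have "\<dots> = [:a:] + (\<Sum>n\<le>Polynomial.degree P. skT ((skT ^^ n) [:Polynomial.coeff P n:]))"
    by (simp only: sum.atMost_Suc_shift funpow.simps o_apply id_apply coeff_pCons_0 coeff_pCons_Suc)
  finally show ?thesis
    by (simp only: skew_subst_skT skT_sum)
qed

lemma skew_minus: "skew_subst (- P) = - skew_subst P"
  using skew_add[of P "- P"] by (simp add: skew_0 eq_neg_iff_add_eq_0 add.commute)

lemma skew_s: "skew_subst (map_poly (s k) P) = map_poly (s k) (skew_subst P)"
proof (induction P)
  case (pCons a P)
  then show ?case
    by (simp only: map_poly_pCons scale_zero_right skew_pCons skT_s map_s_add) (simp add: map_poly_pCons)
qed (simp add: skew_0)

lemma skew_D: "skew_subst (map_poly D P) = map_poly D (skew_subst P)"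
proof (induction P)
  case (pCons a P)
  then show ?case
    by (simp only: map_poly_pCons D_0 skew_pCons skT_D map_D_add) (simp add: map_poly_pCons)
qed (simp add: skew_0)

lemma skw_add:
  "skw (a + a') b = skw a b + skw a' b"
  "skw a (b + b') = skw a b + skw a b'"
  by (simp_all add: skw_def br_add_left br_add_right skew_add)

lemma skw_s:
  "skw (s k a) b = map_poly (s k) (skw a b)"
  "skw a (s k b) = map_poly (s k) (skw a b)"
  by (simp_all add: skw_def br_scale_left br_scale_right skew_s map_s_add)

lemma skw_D:
  "skw (D a) b = - pCons 0 (skw a b)"
  "skw a (D b) = map_poly D (skw a b) + pCons 0 (skw a b)"
proof -
  have *: "pCons 0 (P + R) = pCons 0 P + pCons (0::'a) R" for P R by simp
  show "skw (D a) b = - pCons 0 (skw a b)" "skw a (D b) = map_poly D (skw a b) + pCons 0 (skw a b)"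
    by (simp_all add: skw_def br_D_left br_D_right skew_add skew_D skew_minus skew_pCons map_D_add
        map_D_minus skT_def * del: add_pCons)
qed

lemma lie_conformal_algebraI:
  assumes span: "\<And>T v. \<lbrakk>S \<subseteq> T; \<And>v w. v \<in> T \<Longrightarrow> w \<in> T \<Longrightarrow> v + w \<in> T;
      \<And>k v. v \<in> T \<Longrightarrow> s k v \<in> T; \<And>v. v \<in> T \<Longrightarrow> D v \<in> T\<rbrakk> \<Longrightarrow> v \<in> T"
    and skew: "\<And>a b. a \<in> S \<Longrightarrow> b \<in> S \<Longrightarrow> skw a b = 0"
    and jac: "\<And>a b c. a \<in> S \<Longrightarrow> b \<in> S \<Longrightarrow> c \<in> S \<Longrightarrow> jac a b c = 0"
  shows "lie_conformal_algebra s D br"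
proof -
  have s1: "skw a b = 0" if "b \<in> S" for a b
    using span[of "{a. \<forall>b\<in>S. skw a b = 0}" a] that skew
    by (auto simp: skw_add skw_s skw_D)
  have s2: "skw a b = 0" for a b
    using span[of "{b. skw a b = 0}" b] s1
    by (auto simp: skw_add skw_s skw_D)
  have j1: "jac a b c = 0" if "b \<in> S" "c \<in> S" for a b c
    using span[of "{a. \<forall>b\<in>S. \<forall>c\<in>S. jac a b c = 0}" a] that jac
    by (auto simp: jac_add jac_scale jac_D)
  have j2: "jac a b c = 0" if "c \<in> S" for a b c
    using span[of "{b. \<forall>c\<in>S. jac a b c = 0}" b] that j1
    by (auto simp: jac_add jac_scale jac_D[simplified])
  have j3: "jac a b c = 0" for a b c
    using span[of "{c. jac a b c = 0}" c] j2
    by (auto simp: jac_add jac_scale jac_D)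
  show ?thesis
  proof
    fix a b c
    show "br a b = - skew_subst (br b a)"
      using s2[of a b] by (simp add: skw_def eq_neg_iff_add_eq_0)
    show "app (lam 0) a (app (lam 1) b (const c)) =
         usubst (\<lambda>e. app (lam 0 + lam 1) e (const c)) (lam 0) (br a b)
         + app (lam 1) b (app (lam 0) a (const c))"
      using j3[of a b c] by (simp add: jac_def brapp_def algebra_simps)
  qed (simp_all add: br_add_left br_add_right br_scale_left br_scale_right br_D_left br_D_right)
qed

end

section \<open>The bracket satisfies the axioms\<close>

lemma lookup_sv_mult: "Poly_Mapping.lookup (sv_mult p v) g = p * Poly_Mapping.lookup v g"
  by (simp add: sv_mult_def Poly_Mapping.map.rep_eq when_def)

lemma sv_mult_add: "sv_mult p (v + w) = sv_mult p v + sv_mult p w"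
  "sv_mult (p + q) v = sv_mult p v + sv_mult q v"
  by (rule poly_mapping_eqI, simp add: lookup_sv_mult lookup_add algebra_simps)+

lemma sv_mult_mult: "sv_mult p (sv_mult q v) = sv_mult (p * q) v"
  by (rule poly_mapping_eqI) (simp add: lookup_sv_mult)

lemma sv_mult_0: "sv_mult 0 v = 0" "sv_mult p 0 = 0"
  by (rule poly_mapping_eqI, simp add: lookup_sv_mult)+

lemma sv_mult_1: "sv_mult 1 v = v"
  by (rule poly_mapping_eqI) (simp add: lookup_sv_mult)

interpretation SV_V: partial_module sv_scale "sv_D :: 'f::field_char_0 sv \<Rightarrow> 'f sv"
  by unfold_locales
    (simp_all add: sv_scale_def sv_D_def sv_mult_add sv_mult_mult mult.commute sv_mult_1
      flip: sv_mult_add(2) one_pCons)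

lemma sv_span:
  assumes S: "range sv_of \<subseteq> T" and add: "\<And>v w. v \<in> T \<Longrightarrow> w \<in> T \<Longrightarrow> v + w \<in> T"
    and sc: "\<And>k v. v \<in> T \<Longrightarrow> sv_scale k v \<in> T" and D: "\<And>v. v \<in> T \<Longrightarrow> sv_D v \<in> T"
  shows "v \<in> T"
proof -
  have gT: "sv_of g \<in> T" for g using S by blast
  have 0: "0 \<in> T" using sc[OF gT, of 0 L_gen] by (simp add: sv_scale_def sv_mult_0)
  have m: "sv_mult p (sv_of g) \<in> T" for p g
  proof (induction p)
    case 0
    then show ?case using \<open>0 \<in> T\<close> by (simp add: sv_mult_0)
  next
    case (pCons c p)
    have *: "pCons c p = [:c:] + [:0, 1:] * p" by simp
    have "sv_mult (pCons c p) (sv_of g) = sv_scale c (sv_of g) + sv_D (sv_mult p (sv_of g))"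
      unfolding sv_scale_def sv_D_def sv_mult_mult sv_mult_add(2)[symmetric] * ..
    then show ?case using add sc D gT pCons by simp
  qed
  have "v = (\<Sum>g\<in>UNIV. sv_mult (Poly_Mapping.lookup v g) (sv_of g))"
    by (rule poly_mapping_eqI)
      (auto simp: UNIV_sv_gen lookup_add lookup_sv_mult sv_of_def lookup_single when_def
        split: if_splits, metis sv_gen.exhaust)
  moreover have "(\<Sum>g\<in>UNIV. sv_mult (Poly_Mapping.lookup v g) (sv_of g)) \<in> T"
    by (simp add: UNIV_sv_gen add m)
  ultimately show ?thesis by simp
qed

abbreviation sc :: "'f::field_char_0 \<Rightarrow> 'f sv poly \<Rightarrow> 'f sv poly" where
  "sc c \<equiv> map_poly (sv_scale c)"

abbreviation svU :: "'f::field_char_0 sv poly \<Rightarrow> 'f sv poly" where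
  "svU \<equiv> \<lambda>R. map_poly sv_D R + pCons 0 R"

lemma sc_simps:
  "sc c (P + R) = sc c P + sc c R" "sc (c + d) P = sc c P + sc d P" "sc c (sc d P) = sc (c * d) P"
  "sc 1 P = P" "sc 0 P = 0"
  by (rule poly_eqI, simp add: coeff_map_poly SV_V.scale_right_distrib SV_V.scale_left_distrib)+

definition sv_lin :: "('f::field_char_0 sv poly \<Rightarrow> 'f sv poly) \<Rightarrow> bool" where
  "sv_lin T \<longleftrightarrow> (\<forall>P R. T (P + R) = T P + T R) \<and> (\<forall>c P. T (sc c P) = sc c (T P))"

lemma sv_lin_0: "sv_lin T \<Longrightarrow> T 0 = 0"
  unfolding sv_lin_def by (metis sc_simps(5))

lemma sv_lin_sum: "sv_lin T \<Longrightarrow> T (sum f A) = (\<Sum>x\<in>A. T (f x))"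
  by (induction A rule: infinite_finite_induct) (simp_all add: sv_lin_0, simp add: sv_lin_def)

lemma sv_lin_pow: "sv_lin T \<Longrightarrow> sv_lin (T ^^ n)"
  by (induction n) (simp_all add: sv_lin_def)

lemma sv_lin_sc: "sv_lin (sc c)"
  by (simp add: sv_lin_def sc_simps mult.commute)

lemma sv_lin_minus: "sv_lin (\<lambda>R. - pCons 0 R)"
  unfolding sv_lin_def
  by (auto intro!: poly_eqI simp: coeff_map_poly coeff_pCons split: nat.split)

lemma sv_lin_svU: "sv_lin svU"
  unfolding sv_lin_def
  by (auto intro!: poly_eqI simp: coeff_map_poly coeff_pCons SV_V.D_add SV_V.D_scale
      SV_V.scale_right_distrib split: nat.split)

lemma op_poly_expand:
  assumes "Polynomial.degree p \<le> N"
  shows "op_poly T p R = (\<Sum>i\<le>N. sc (Polynomial.coeff p i) ((T ^^ i) R))"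
  unfolding op_poly_def using assms
  by (intro sum.mono_neutral_left) (auto simp: coeff_eq_0 sc_simps)

lemma op_poly_add: "op_poly T (p + q) R = op_poly T p R + op_poly T q R"
proof -
  let ?N = "max (Polynomial.degree p) (Polynomial.degree q)"
  have "Polynomial.degree (p + q) \<le> ?N" by (rule degree_add_le_max)
  then show ?thesis by (simp add: op_poly_expand[of _ ?N] sc_simps sum.distrib)
qed

lemma op_poly_pCons: "sv_lin T \<Longrightarrow> op_poly T (pCons 0 p) R = T (op_poly T p R)"
proof -
  assume T: "sv_lin T"
  have "op_poly T (pCons 0 p) R =
      (\<Sum>n\<le>Suc (Polynomial.degree p). sc (Polynomial.coeff (pCons 0 p) n) ((T ^^ n) R))"
    by (intro op_poly_expand degree_pCons_le)
  also have "\<dots> = (\<Sum>n\<le>Polynomial.degree p. T (sc (Polynomial.coeff p n) ((T ^^ n) R)))"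
    using T by (simp only: sum.atMost_Suc_shift coeff_pCons_0 coeff_pCons_Suc sc_simps)
      (simp add: sv_lin_def)
  finally show ?thesis by (simp add: op_poly_def sv_lin_sum T)
qed

lemma op_poly_smult: "op_poly T (Polynomial.smult c p) R = sc c (op_poly T p R)"
  by (simp add: op_poly_expand[of _ "Polynomial.degree p"] sv_lin_sum[OF sv_lin_sc] sc_simps)

lemma op_poly_comm:
  assumes "sv_lin U" "\<And>R. T (U R) = U (T R)"
  shows "op_poly T p (U R) = U (op_poly T p R)"
proof -
  have "(T ^^ n) (U R) = U ((T ^^ n) R)" for n
    by (induction n) (simp_all add: assms(2))
  then show ?thesis
    using assms(1) by (simp add: op_poly_def sv_lin_sum) (simp add: sv_lin_def)
qed

lemma op_poly_add_arg: "sv_lin T \<Longrightarrow> op_poly T p (P + R) = op_poly T p P + op_poly T p R"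
  using sv_lin_pow[of T]
  by (simp add: op_poly_def sv_lin_def sc_simps sum.distrib)

lemma op_poly_1: "op_poly T 1 R = R"
  by (simp add: op_poly_def sc_simps)

lemma sum_pCons_0: "(\<Sum>x\<in>A. - pCons 0 (f x)) = - pCons (0::'a::ab_group_add) (sum f A)"
  by (induction A rule: infinite_finite_induct) simp_all

lemma sv_bracket_gen: "sv_bracket (sv_of g) (sv_of h) = sv_gen_bracket g h"
proof -
  have op0: "op_poly T 0 R = 0" for T and R :: "'a sv poly"
    by (simp add: op_poly_def sc_simps)
  have op00: "op_poly (\<lambda>R. - pCons 0 R) p 0 = 0" for p :: "'a poly"
    using op_poly_add_arg[OF sv_lin_minus, of p 0 0] by simp
  show ?thesis
    by (cases g; cases h) (simp_all add: sv_bracket_def UNIV_sv_gen sv_of_def lookup_single when_def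
        op0 op00 op_poly_1)
qed

interpretation SV_B: lambda_bracket sv_scale "sv_D :: 'f::field_char_0 sv \<Rightarrow> 'f sv" sv_bracket
proof
  fix a a' b b' :: "'f sv" and k :: 'f
  have lk: "Poly_Mapping.lookup (sv_scale k a) g = Polynomial.smult k (Poly_Mapping.lookup a g)"
    "Poly_Mapping.lookup (sv_D a) g = pCons 0 (Poly_Mapping.lookup a g)" for k g and a :: "'f sv"
    by (simp_all add: sv_scale_def sv_D_def lookup_sv_mult)
  show "sv_bracket (a + a') b = sv_bracket a b + sv_bracket a' b"
    by (simp only: sv_bracket_def lookup_add op_poly_add sum.distrib)
  show "sv_bracket a (b + b') = sv_bracket a b + sv_bracket a b'"
    by (simp only: sv_bracket_def lookup_add op_poly_add op_poly_add_arg sv_lin_minus sum.distrib)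
  show "sv_bracket (sv_scale k a) b = sc k (sv_bracket a b)"
    by (simp only: sv_bracket_def lk op_poly_smult sv_lin_sum[OF sv_lin_sc])
  have "op_poly (\<lambda>R. - pCons 0 R) p (sc k R) = sc k (op_poly (\<lambda>R. - pCons 0 R) p R)" for p R
    using sv_lin_minus by (intro op_poly_comm sv_lin_sc) (unfold sv_lin_def, blast)
  then show "sv_bracket a (sv_scale k b) = sc k (sv_bracket a b)"
    by (simp only: sv_bracket_def lk op_poly_smult sv_lin_sum[OF sv_lin_sc])
  show "sv_bracket (sv_D a) b = - pCons 0 (sv_bracket a b)"
    by (simp only: sv_bracket_def lk op_poly_pCons sv_lin_minus sum_pCons_0)
  have U: "op_poly (\<lambda>R. - pCons 0 R) p (svU R) = svU (op_poly (\<lambda>R. - pCons 0 R) p R)"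
    for p :: "'f poly" and R
    by (rule op_poly_comm[OF sv_lin_svU])
      (auto intro!: poly_eqI simp: coeff_map_poly coeff_pCons SV_V.D_minus split: nat.split)
  show "sv_bracket a (sv_D b) = map_poly sv_D (sv_bracket a b) + pCons 0 (sv_bracket a b)"
    by (simp only: sv_bracket_def lk op_poly_pCons sv_lin_svU U sv_lin_sum[OF sv_lin_svU])
qed

lemma sv_skw: "SV_B.skw (sv_of g) (sv_of h) = (0 :: 'f::field_char_0 sv poly)"
proof -
  have h: "sv_scale (1/2) v + sv_scale (1/2) v = v" "sv_scale 2 v = v + v"
    "sv_scale (3/2) v = v + sv_scale (1/2) v" for v :: "'f sv"
    by (simp_all flip: SV_V.scale_left_distrib) 
      (simp_all add: SV_V.scale_left_distrib[of 1 1, simplified] 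
        SV_V.scale_left_distrib[of 1 "1/2", simplified] flip: SV_V.scale_left_distrib)
  show ?thesis
    by (cases g; cases h)
      (simp_all add: SV_B.skw_def sv_bracket_gen SV_B.skew_pCons SV_B.skew_0 SV_B.skT_def
        map_poly_pCons SV_B.map_D_add SV_B.map_D_minus SV_V.D_add SV_V.D_minus SV_V.D_scale h)
qed

text \<open>\<open>\<alpha> g + \<beta> \<partial>g + \<gamma> \<partial>\<^sup>2g\<close> for a generator \<open>g\<close>.\<close>

definition Phi :: "sv_gen \<Rightarrow> 'f lpoly \<Rightarrow> 'f lpoly \<Rightarrow> 'f lpoly \<Rightarrow> 'f::field_char_0 sv lpoly" where
  "Phi g \<alpha> \<beta> \<gamma> = SV_V.pscale \<alpha> (const (sv_of g)) + SV_V.pscale \<beta> (SV_V.mapD (const (sv_of g)))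
     + SV_V.pscale \<gamma> (SV_V.mapD (SV_V.mapD (const (sv_of g))))"

lemma Phi_add: "Phi g a b c + Phi g a' b' c' = Phi g (a + a') (b + b') (c + c')"
  by (simp add: Phi_def SV_V.pscale_add_left algebra_simps del: map_single)

lemma Phi_minus: "- Phi g a b c = Phi g (- a) (- b) (- c)"
  by (simp add: Phi_def SV_V.pscale_minus_left del: map_single)

lemma Phi_diff: "Phi g a b c - Phi g a' b' c' = Phi g (a - a') (b - b') (c - c')"
  using Phi_add[of g a b c "- a'" "- b'" "- c'"] by (simp flip: Phi_minus)

lemma Phi_scale: "SV_V.pscale p (Phi g a b c) = Phi g (p * a) (p * b) (p * c)"
  by (simp add: Phi_def SV_V.pscale_add_right SV_V.pscale_mult del: map_single)

lemma Phi_D: "SV_V.mapD (Phi g a b 0) = Phi g 0 a b"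
  by (simp add: Phi_def SV_V.mapD_add SV_V.mapD_pscale del: map_single)

lemma Phi_0: "Phi g 0 0 0 = 0"
  by (simp add: Phi_def)

lemma Phi_const: "const (sv_of g) = Phi g 1 0 0"
  by (simp add: Phi_def)

lemma app_Phi:
  "SV_B.app \<sigma> e (Phi g a b 0) = SV_V.pscale a (SV_B.app \<sigma> e (Phi g 1 0 0)) +
     SV_V.pscale b (SV_V.mapD (SV_B.app \<sigma> e (Phi g 1 0 0)) + SV_V.pscale \<sigma> (SV_B.app \<sigma> e (Phi g 1 0 0)))"
  by (simp add: Phi_def SV_B.app_add SV_B.app_pscale SV_B.app_D_arg del: map_single)

abbreviation hf :: "'f::field_char_0 lpoly" where "hf \<equiv> const (1/2)"

lemma hf: "2 * (hf :: 'f::field_char_0 lpoly) = 1"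
  by (simp add: mult_single flip: single_numeral)

lemma const_scale2: "SV_V.pscale (const 2) P = SV_V.pscale 2 P"
  by simp

lemma const_32: "const (3/2) = 3 * (hf :: 'f::field_char_0 lpoly)"
  by (simp add: mult_single flip: single_numeral)

lemma const_scale32: "SV_V.pscale (const (3/2)) P = SV_V.pscale (3 * hf) (P :: 'f::field_char_0 sv lpoly)"
  by (simp add: mult_single flip: single_numeral)

lemma ev_gen_const: "const (sv_D v) = SV_V.mapD (const v)" "const (sv_scale k v) = SV_V.pscale (const k) (const v)"
  by (simp_all add: SV_V.pscale_single)

lemma app_gen:
  "SV_B.app \<sigma> (sv_of L_gen) (Phi L_gen 1 0 0) = Phi L_gen (2 * \<sigma>) 1 0"
  "SV_B.app \<sigma> (sv_of L_gen) (Phi M_gen 1 0 0) = Phi M_gen \<sigma> 1 0"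
  "SV_B.app \<sigma> (sv_of L_gen) (Phi Y_gen 1 0 0) = Phi Y_gen (3 * hf * \<sigma>) 1 0"
  "SV_B.app \<sigma> (sv_of M_gen) (Phi L_gen 1 0 0) = Phi M_gen \<sigma> 0 0"
  "SV_B.app \<sigma> (sv_of M_gen) (Phi M_gen 1 0 0) = 0"
  "SV_B.app \<sigma> (sv_of M_gen) (Phi Y_gen 1 0 0) = 0"
  "SV_B.app \<sigma> (sv_of Y_gen) (Phi L_gen 1 0 0) = Phi Y_gen (3 * hf * \<sigma>) hf 0"
  "SV_B.app \<sigma> (sv_of Y_gen) (Phi M_gen 1 0 0) = 0"
  "SV_B.app \<sigma> (sv_of Y_gen) (Phi Y_gen 1 0 0) = Phi M_gen (2 * \<sigma>) 1 0"
  unfolding Phi_const[symmetric] SV_B.app_const sv_bracket_gen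
  by (simp_all only: sv_gen_bracket.simps SV_B.ev_pCons SV_B.ev_0 ev_gen_const const_scale2 const_scale32
      Phi_const Phi_D Phi_scale Phi_add single_zero)
    (simp_all add: const_32 mult_ac SV_V.pscale_add_right Phi_scale Phi_add Phi_D)

lemmas app_gen_Phi =
  app_Phi[of _ "sv_of L_gen" L_gen, unfolded app_gen] app_Phi[of _ "sv_of L_gen" M_gen, unfolded app_gen]
  app_Phi[of _ "sv_of L_gen" Y_gen, unfolded app_gen] app_Phi[of _ "sv_of M_gen" L_gen, unfolded app_gen]
  app_Phi[of _ "sv_of M_gen" M_gen, unfolded app_gen] app_Phi[of _ "sv_of M_gen" Y_gen, unfolded app_gen]
  app_Phi[of _ "sv_of Y_gen" L_gen, unfolded app_gen] app_Phi[of _ "sv_of Y_gen" M_gen, unfolded app_gen]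
  app_Phi[of _ "sv_of Y_gen" Y_gen, unfolded app_gen]

lemma Phi_eq_0: "a = 0 \<Longrightarrow> b = 0 \<Longrightarrow> Phi g a b 0 = 0"
  by (simp add: Phi_0)

lemma const_2: "const 2 = (2 :: 'f::field_char_0 lpoly)"
  by simp

lemma sv_jac: "SV_B.jac (sv_of f) (sv_of g) (sv_of h) = (0 :: 'f::field_char_0 sv lpoly)"
proof -
  obtain x y t :: "'f lpoly" where t: "2 * t = 1" and xyt: "lam 0 = x" "lam 1 = y" "hf = t"
    using hf by blast
  show ?thesis
    unfolding SV_B.jac_def sv_bracket_gen Phi_const
    apply (induct f; induct g; induct h; simp only: sv_gen_bracket.simps;
        simp only: app_gen_Phi SV_B.br_app_pCons SV_B.br_app_0 SV_B.app_D_left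
          SV_B.app_scale_left const_scale2 const_scale32 Phi_D Phi_scale Phi_add Phi_minus Phi_diff
          SV_B.app_0 SV_V.pscale_0 mult_zero_right mult_zero_left add_0_left add_0_right diff_self
          Phi_0 SV_V.mapD_0 SV_B.app_zero_left mult_1_right minus_zero diff_zero diff_0;
        rule Phi_eq_0)
    apply (unfold const_2 const_32 xyt)
    apply (rule refl | Groebner_Basis.algebra | (use t in Groebner_Basis.algebra))+
    done
qed

theorem sv_lie_conformal_algebra:
  "lie_conformal_algebra sv_scale (sv_D :: 'f::field_char_0 sv \<Rightarrow> 'f sv) sv_bracket"
proof (rule SV_B.lie_conformal_algebraI[where S = "range sv_of"])
  fix T :: "'f sv set" and v
  assume "range sv_of \<subseteq> T" "\<And>v w. v \<in> T \<Longrightarrow> w \<in> T \<Longrightarrow> v + w \<in> T"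
    "\<And>k v. v \<in> T \<Longrightarrow> sv_scale k v \<in> T" "\<And>v. v \<in> T \<Longrightarrow> sv_D v \<in> T"
  then show "v \<in> T" by (rule sv_span)
qed (auto simp: sv_skw sv_jac)

interpretation SV: conformal_module sv_scale "sv_D :: 'f::field_char_0 sv \<Rightarrow> 'f sv" sv_bracket
    sv_scale sv_D sv_bracket
  by (rule lie_conformal_algebra.adjoint_module) (rule sv_lie_conformal_algebra)

end

theory Submission
  imports Defs
begin

text \<open>
  The proof replaces cochains by their coefficients. For a generator \<open>g\<close> let \<open>g\<^sub>(\<^sub>n\<^sub>)\<close> stand for the coefficient of
  \<open>\<lambda>\<^sup>n/n!\<close>; these symbols span the annihilation Lie algebra of \<open>SV\<close>, in which
  \<open>[g\<^sub>(\<^sub>m\<^sub>), h\<^sub>(\<^sub>n\<^sub>)]\<close> is always a multiple of a single basis element, and which acts on \<open>SV\<close> by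
  \<open>g\<^sub>(\<^sub>n\<^sub>) v\<close> = coefficient of \<open>\<lambda>\<^sup>n/n!\<close> in \<open>[g\<^sub>\<lambda> v]\<close>. By sesquilinearity a \<open>q\<close>-cochain is the same as an
  alternating function on words of \<open>q\<close> basis elements with values in \<open>SV\<close> that, for given generators,
  is non-zero at finitely many words only (\<open>cochains_iff\<close>, \<open>phi_inject\<close>, \<open>phi_psi\<close>). Under this dictionary
  the differential becomes the Chevalley-Eilenberg differential (\<open>phi_diff\<close>) and the derivation \<open>\<partial>\<close>
  becomes the Lie derivative along \<open>L\<^sub>(\<^sub>0\<^sub>)\<close> (\<open>phi_del\<close>).

  On functions of words the differential has a recursive description, namely Cartan's formula
  \<open>\<iota>\<^sub>x d = \<L>\<^sub>x - d \<iota>\<^sub>x\<close>, where \<open>\<iota>\<^sub>x\<close> prepends the letter \<open>x\<close>. Taken as the definition of \<open>d\<close>, it reduces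
  \<open>[\<L>\<^sub>x, d] = 0\<close> and \<open>d\<^sup>2 = 0\<close> to inductions on the word (\<open>lie_basis.lie_ce\<close>, \<open>lie_basis.ce_ce\<close>).

  The Lie derivative along \<open>L\<^sub>(\<^sub>1\<^sub>)\<close> is diagonal: it multiplies each coefficient by its conformal weight.
  Being homotopic to zero, it forces the basic cohomology into weight zero
  (\<open>basis_mod_weight0\<close>). An alternating function vanishes on words with a repeated letter, and
  the only letters of negative weight are \<open>L\<^sub>(\<^sub>0\<^sub>)\<close> (weight -1) and \<open>Y\<^sub>(\<^sub>0\<^sub>)\<close> (weight -1/2), while values in \<open>SV\<close>
  have weight at least 1. Hence the complex of weight zero has a basis of twelve
  elements, one for each of the words
  \<open>L\<^sub>0, L\<^sub>0L\<^sub>1, L\<^sub>0M\<^sub>0, L\<^sub>0L\<^sub>1M\<^sub>0, L\<^sub>0Y\<^sub>0Y\<^sub>1, L\<^sub>0L\<^sub>1Y\<^sub>0Y\<^sub>1, L\<^sub>0M\<^sub>0Y\<^sub>0Y\<^sub>1, L\<^sub>0L\<^sub>1M\<^sub>0Y\<^sub>0Y\<^sub>1\<close> (with value \<open>M\<close>) and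
  \<open>L\<^sub>0Y\<^sub>0, L\<^sub>0L\<^sub>1Y\<^sub>0, L\<^sub>0M\<^sub>0Y\<^sub>0, L\<^sub>0L\<^sub>1M\<^sub>0Y\<^sub>0\<close> (with value \<open>Y\<close>). Its differential is computed in \<open>ce_E\<close>, and linear algebra gives
  the dimensions 1, 2, 1 in degrees 1, 2, 3 (\<open>model_basis\<close>).

  For the reduced complex, \<open>\<partial>\<close> is injective on cochains since it is injective on the free module \<open>SV\<close>
  (\<open>lie_L0_inject\<close>), and it is homotopic to zero via \<open>\<iota>\<close> for the letter \<open>L\<^sub>(\<^sub>0\<^sub>)\<close>. So the long exact
  sequence of \<open>0 \<rightarrow> \<partial>C \<rightarrow> C \<rightarrow> C/\<partial>C \<rightarrow> 0\<close> splits, and the reduced cohomology in degree \<open>q\<close> has as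
  dimension the sum of the basic ones in degrees \<open>q\<close> and \<open>q + 1\<close> (\<open>basis_reduced\<close>), that is
  1, 3, 3, 1 in degrees 0 to 3.
\<close>


section \<open>Dimensions of quotients\<close>

definition coset :: "'c::ab_group_add set \<Rightarrow> 'c \<Rightarrow> 'c set" where
  "coset B x = (\<lambda>b. b + x) ` B"

locale scaled_space = vector_space scale
  for scale :: "'f::field \<Rightarrow> 'c::ab_group_add \<Rightarrow> 'c"
begin

text \<open>
  \<open>M\<close> is a model of the quotient \<open>Z/B\<close> with quotient map \<open>K\<close>. In this form both the cohomology of
  a complex and that of a complex of quotients are treated alike: the latter is a quotient by cosets whose
  elements are cosets, but it is still presented by two subspaces of the original space.
\<close>

definition presents :: "('f, 'm, 'z) module_scheme \<Rightarrow> ('c \<Rightarrow> 'm) \<Rightarrow> 'c set \<Rightarrow> 'c set \<Rightarrow> bool" where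
  "presents M K Z B \<longleftrightarrow> subspace Z \<and> subspace B \<and> B \<subseteq> Z \<and> carrier M = K ` Z \<and> \<zero>\<^bsub>M\<^esub> = K 0 \<and>
     (\<forall>x\<in>Z. \<forall>y\<in>Z. K x = K y \<longleftrightarrow> x - y \<in> B) \<and>
     (\<forall>x\<in>Z. \<forall>y\<in>Z. K x \<oplus>\<^bsub>M\<^esub> K y = K (x + y)) \<and>
     (\<forall>c. \<forall>x\<in>Z. c \<odot>\<^bsub>M\<^esub> K x = K (scale c x))"

text \<open>
  The classes of \<open>b 0, \<dots>, b (n - 1)\<close> form a basis of \<open>Z/B\<close>.
\<close>

definition basis_mod :: "'c set \<Rightarrow> 'c set \<Rightarrow> nat \<Rightarrow> (nat \<Rightarrow> 'c) \<Rightarrow> bool" where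
  "basis_mod Z B n b \<longleftrightarrow> (\<forall>i<n. b i \<in> Z) \<and>
     (\<forall>z\<in>Z. \<exists>u. z - (\<Sum>i<n. scale (u i) (b i)) \<in> B) \<and>
     (\<forall>u. (\<Sum>i<n. scale (u i) (b i)) \<in> B \<longrightarrow> (\<forall>i<n. u i = 0))"

lemma presents_vectorspace:
  assumes "presents M K Z B"
  shows "vectorspace class_ring M"
proof -
  note p = assms[unfolded presents_def]
  have Z: "subspace Z" and car: "carrier M = K ` Z" and zero: "\<zero>\<^bsub>M\<^esub> = K 0" using p by auto
  have add: "K x \<oplus>\<^bsub>M\<^esub> K y = K (x + y)" if "x \<in> Z" "y \<in> Z" for x y using p that by blast
  have sm: "c \<odot>\<^bsub>M\<^esub> K x = K (scale c x)" if "x \<in> Z" for x c using p that by blast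
  note cl = subspace_0[OF Z] subspace_add[OF Z] subspace_scale[OF Z] subspace_neg[OF Z]
  have ag: "abelian_group M"
  proof (rule abelian_groupI)
    fix x assume "x \<in> carrier M"
    then obtain a where a: "x = K a" "a \<in> Z" by (auto simp: car)
    show "\<exists>y\<in>carrier M. y \<oplus>\<^bsub>M\<^esub> x = \<zero>\<^bsub>M\<^esub>"
      using a cl by (intro bexI[of _ "K (- a)"]) (auto simp: car add zero)
  qed (auto simp: car zero add cl algebra_simps)
  show ?thesis
    unfolding vectorspace_def
  proof (intro conjI Module.module.intro ag Module.module_axioms.intro)
    show "field (class_ring :: 'f ring)" by (rule class_field)
    show "cring (class_ring :: 'f ring)" by (rule class_cring.is_cring)
    fix a b :: 'f and x y assume "x \<in> carrier M"
    then obtain v where v: "v \<in> Z" "x = K v" by (auto simp: car)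
    show "a \<odot>\<^bsub>M\<^esub> x \<in> carrier M" using v cl by (simp add: car sm)
    show "(a \<oplus>\<^bsub>class_ring\<^esub> b) \<odot>\<^bsub>M\<^esub> x = a \<odot>\<^bsub>M\<^esub> x \<oplus>\<^bsub>M\<^esub> b \<odot>\<^bsub>M\<^esub> x"
      using v cl by (simp add: sm add scale_left_distrib)
    show "(a \<otimes>\<^bsub>class_ring\<^esub> b) \<odot>\<^bsub>M\<^esub> x = a \<odot>\<^bsub>M\<^esub> (b \<odot>\<^bsub>M\<^esub> x)"
      using v cl by (simp add: sm)
    show "\<one>\<^bsub>class_ring\<^esub> \<odot>\<^bsub>M\<^esub> x = x" using v by (simp add: sm)
    assume "y \<in> carrier M"
    then obtain w where w: "w \<in> Z" "y = K w" by (auto simp: car)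
    show "a \<odot>\<^bsub>M\<^esub> (x \<oplus>\<^bsub>M\<^esub> y) = a \<odot>\<^bsub>M\<^esub> x \<oplus>\<^bsub>M\<^esub> a \<odot>\<^bsub>M\<^esub> y"
      using v w cl by (simp add: sm add scale_right_distrib)
  qed
qed

text \<open>
  The vectors of length \<open>n\<close> have dimension \<open>n\<close>, and a basis modulo \<open>B\<close> gives a linear bijection from
  them onto \<open>M\<close>.
\<close>

lemma has_dimension_presents:
  assumes M: "presents M K Z B" and b: "basis_mod Z B n b"
  shows "has_dimension M n"
proof -
  note p = M[unfolded presents_def]
  have Z: "subspace Z" and B: "subspace B" and car: "carrier M = K ` Z" using p by auto
  have eq: "K x = K y \<longleftrightarrow> x - y \<in> B" if "x \<in> Z" "y \<in> Z" for x y using p that by blast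
  have add: "K x \<oplus>\<^bsub>M\<^esub> K y = K (x + y)" if "x \<in> Z" "y \<in> Z" for x y using p that by blast
  have sm: "c \<odot>\<^bsub>M\<^esub> K x = K (scale c x)" if "x \<in> Z" for x c using p that by blast
  define L where "L u = (\<Sum>i<n. scale (u i) (b i))" for u
  have LZ: "L u \<in> Z" for u
    unfolding L_def using b Z by (intro subspace_sum subspace_scale) (auto simp: basis_mod_def)
  have Lvec: "L (($) (v + w)) = L (($) v) + L (($) w)" "L (($) (c \<cdot>\<^sub>v v)) = scale c (L (($) v))"
    if "v \<in> carrier_vec n" "w \<in> carrier_vec n" for v w c
    using that by (simp_all add: L_def scale_left_distrib sum.distrib scale_sum_right)
  define T where "T v = K (L (($) v))" for v
  interpret V: vec_space "TYPE('f)" n .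
  have lin: "linear_map class_ring (module_vec TYPE('f) n) M T"
  proof (intro linear_map.intro mod_hom.intro mod_hom_axioms.intro presents_vectorspace[OF M] vec_vs)
    have *: "vectorspace class_ring M" by (rule presents_vectorspace[OF M])
    show "Module.module class_ring (module_vec TYPE('f) n)" "Module.module class_ring M"
      using * vec_vs by (auto simp: vectorspace_def)
    show "T \<in> LinearCombinations.module_hom class_ring (module_vec TYPE('f) n) M"
      by (auto simp: LinearCombinations.module_hom_def module_vec_simps T_def car LZ Lvec add sm)
  qed
  have surj: "T ` carrier (module_vec TYPE('f) n) = carrier M"
  proof
    show "T ` carrier (module_vec TYPE('f) n) \<subseteq> carrier M" by (auto simp: car T_def LZ)
    show "carrier M \<subseteq> T ` carrier (module_vec TYPE('f) n)"
    proof
      fix x assume "x \<in> carrier M"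
      then obtain z where z: "z \<in> Z" "x = K z" by (auto simp: car)
      obtain u where u: "z - L u \<in> B" using b z by (auto simp: basis_mod_def L_def)
      have "L (($) (vec n u)) = L u" by (simp add: L_def)
      then have "x = T (vec n u)" using z u LZ by (simp add: T_def eq)
      then show "x \<in> T ` carrier (module_vec TYPE('f) n)" by (auto simp: module_vec_simps)
    qed
  qed
  have inj: "inj_on T (carrier (module_vec TYPE('f) n))"
  proof (rule inj_onI)
    fix v w assume vw: "v \<in> carrier (module_vec TYPE('f) n)" "w \<in> carrier (module_vec TYPE('f) n)" "T v = T w"
    then have "L (($) v) - L (($) w) \<in> B" by (simp add: T_def eq LZ)
    moreover have "L (($) v) - L (($) w) = L (\<lambda>i. v $ i - w $ i)"
      by (simp add: L_def scale_left_diff_distrib sum_subtractf)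
    ultimately have "\<forall>i<n. v $ i - w $ i = 0" using b by (auto simp: basis_mod_def L_def)
    then show "v = w" using vw by (intro eq_vecI) (auto simp: module_vec_simps)
  qed
  interpret T: linear_map class_ring "module_vec TYPE('f) n" M T by (rule lin)
  show ?thesis
    unfolding has_dimension_def
    using T.dim_eq[OF V.fin_dim inj surj] T.surj_fin_dim[OF V.fin_dim surj] V.dim_is_n presents_vectorspace[OF M]
    by simp
qed

lemma coset_eq:
  assumes "subspace B"
  shows "coset B x = coset B y \<longleftrightarrow> x - y \<in> B"
proof
  assume "coset B x = coset B y"
  then have "0 + x \<in> coset B y" using subspace_0[OF assms] by (auto simp: coset_def)
  then show "x - y \<in> B" by (auto simp: coset_def)
next
  assume d: "x - y \<in> B"
  have "b + x \<in> coset B y" if "b \<in> B" for b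
    unfolding coset_def using subspace_add[OF assms that d] by (intro image_eqI[of _ _ "b + (x - y)"]) auto
  moreover have "b + y \<in> coset B x" if "b \<in> B" for b
    unfolding coset_def using subspace_diff[OF assms that d] by (intro image_eqI[of _ _ "b - (x - y)"]) auto
  ultimately show "coset B x = coset B y" by (auto simp: coset_def)
qed

definition sumset :: "'c set \<Rightarrow> 'c set \<Rightarrow> 'c set" where
  "sumset A B = {a + b |a b. a \<in> A \<and> b \<in> B}"

text \<open>
  This is \<open>(Z/B)/(B0/(B0 \<inter> B)) = Z/(B0 + B)\<close>, read off from the coset operations.
\<close>

lemma presents_quotient:
  assumes M: "presents M K Z B" and B0: "subspace B0" "B0 \<subseteq> Z"
  shows "presents (mod_quotient M (K ` B0)) (\<lambda>x. K ` coset B0 x) Z (sumset B0 B)"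
proof -
  note p = M[unfolded presents_def]
  have Z: "subspace Z" and B: "subspace B" "B \<subseteq> Z" and car: "carrier M = K ` Z"
    and zero: "\<zero>\<^bsub>M\<^esub> = K 0" using p by auto
  have eq: "K x = K y \<longleftrightarrow> x - y \<in> B" if "x \<in> Z" "y \<in> Z" for x y using p that by blast
  have add: "K x \<oplus>\<^bsub>M\<^esub> K y = K (x + y)" if "x \<in> Z" "y \<in> Z" for x y using p that by blast
  have sm: "c \<odot>\<^bsub>M\<^esub> K x = K (scale c x)" if "x \<in> Z" for x c using p that by blast
  note cl = subspace_0[OF Z] subspace_add[OF Z] subspace_scale[OF Z] subspace_neg[OF Z]
    subspace_diff[OF Z]
  have B0Z: "b \<in> Z" if "b \<in> B0" for b using B0 that by blast
  have rc: "(K ` B0) +>\<^bsub>M\<^esub> K x = K ` coset B0 x" if "x \<in> Z" for x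
    using that B0Z by (auto simp: a_r_coset_def r_coset_def coset_def add)
  have sub: "subspace (sumset B0 B)"
    unfolding sumset_def by (rule subspace_sums) fact+
  let ?Q = "mod_quotient M (K ` B0)"
  show ?thesis
    unfolding presents_def
  proof (intro conjI ballI allI)
    show "sumset B0 B \<subseteq> Z" using B B0 cl by (auto simp: sumset_def)
    have "carrier ?Q = (\<Union>a\<in>K ` Z. {(K ` B0) +>\<^bsub>M\<^esub> a})"
      by (simp add: mod_quotient_def A_RCOSETS_def RCOSETS_def a_r_coset_def car)
    then show "carrier ?Q = (\<lambda>x. K ` coset B0 x) ` Z" by (auto simp: rc)
    show "\<zero>\<^bsub>?Q\<^esub> = K ` coset B0 0"
      by (simp add: mod_quotient_def coset_def)
  next
    fix x y assume xy: "x \<in> Z" "y \<in> Z"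
    have "K ` coset B0 x \<oplus>\<^bsub>?Q\<^esub> K ` coset B0 y = {K (b + x + (b' + y)) |b b'. b \<in> B0 \<and> b' \<in> B0}"
      using xy B0Z cl by (auto simp: mod_quotient_def set_add_def set_mult_def coset_def add)
    also have "\<dots> = K ` coset B0 (x + y)"
    proof (intro equalityI subsetI)
      fix z assume "z \<in> {K (b + x + (b' + y)) |b b'. b \<in> B0 \<and> b' \<in> B0}"
      then obtain b b' where b: "z = K (b + x + (b' + y))" "b \<in> B0" "b' \<in> B0" by auto
      then have "z = K ((b + b') + (x + y))" by (simp add: algebra_simps)
      then show "z \<in> K ` coset B0 (x + y)" using subspace_add[OF B0(1)] b by (auto simp: coset_def)
    next
      fix z assume "z \<in> K ` coset B0 (x + y)"
      then obtain b where "z = K (b + x + (0 + y))" "b \<in> B0" by (auto simp: coset_def algebra_simps)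
      then show "z \<in> {K (b + x + (b' + y)) |b b'. b \<in> B0 \<and> b' \<in> B0}" using subspace_0[OF B0(1)] by blast
    qed
    finally show "K ` coset B0 x \<oplus>\<^bsub>?Q\<^esub> K ` coset B0 y = K ` coset B0 (x + y)" .
    have diff_sumset: "x - y \<in> sumset B0 B" if h: "x + b - (y + b') \<in> B" "b \<in> B0" "b' \<in> B0" for b b'
    proof -
      have "x - y = (b' - b) + (x + b - (y + b'))" by simp
      then show ?thesis using h subspace_diff[OF B0(1)] unfolding sumset_def by blast
    qed
    show "K ` coset B0 x = K ` coset B0 y \<longleftrightarrow> x - y \<in> sumset B0 B"
    proof
      assume "K ` coset B0 x = K ` coset B0 y"
      then have "K (0 + x) \<in> K ` coset B0 y" using subspace_0[OF B0(1)] unfolding coset_def by blast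
      then obtain b where b: "b \<in> B0" "K x = K (b + y)" by (auto simp: coset_def)
      then show "x - y \<in> sumset B0 B"
        using xy B0Z cl eq[of x "b + y"] diff_sumset[of 0 b] subspace_0[OF B0(1)] by (simp add: algebra_simps)
    next
      have *: "K ` coset B0 x \<subseteq> K ` coset B0 y" if d: "x - y \<in> sumset B0 B" and xy: "x \<in> Z" "y \<in> Z" for x y
      proof
        fix z assume "z \<in> K ` coset B0 x"
        then obtain b where b: "b \<in> B0" "z = K (b + x)" by (auto simp: coset_def)
        from d obtain c e where c: "x - y = c + e" "c \<in> B0" "e \<in> B" by (auto simp: sumset_def)
        have bx: "b + x = (b + c + y) + e" using c(1) by (simp add: algebra_simps)
        have "K (b + x) = K ((b + c) + y)"
        proof (subst eq)
          show "b + x \<in> Z" "b + c + y \<in> Z" using b c xy B0Z cl by auto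
          show "b + x - (b + c + y) \<in> B" using c by (simp add: bx)
        qed
        then show "z \<in> K ` coset B0 y"
          using b c subspace_add[OF B0(1)] by (auto simp: coset_def)
      qed
      assume d: "x - y \<in> sumset B0 B"
      then have "y - x \<in> sumset B0 B" using subspace_neg[OF sub d] by simp
      with d * xy show "K ` coset B0 x = K ` coset B0 y" by blast
    qed
  next
    fix c x assume x: "x \<in> Z"
    have "c \<odot>\<^bsub>?Q\<^esub> K ` coset B0 x = (\<Union>b\<in>B0. K ` coset B0 (scale c (b + x)))"
      using x B0Z cl by (auto simp: mod_quotient_def coset_def sm rc)
    also have "\<dots> = (\<Union>b\<in>B0. K ` coset B0 (scale c x))"
    proof (intro SUP_cong refl arg_cong[of _ _ "(`) K"])
      fix b assume "b \<in> B0"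
      then show "coset B0 (scale c (b + x)) = coset B0 (scale c x)"
        using B0(1) by (simp add: coset_eq scale_right_distrib subspace_scale)
    qed
    also have "\<dots> = K ` coset B0 (scale c x)" using subspace_0[OF B0(1)] by auto
    finally show "c \<odot>\<^bsub>?Q\<^esub> K ` coset B0 x = K ` coset B0 (scale c x)" .
  qed (use Z sub in auto)
qed

lemma presents_restrict:
  assumes "presents M K Z B" "subspace Z'" "B \<subseteq> Z'" "Z' \<subseteq> Z"
  shows "presents (M\<lparr>carrier := K ` Z'\<rparr>) K Z' B"
  using assms unfolding presents_def by (fastforce simp: subset_iff)

end


section \<open>Reduced cohomology of a complex with a homotopy for the derivation\<close>

text \<open>
  A complex with an injective endomorphism \<open>del\<close> that is homotopic to zero. That \<open>del\<close> commutes with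
  \<open>d\<close> follows from the homotopy formula.
\<close>

locale homotopy_complex = scaled_space scale
  for scale :: "'f::field \<Rightarrow> 'c::ab_group_add \<Rightarrow> 'c" +
  fixes C :: "nat \<Rightarrow> 'c set" and d del :: "nat \<Rightarrow> 'c \<Rightarrow> 'c" and iota :: "nat \<Rightarrow> 'c \<Rightarrow> 'c"
  assumes C: "subspace (C q)"
    and d_mem: "x \<in> C q \<Longrightarrow> d q x \<in> C (Suc q)"
    and d_add: "x \<in> C q \<Longrightarrow> y \<in> C q \<Longrightarrow> d q (x + y) = d q x + d q y"
    and d_scale: "x \<in> C q \<Longrightarrow> d q (scale c x) = scale c (d q x)"
    and d_d: "x \<in> C q \<Longrightarrow> d (Suc q) (d q x) = 0"
    and del_mem: "x \<in> C q \<Longrightarrow> del q x \<in> C q"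
    and del_add: "x \<in> C q \<Longrightarrow> y \<in> C q \<Longrightarrow> del q (x + y) = del q x + del q y"
    and del_scale: "x \<in> C q \<Longrightarrow> del q (scale c x) = scale c (del q x)"
    and del_inj: "x \<in> C q \<Longrightarrow> del q x = 0 \<Longrightarrow> x = 0"
    and iota_mem: "x \<in> C (Suc q) \<Longrightarrow> iota q x \<in> C q"
    and iota_add: "x \<in> C (Suc q) \<Longrightarrow> y \<in> C (Suc q) \<Longrightarrow> iota q (x + y) = iota q x + iota q y"
    and iota_scale: "x \<in> C (Suc q) \<Longrightarrow> iota q (scale c x) = scale c (iota q x)"
    and homotopy: "x \<in> C (Suc q) \<Longrightarrow> d q (iota q x) + iota (Suc q) (d (Suc q) x) = del (Suc q) x"
    and homotopy_0: "x \<in> C 0 \<Longrightarrow> iota 0 (d 0 x) = del 0 x"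
begin

definition Z :: "nat \<Rightarrow> 'c set" where "Z q = {x \<in> C q. d q x = 0}"
definition B :: "nat \<Rightarrow> 'c set" where "B q = (case q of 0 \<Rightarrow> {0} | Suc p \<Rightarrow> d p ` C p)"

lemma linear_image_subspace:
  assumes "subspace S" "\<And>x y. x \<in> S \<Longrightarrow> y \<in> S \<Longrightarrow> f (x + y) = f x + f y"
    "\<And>c x. x \<in> S \<Longrightarrow> f (scale c x) = scale c (f x)"
  shows "subspace (f ` S)"
proof (rule subspaceI)
  show "0 \<in> f ` S"
    using assms(3)[OF subspace_0[OF assms(1)], of 0] subspace_0[OF assms(1)] by (auto simp: image_iff)
  fix x y assume "x \<in> f ` S" "y \<in> f ` S"
  then show "x + y \<in> f ` S" using assms subspace_add[OF assms(1)] by (auto simp flip: assms(2))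
next
  fix c x assume "x \<in> f ` S"
  then show "scale c x \<in> f ` S" using assms subspace_scale[OF assms(1)] by (auto simp flip: assms(3))
qed

lemma zeros: "d q 0 = 0" "del q 0 = 0" "iota q 0 = 0"
  using d_scale[OF subspace_0[OF C], of q 0] del_scale[OF subspace_0[OF C], of q 0]
    iota_scale[OF subspace_0[OF C], of q 0] by simp_all

lemma C_cl: "0 \<in> C q" "x \<in> C q \<Longrightarrow> y \<in> C q \<Longrightarrow> x + y \<in> C q" "x \<in> C q \<Longrightarrow> scale c x \<in> C q"
  "x \<in> C q \<Longrightarrow> y \<in> C q \<Longrightarrow> x - y \<in> C q" "(\<And>i. i \<in> I \<Longrightarrow> f i \<in> C q) \<Longrightarrow> sum f I \<in> C q"
  by (intro subspace_0[OF C] subspace_add[OF C] subspace_scale[OF C] subspace_diff[OF C]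
    subspace_sum[OF C]; assumption)+

lemma diffs:
  "x \<in> C q \<Longrightarrow> y \<in> C q \<Longrightarrow> d q (x - y) = d q x - d q y"
  "x \<in> C q \<Longrightarrow> y \<in> C q \<Longrightarrow> del q (x - y) = del q x - del q y"
  "x \<in> C (Suc q) \<Longrightarrow> y \<in> C (Suc q) \<Longrightarrow> iota q (x - y) = iota q x - iota q y"
  using d_add[of x q "scale (-1) y"] d_scale[of y q "-1"] del_add[of x q "scale (-1) y"]
    del_scale[of y q "-1"] iota_add[of x q "scale (-1) y"] iota_scale[of y q "-1"] C_cl(3)[of y _ "-1"]
  by simp_all

lemma sum_linear_iota:
  assumes "\<And>i. i \<in> I \<Longrightarrow> g i \<in> C (Suc q)"
  shows "iota q (\<Sum>i\<in>I. scale (u i) (g i)) = (\<Sum>i\<in>I. scale (u i) (iota q (g i)))"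
  using assms
proof (induction I rule: infinite_finite_induct)
  case (insert x F)
  then show ?case by (simp add: iota_add iota_scale C_cl)
qed (simp_all add: zeros)

lemma Z: "subspace (Z q)"
  by (rule subspaceI) (auto simp: Z_def zeros C_cl d_add d_scale)

lemma B: "subspace (B q)"
proof (cases q)
  case (Suc p)
  then show ?thesis unfolding B_def by (auto intro!: linear_image_subspace C d_add d_scale)
qed (simp add: B_def)

lemma B_sub_Z: "B q \<subseteq> Z q"
  by (cases q) (auto simp: B_def Z_def zeros C_cl d_mem d_d)

lemma del_d: "x \<in> C q \<Longrightarrow> del (Suc q) (d q x) = d q (del q x)"
proof (cases q)
  case 0
  assume x: "x \<in> C q"
  then have "d 0 (iota 0 (d 0 x)) + iota 1 (d 1 (d 0 x)) = del 1 (d 0 x)"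
    using homotopy[of "d 0 x" 0] d_mem[of x 0] 0 by simp
  then show ?thesis using 0 x d_d[of x 0] by (simp add: homotopy_0 zeros)
next
  case (Suc p)
  assume x: "x \<in> C q"
  have "d q (iota q (d q x)) + iota (Suc q) (d (Suc q) (d q x)) = del (Suc q) (d q x)"
    using homotopy[of "d q x" q] d_mem[OF x] by simp
  then have 1: "d q (iota q (d q x)) = del (Suc q) (d q x)" using d_d[OF x] by (simp add: zeros)
  have "d q (del q x) = d q (d p (iota p x) + iota q (d q x))"
    using homotopy[of x p] x Suc by simp
  also have "\<dots> = d q (iota q (d q x))"
    using x Suc d_mem iota_mem by (simp add: d_add d_d)
  finally show ?thesis using 1 by simp
qed

abbreviation N :: "nat \<Rightarrow> 'c set" where "N q \<equiv> del q ` C q"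

lemma N: "subspace (N q)"
  by (rule linear_image_subspace[OF C del_add del_scale])

lemma N_sub: "N q \<subseteq> C q" using del_mem by auto

text \<open>
  The elements whose class in \<open>C/del C\<close> is a cocycle.
\<close>

definition Zr :: "nat \<Rightarrow> 'c set" where "Zr q = {x \<in> C q. d q x \<in> N (Suc q)}"

lemma Zr: "subspace (Zr q)"
  using N[of "Suc q"]
  by (intro subspaceI) (auto simp: Zr_def zeros C_cl d_add d_scale subspace_0 subspace_add subspace_scale)

lemma N_sub_Zr: "N q \<subseteq> Zr q"
  by (auto simp: Zr_def del_mem simp flip: del_d intro: d_mem)

lemma B_sub_Zr: "B q \<subseteq> Zr q"
  using B_sub_Z[of q] subspace_0[OF N] by (auto simp: Zr_def Z_def)

text \<open>
  From \<open>d x = del g\<close> one gets \<open>del (d g) = d (d x) = 0\<close>, so \<open>g\<close> is a cocycle because \<open>del\<close> is injective.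
  This cocycle represents the image of the class of \<open>x\<close> under the connecting map.
\<close>

lemma Zr_lift: "x \<in> Zr q \<Longrightarrow> \<exists>g \<in> Z (Suc q). d q x = del (Suc q) g"
proof -
  assume x: "x \<in> Zr q"
  then obtain g where g: "g \<in> C (Suc q)" "d q x = del (Suc q) g" by (auto simp: Zr_def)
  have "del (Suc (Suc q)) (d (Suc q) g) = 0"
    using x d_d[of x q] unfolding del_d[OF g(1)] g(2)[symmetric] by (simp add: Zr_def)
  then have "d (Suc q) g = 0" by (rule del_inj[OF d_mem[OF g(1)]])
  with g show ?thesis by (auto simp: Z_def)
qed

lemma del_cocycle: "x \<in> Z q \<Longrightarrow> del q x \<in> B q"
proof (cases q)
  case 0
  assume "x \<in> Z q"
  then show ?thesis using 0 homotopy_0[of x] by (simp add: B_def Z_def zeros)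
next
  case (Suc p)
  assume x: "x \<in> Z q"
  then have "del q x = d p (iota p x)"
    using homotopy[of x p] Suc by (simp add: Z_def zeros)
  then show ?thesis using x Suc iota_mem by (auto simp: B_def Z_def)
qed

text \<open>
  The connecting map \<open>[x] \<mapsto> [g]\<close>, \<open>d x = del g\<close>, from the reduced cohomology in degree \<open>q\<close> to the basic
  one in degree \<open>q + 1\<close> is split by \<open>iota\<close>, since \<open>d (iota g) = del g\<close> for a cocycle \<open>g\<close>. Its kernel is the
  basic cohomology in degree \<open>q\<close>: \<open>del\<close> of a cocycle is a coboundary.
\<close>

lemma basis_reduced:
  assumes b: "basis_mod (Z q) (B q) m b" and c: "basis_mod (Z (Suc q)) (B (Suc q)) n c"
  shows "basis_mod (Zr q) (sumset (B q) (N q)) (m + n) (\<lambda>i. if i < m then b i else iota q (c (i - m)))"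
    (is "basis_mod _ _ _ ?e")
proof -
  have bZ: "b i \<in> C q" "d q (b i) = 0" if "i < m" for i using b that by (auto simp: basis_mod_def Z_def)
  have cZ: "c i \<in> C (Suc q)" "d (Suc q) (c i) = 0" if "i < n" for i
    using c that by (auto simp: basis_mod_def Z_def)
  have split: "(\<Sum>i<m + n. scale (u i) (?e i)) =
      (\<Sum>i<m. scale (u i) (b i)) + iota q (\<Sum>i<n. scale (u (m + i)) (c i))" for u
  proof -
    have "(\<Sum>i<m + n. scale (u i) (?e i)) =
      (\<Sum>i<m. scale (u i) (b i)) + (\<Sum>i<n. scale (u (m + i)) (iota q (c i)))"
      by (induction n) (simp_all add: add.assoc)
    then show ?thesis using sum_linear_iota[of "{..<n}" c q] cZ by simp
  qed
  have d_iota: "d q (iota q g) = del (Suc q) g" if "g \<in> Z (Suc q)" for g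
    using homotopy[of g q] that by (simp add: Z_def zeros)
  have cs: "(\<Sum>i<n. scale (u i) (c i)) \<in> Z (Suc q)" for u
    using c by (intro subspace_sum[OF Z] subspace_scale[OF Z]) (auto simp: basis_mod_def)
  have bs: "(\<Sum>i<m. scale (u i) (b i)) \<in> Z q" for u
    using b by (intro subspace_sum[OF Z] subspace_scale[OF Z]) (auto simp: basis_mod_def)
  show ?thesis
    unfolding basis_mod_def
  proof (intro conjI ballI allI impI)
    fix i assume "i < m + n"
    then show "?e i \<in> Zr q"
      using bZ subspace_0[OF N] c cZ iota_mem by (auto simp: Zr_def d_iota basis_mod_def)
  next
    fix z assume z: "z \<in> Zr q"
    obtain g where g: "g \<in> Z (Suc q)" "d q z = del (Suc q) g" using Zr_lift[OF z] by auto
    obtain v where "g - (\<Sum>i<n. scale (v i) (c i)) \<in> B (Suc q)"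
      using c g by (auto simp: basis_mod_def)
    then obtain y where y: "y \<in> C q" "g = (\<Sum>i<n. scale (v i) (c i)) + d q y"
      by (auto simp: B_def algebra_simps)
    have zz: "z - iota q g \<in> Z q"
      using z g d_iota iota_mem by (simp add: Z_def Zr_def diffs C_cl)
    then obtain u where u: "z - iota q g - (\<Sum>i<m. scale (u i) (b i)) \<in> B q"
      using b by (auto simp: basis_mod_def)
    define w where "w i = (if i < m then u i else v (i - m))" for i
    have sw: "(\<Sum>i<m + n. scale (w i) (?e i)) =
      (\<Sum>i<m. scale (u i) (b i)) + iota q (\<Sum>i<n. scale (v i) (c i))"
      unfolding split by (simp add: w_def)
    \<comment> \<open>by the homotopy formula, \<open>iota (d y)\<close> and \<open>del y\<close> differ by \<open>d (iota y)\<close>\<close>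
    have "iota q (d q y) - del q y \<in> B q"
    proof (cases q)
      case 0
      then show ?thesis using y by (simp add: homotopy_0 B_def)
    next
      case (Suc p)
      then have "iota q (d q y) - del q y = d p (- iota p y)"
        using homotopy[of y p] y diffs(1)[of 0 p "iota p y"] iota_mem
        by (simp add: C_cl zeros algebra_simps)
      moreover have "- iota p y \<in> C p" using y Suc iota_mem C_cl(4)[OF C_cl(1)] by fastforce
      ultimately show ?thesis using Suc by (auto simp: B_def)
    qed
    then have "(z - iota q g - (\<Sum>i<m. scale (u i) (b i))) + (iota q (d q y) - del q y) + del q y \<in> sumset (B q) (N q)"
      unfolding sumset_def using y subspace_add[OF B u] by blast
    moreover have "iota q g = iota q (\<Sum>i<n. scale (v i) (c i)) + iota q (d q y)"
      using y cs[of v] d_mem by (simp add: iota_add Z_def)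
    ultimately have "z - (\<Sum>i<m + n. scale (w i) (?e i)) \<in> sumset (B q) (N q)"
      unfolding sw by (simp add: algebra_simps)
    then show "\<exists>u. z - (\<Sum>i<m + n. scale (u i) (?e i)) \<in> sumset (B q) (N q)" by blast
  next
    fix u i
    assume "(\<Sum>i<m + n. scale (u i) (?e i)) \<in> sumset (B q) (N q)" and i: "i < m + n"
    then obtain e y where e: "e \<in> B q" and y: "y \<in> C q"
      and s: "(\<Sum>i<m. scale (u i) (b i)) + iota q (\<Sum>i<n. scale (u (m + i)) (c i)) = e + del q y"
      unfolding split by (auto simp: sumset_def)
    define W where "W = (\<Sum>i<n. scale (u (m + i)) (c i))"
    define V where "V = (\<Sum>i<m. scale (u i) (b i))"
    have V: "V \<in> C q" "d q V = 0" using bs[of u] by (auto simp: V_def Z_def)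
    have W: "W \<in> C (Suc q)" "W \<in> Z (Suc q)" using cs[of "\<lambda>i. u (m + i)"] by (auto simp: W_def Z_def)
    have eZ: "e \<in> C q" "d q e = 0" using e B_sub_Z by (auto simp: Z_def)
    have "d q (V + iota q W) = d q (e + del q y)" using s by (simp add: V_def W_def)
    then have "del (Suc q) W = del (Suc q) (d q y)"
      using V W eZ y del_mem iota_mem by (simp add: d_add d_iota del_d)
    then have "W - d q y = 0"
      using del_inj[of "W - d q y" "Suc q"] diffs(2)[OF W(1) d_mem[OF y]] C_cl(4)[OF W(1) d_mem[OF y]] by simp
    then have Wy: "W = d q y" by simp
    then have "W \<in> B (Suc q)" using y by (auto simp: B_def)
    then have un: "\<forall>i<n. u (m + i) = 0" using c by (auto simp: basis_mod_def W_def)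
    then have "W = 0" by (simp add: W_def)
    then have yZ: "y \<in> Z q" using Wy y by (simp add: Z_def)
    have "V = e + del q y" using s un by (simp add: V_def zeros)
    then have "V \<in> B q" using subspace_add[OF B e del_cocycle[OF yZ]] by simp
    then have um: "\<forall>i<m. u i = 0" using b by (auto simp: basis_mod_def V_def)
    show "u i = 0"
      using um un[rule_format, of "i - m"] i by (cases "i < m") auto
  qed
qed

end

context homotopy_complex
begin

abbreviation space :: "nat \<Rightarrow> ('f, 'c) module" where
  "space q \<equiv> \<lparr>carrier = C q, mult = undefined, one = undefined, zero = 0, add = (+), smult = scale\<rparr>"

definition red_space :: "nat \<Rightarrow> ('f, 'c set) module" where
  "red_space q = mod_quotient (space q) (N q)"

definition red_diff :: "nat \<Rightarrow> 'c set \<Rightarrow> 'c set" where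
  "red_diff q X = (\<Union>f\<in>X. N (Suc q) +>\<^bsub>space (Suc q)\<^esub> d q f)"

lemma presents_space: "presents (space q) id (C q) {0}"
  unfolding presents_def using C C_cl by auto

lemma sumset_0: "sumset S {0} = S"
  by (auto simp: sumset_def)

lemma Z_sub_C: "Z q \<subseteq> C q" and Zr_sub_C: "Zr q \<subseteq> C q"
  by (auto simp: Z_def Zr_def)

theorem has_dimension_cohomology:
  assumes "basis_mod (Z q) (B q) n b"
  shows "has_dimension (cohomology space d q) n"
proof -
  have "presents (space q\<lparr>carrier := id ` Z q\<rparr>) id (Z q) {0}"
    by (rule presents_restrict[OF presents_space Z]) (use subspace_0[OF Z] Z_sub_C in auto)
  from presents_quotient[OF this B B_sub_Z]
  have "presents (mod_quotient (space q\<lparr>carrier := Z q\<rparr>) (B q)) (\<lambda>x. coset (B q) x) (Z q) (B q)"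
    by (simp add: sumset_0)
  moreover have "cocycles space d q = Z q" "coboundaries space d q = B q"
    by (simp_all add: cocycles_def Z_def coboundaries_def B_def split: nat.split)
  ultimately have "presents (cohomology space d q) (\<lambda>x. coset (B q) x) (Z q) (B q)"
    by (simp add: cohomology_def)
  then show ?thesis using assms by (rule has_dimension_presents)
qed

lemma presents_red_space: "presents (red_space q) (coset (N q)) (C q) (N q)"
  using presents_quotient[OF presents_space N N_sub] by (simp add: red_space_def sumset_0)

lemma a_r_coset_space: "S +>\<^bsub>space q\<^esub> x = coset S x"
  by (auto simp: a_r_coset_def r_coset_def coset_def)

lemma red_diff_coset:
  assumes "x \<in> C q"
  shows "red_diff q (coset (N q) x) = coset (N (Suc q)) (d q x)"
proof -
  have "coset (N (Suc q)) (d q (b + x)) = coset (N (Suc q)) (d q x)" if b: "b \<in> N q" for b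
  proof -
    obtain y where y: "y \<in> C q" "b = del q y" using b by blast
    then have "d q (b + x) - d q x = del (Suc q) (d q y)"
      using assms by (simp add: d_add del_mem del_d)
    then show ?thesis using y by (simp add: coset_eq[OF N] d_mem)
  qed
  then show ?thesis
    using subspace_0[OF N, of q] unfolding red_diff_def a_r_coset_space coset_def[of "N q"] by auto
qed

theorem has_dimension_reduced_cohomology:
  assumes b: "basis_mod (Z q) (B q) m b" and c: "basis_mod (Z (Suc q)) (B (Suc q)) n c"
  shows "has_dimension (cohomology red_space red_diff q) (m + n)"
proof -
  have zero: "zero (red_space p) = coset (N p) 0" for p
    by (simp add: red_space_def mod_quotient_def coset_def)
  have car: "carrier (red_space p) = coset (N p) ` C p" for p
    using presents_red_space[of p] by (simp add: presents_def)
  have "presents (red_space q\<lparr>carrier := coset (N q) ` Zr q\<rparr>) (coset (N q)) (Zr q) (N q)"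
    by (rule presents_restrict[OF presents_red_space Zr N_sub_Zr Zr_sub_C])
  from presents_quotient[OF this B B_sub_Zr]
  have "presents (mod_quotient (red_space q\<lparr>carrier := coset (N q) ` Zr q\<rparr>) (coset (N q) ` B q))
      (\<lambda>x. coset (N q) ` coset (B q) x) (Zr q) (sumset (B q) (N q))" .
  moreover have "cocycles red_space red_diff q = coset (N q) ` Zr q"
  proof -
    have "red_diff q (coset (N q) x) = zero (red_space (Suc q)) \<longleftrightarrow> d q x \<in> N (Suc q)" if "x \<in> C q" for x
      unfolding red_diff_coset[OF that] zero coset_eq[OF N] by simp
    then show ?thesis unfolding cocycles_def car Zr_def by auto
  qed
  moreover have "coboundaries red_space red_diff q = coset (N q) ` B q"
  proof (cases q)
    case 0
    then show ?thesis by (simp add: coboundaries_def B_def zero)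
  next
    case (Suc p)
    have "red_diff p ` coset (N p) ` C p = (\<lambda>x. coset (N (Suc p)) (d p x)) ` C p"
      unfolding image_image by (rule image_cong) (simp_all add: red_diff_coset)
    then show ?thesis by (simp add: coboundaries_def B_def Suc car image_image)
  qed
  ultimately have "presents (cohomology red_space red_diff q) (\<lambda>x. coset (N q) ` coset (B q) x) (Zr q) (sumset (B q) (N q))"
    by (simp add: cohomology_def)
  then show ?thesis by (rule has_dimension_presents) (rule basis_reduced[OF b c])
qed

end


section \<open>Cartan calculus for functions on words\<close>

text \<open>
  A Lie algebra with a basis such that the bracket \<open>[x, y] = c x y \<cdot> (mul x y)\<close> of two basis elements is a multiple
  of a basis element, and a module over it. The element \<open>mul x y\<close> is arbitrary where \<open>c x y = 0\<close>;
  therefore the Jacobi identity is tested on functions \<open>G\<close> of basis elements.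
\<close>

locale lie_basis = V: vector_space s
  for s :: "'f::field_char_0 \<Rightarrow> 'v::ab_group_add \<Rightarrow> 'v" +
  fixes c :: "'x \<Rightarrow> 'x \<Rightarrow> 'f" and mul :: "'x \<Rightarrow> 'x \<Rightarrow> 'x" and act :: "'x \<Rightarrow> 'v \<Rightarrow> 'v"
  assumes mul_comm: "mul x y = mul y x"
    and c_skew: "c x y = - c y x"
    and jacobi: "s (c y z * c x (mul y z)) (G (mul x (mul y z))) =
      s (c x y * c (mul x y) z) (G (mul (mul x y) z)) + s (c x z * c y (mul x z)) (G (mul y (mul x z)))"
    and act_add: "act x (v + w) = act x v + act x w"
    and act_scale: "act x (s k v) = s k (act x v)"
    and act_act: "act x (act y v) - act y (act x v) = s (c x y) (act (mul x y) v)"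
begin

abbreviation smul :: "'f \<Rightarrow> ('x list \<Rightarrow> 'v) \<Rightarrow> 'x list \<Rightarrow> 'v" where
  "smul k F \<equiv> \<lambda>xs. s k (F xs)"

definition contr :: "'x \<Rightarrow> ('x list \<Rightarrow> 'v) \<Rightarrow> 'x list \<Rightarrow> 'v" where
  "contr x F = (\<lambda>ys. F (x # ys))"

text \<open>
  The sum of \<open>c x y\<^sub>i \<cdot> F(y\<^sub>1, \<dots>, mul x y\<^sub>i, \<dots>, y\<^sub>n)\<close> over all positions \<open>i\<close>.
\<close>

primrec subst_act :: "'x \<Rightarrow> ('x list \<Rightarrow> 'v) \<Rightarrow> 'x list \<Rightarrow> 'v" where
  "subst_act x F [] = 0"
| "subst_act x F (y # ys) = s (c x y) (F (mul x y # ys)) + subst_act x (contr y F) ys"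

definition lie :: "'x \<Rightarrow> ('x list \<Rightarrow> 'v) \<Rightarrow> 'x list \<Rightarrow> 'v" where
  "lie x F = (\<lambda>ys. act x (F ys) - subst_act x F ys)"

text \<open>
  The Chevalley-Eilenberg differential, defined by Cartan's formula. For functions that are not
  alternating it is the differential of Leibniz cohomology.
\<close>

primrec ce :: "('x list \<Rightarrow> 'v) \<Rightarrow> 'x list \<Rightarrow> 'v" where
  "ce F [] = 0"
| "ce F (x # xs) = lie x F xs - ce (contr x F) xs"

lemma act_0 [simp]: "act x 0 = 0" using act_scale[of x 0 0] by simp
lemma act_minus: "act x (- v) = - act x v" using act_scale[of x "-1" v] by simp
lemma act_diff: "act x (v - w) = act x v - act x w" using act_add[of x v "- w"] by (simp add: act_minus)

lemma contr_apply: "contr x F ys = F (x # ys)" by (simp add: contr_def)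

lemma contr_linear:
  "contr x (F + G) = contr x F + contr x G" "contr x (F - G) = contr x F - contr x G"
  "contr x (smul k F) = smul k (contr x F)"
  by (auto simp: contr_def)

lemma subst_act_add: "subst_act x (F + G) ys = subst_act x F ys + subst_act x G ys"
  by (induction ys arbitrary: F G) (simp_all add: contr_linear V.scale_right_distrib)

lemma subst_act_scale: "subst_act x (smul k F) ys = s k (subst_act x F ys)"
  by (induction ys arbitrary: F) (simp_all add: contr_linear V.scale_right_distrib mult.commute)

lemma subst_act_diff: "subst_act x (F - G) ys = subst_act x F ys - subst_act x G ys"
  by (induction ys arbitrary: F G) (simp_all add: contr_linear V.scale_right_diff_distrib)

lemma lie_linear:
  "lie x (F + G) = lie x F + lie x G" "lie x (F - G) = lie x F - lie x G"
  "lie x (smul k F) = smul k (lie x F)"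
  by (auto simp: lie_def subst_act_add act_add subst_act_diff act_diff subst_act_scale act_scale
      V.scale_right_diff_distrib)

lemma ce_add: "ce (F + G) ys = ce F ys + ce G ys"
  by (induction ys arbitrary: F G) (simp_all add: contr_linear lie_linear)

lemma ce_diff: "ce (F - G) ys = ce F ys - ce G ys"
  by (induction ys arbitrary: F G) (simp_all add: contr_linear lie_linear)

lemma ce_scale: "ce (smul k F) ys = s k (ce F ys)"
  by (induction ys arbitrary: F) (simp_all add: contr_linear lie_linear V.scale_right_diff_distrib)

lemma contr_lie: "contr y (lie x F) = lie x (contr y F) - smul (c x y) (contr (mul x y) F)"
  by (auto simp: contr_def lie_def)

lemma contr_ce: "contr x (ce F) = lie x F - ce (contr x F)"
  by (auto simp: contr_def)

text \<open>
  The Jacobi identity moves the two derivations past the first letter of the word.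
\<close>

lemma lie_lie: "lie x (lie y F) ys - lie y (lie x F) ys = s (c x y) (lie (mul x y) F ys)"
proof (induction ys arbitrary: F)
  case Nil
  show ?case by (simp add: lie_def act_act)
next
  case (Cons z zs)
  have *: "lie x (lie y F) (z # zs) = lie x (lie y (contr z F)) zs - s (c y z) (lie x (contr (mul y z) F) zs)
      - s (c x z) (lie y (contr (mul x z) F) zs) + s (c x z * c y (mul x z)) (F (mul y (mul x z) # zs))" for x y
  proof -
    have "contr z (lie x (lie y F)) = lie x (lie y (contr z F)) - smul (c y z) (lie x (contr (mul y z) F))
      - smul (c x z) (lie y (contr (mul x z) F) - smul (c y (mul x z)) (contr (mul y (mul x z)) F))"
      by (simp only: contr_lie lie_linear)
    from fun_cong[OF this, of zs] show ?thesis
      by (simp add: contr_apply V.scale_right_diff_distrib)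
  qed
  have e: "lie (mul x y) F (z # zs) = lie (mul x y) (contr z F) zs - s (c (mul x y) z) (F (mul (mul x y) z # zs))"
    by (simp add: lie_def contr_def)
  show ?case
    unfolding * e using Cons[of "contr z F"] jacobi[of y z x "\<lambda>w. F (w # zs)"]
    by (simp add: V.scale_right_diff_distrib algebra_simps)
qed

text \<open>
  Both sides are expanded at the first letter \<open>y\<close> of the word; the terms agree by \<open>lie_lie\<close> and by the
  induction hypothesis, applied to the contractions with \<open>y\<close> and with \<open>mul x y\<close>.
\<close>

lemma lie_ce: "lie x (ce F) ys = ce (lie x F) ys"
proof (induction ys arbitrary: F)
  case Nil
  show ?case by (simp add: lie_def)
next
  case (Cons y ys)
  have "lie x (ce F) (y # ys) = (lie x (contr y (ce F)) - smul (c x y) (contr (mul x y) (ce F))) ys"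
    using fun_cong[OF contr_lie[of y x "ce F"], of ys] by (simp add: contr_apply)
  also have "\<dots> = lie x (lie y F) ys - lie x (ce (contr y F)) ys
      - s (c x y) (lie (mul x y) F ys - ce (contr (mul x y) F) ys)"
    by (simp add: contr_ce lie_linear)
  also have "\<dots> = lie y (lie x F) ys - (ce (lie x (contr y F)) ys - s (c x y) (ce (contr (mul x y) F) ys))"
  proof -
    have "lie x (lie y F) ys = lie y (lie x F) ys + s (c x y) (lie (mul x y) F ys)"
      using lie_lie[of x y F ys] by (simp only: diff_eq_eq add.commute)
    then show ?thesis
      by (simp only: Cons V.scale_right_diff_distrib) simp
  qed
  also have "\<dots> = ce (lie x F) (y # ys)"
    by (simp add: contr_lie ce_diff ce_scale)
  finally show ?case .
qed

text \<open>
  \<open>\<iota>\<^sub>x d d F = \<L>\<^sub>x d F - d \<iota>\<^sub>x d F = \<L>\<^sub>x d F - d \<L>\<^sub>x F + d d \<iota>\<^sub>x F\<close>, where the first two terms cancel.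
\<close>

lemma ce_ce: "ce (ce F) xs = 0"
proof (induction xs arbitrary: F)
  case (Cons x xs)
  then show ?case by (simp add: contr_ce ce_diff lie_ce)
qed simp

lemma cartan: "ce (contr x F) xs + contr x (ce F) xs = lie x F xs"
  by (simp add: contr_ce)

definition alt :: "('x list \<Rightarrow> 'v) \<Rightarrow> bool" where
  "alt F \<longleftrightarrow> (\<forall>us x y vs. F (us @ x # y # vs) = - F (us @ y # x # vs))"

lemma alt_swap: "alt F \<Longrightarrow> F (us @ x # y # vs) = - F (us @ y # x # vs)"
  unfolding alt_def by blast

lemma alt_swap0: "alt F \<Longrightarrow> F (x # y # vs) = - F (y # x # vs)"
  using alt_swap[of F "[]" x y vs] by simp

lemma alt_contr: "alt F \<Longrightarrow> alt (contr x F)"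
  unfolding alt_def contr_def by (metis append_Cons)

lemma contr_contr: "alt F \<Longrightarrow> contr y (contr x F) = smul (-1) (contr x (contr y F))"
  using alt_swap0[of F x y] by (simp add: contr_def fun_eq_iff)

lemma subst_act_contr_contr:
  assumes "alt F"
  shows "subst_act x (contr b (contr a F)) vs = - subst_act x (contr a (contr b F)) vs"
  by (subst contr_contr[OF assms], subst subst_act_scale) simp

lemma alt_subst_act: "alt F \<Longrightarrow> subst_act x F (us @ a # b # vs) = - subst_act x F (us @ b # a # vs)"
proof (induction us arbitrary: F)
  case Nil
  then show ?case
    using alt_swap0[of F "mul x a" b vs] alt_swap0[of F a "mul x b" vs] subst_act_contr_contr[of F x b a vs]
    by (simp add: contr_apply)
next
  case (Cons z us)
  then show ?case using alt_swap[of F "mul x z # us" a b vs] by (simp add: alt_contr)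
qed

lemma alt_lie:
  assumes "alt F"
  shows "alt (lie x F)"
  unfolding alt_def[of "lie x F"]
proof (intro allI)
  fix us a b vs
  show "lie x F (us @ a # b # vs) = - lie x F (us @ b # a # vs)"
    unfolding lie_def alt_subst_act[OF assms, of x us a b vs] alt_swap[OF assms, of us a b vs]
    by (simp add: act_minus)
qed

lemma ce_contr_contr:
  assumes "alt F"
  shows "ce (contr b (contr a F)) vs = - ce (contr a (contr b F)) vs"
  by (subst contr_contr[OF assms], subst ce_scale) simp

lemma alt_ce: "alt F \<Longrightarrow> alt (ce F)"
proof -
  have "ce F (us @ a # b # vs) = - ce F (us @ b # a # vs)" if "alt F" for us a b vs and F
    using that
  proof (induction us arbitrary: F)
    case Nil
    have *: "lie a F (b # vs) = lie a (contr b F) vs - s (c a b) (F (mul a b # vs))" for a b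
      by (simp add: lie_def contr_def)
    show ?case
      using ce_contr_contr[OF Nil, of b a vs] c_skew[of a b]
      by (simp add: * contr_apply mul_comm[of b a])
  next
    case (Cons z us)
    then show ?case using alt_swap[OF alt_lie[of F z], of us a b vs] by (simp add: alt_contr)
  qed
  then show "alt F \<Longrightarrow> alt (ce F)" unfolding alt_def[of "ce F"] by blast
qed

text \<open>
  The exterior product of the dual basis vector of \<open>x\<close> with \<open>G\<close>, expanded along the position of \<open>x\<close>.
\<close>

primrec wedge :: "'x \<Rightarrow> ('x list \<Rightarrow> 'v) \<Rightarrow> 'x list \<Rightarrow> 'v" where
  "wedge x G [] = 0"
| "wedge x G (y # ys) = (if y = x then G ys else 0) - wedge x (contr y G) ys"

lemma wedge_scale: "wedge x (smul k G) ys = s k (wedge x G ys)"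
  by (induction ys arbitrary: G) (simp_all add: contr_linear V.scale_right_diff_distrib)

lemma wedge_contr_contr:
  assumes "alt F"
  shows "wedge x (contr b (contr a F)) vs = - wedge x (contr a (contr b F)) vs"
  by (subst contr_contr[OF assms], subst wedge_scale) simp

lemma alt_wedge: "alt G \<Longrightarrow> alt (wedge x G)"
proof -
  have "wedge x F (us @ a # b # vs) = - wedge x F (us @ b # a # vs)" if "alt F" for us a b vs and F
    using that
  proof (induction us arbitrary: F)
    case Nil
    then show ?case using wedge_contr_contr[of F x b a vs] by (simp add: contr_apply)
  next
    case (Cons z us)
    then show ?case using alt_swap[of F us a b vs] by (simp add: alt_contr)
  qed
  then show "alt G \<Longrightarrow> alt (wedge x G)" unfolding alt_def[of "wedge x G"] by blast
qed

text \<open>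
  The alternating function with value \<open>v\<close> on a word \<open>w\<close> of distinct letters that vanishes on all words
  other than the rearrangements of \<open>w\<close>.
\<close>

definition dual :: "'x list \<Rightarrow> 'v \<Rightarrow> 'x list \<Rightarrow> 'v" where
  "dual w v = foldr wedge w (\<lambda>xs. if xs = [] then v else 0)"

lemma dual_simps: "dual [] v = (\<lambda>xs. if xs = [] then v else 0)" "dual (x # w) v = wedge x (dual w v)"
  by (simp_all add: dual_def)

lemma alt_dual: "alt (dual w v)"
  by (induction w) (simp_all add: dual_simps alt_wedge, simp add: alt_def)

lemma wedge_support:
  assumes "\<And>ys. G ys \<noteq> 0 \<Longrightarrow> mset ys = M"
  shows "wedge x G xs \<noteq> 0 \<Longrightarrow> mset xs = add_mset x M"
  using assms
proof (induction xs arbitrary: G M)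
  case (Cons y ys)
  show ?case
  proof (cases "y = x \<and> G ys \<noteq> 0")
    case True
    then show ?thesis using Cons.prems(2) by auto
  next
    case False
    then have w: "wedge x (contr y G) ys \<noteq> 0" using Cons.prems(1) by (auto split: if_splits)
    have 1: "mset zs = M - {#y#} \<and> y \<in># M" if "contr y G zs \<noteq> 0" for zs
      using Cons.prems(2)[of "y # zs"] that by (auto simp: contr_apply)
    have "\<exists>zs. contr y G zs \<noteq> 0"
    proof (rule ccontr)
      assume "\<nexists>zs. contr y G zs \<noteq> 0"
      then have "contr y G = smul 0 (contr y G)" by auto
      then have "wedge x (contr y G) ys = s 0 (wedge x (contr y G) ys)" using wedge_scale by metis
      then show False using w by simp
    qed
    with 1 have "y \<in># M" by auto
    moreover have "mset ys = add_mset x (M - {#y#})" using Cons.IH[OF w] 1 by blast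
    ultimately show ?thesis by simp
  qed
qed simp

lemma dual_support: "dual w v xs \<noteq> 0 \<Longrightarrow> mset xs = mset w"
proof (induction w arbitrary: xs)
  case (Cons x w)
  show ?case
    using wedge_support[of "dual w v" "mset w" x xs] Cons by (simp add: dual_simps)
qed (simp add: dual_simps split: if_splits)

lemma alt_move: "alt F \<Longrightarrow> F (us @ x # ms @ vs) = s ((-1) ^ length ms) (F (us @ ms @ x # vs))"
proof (induction ms arbitrary: us)
  case (Cons m ms)
  have "F (us @ x # m # ms @ vs) = - F ((us @ [m]) @ x # ms @ vs)"
    using alt_swap[OF Cons.prems, of us x m "ms @ vs"] by simp
  also have "\<dots> = - s ((-1) ^ length ms) (F (us @ m # ms @ x # vs))" using Cons.IH[OF Cons.prems, of "us @ [m]"] by simp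
  finally show ?case by simp
qed simp

lemma alt_exchange: "alt F \<Longrightarrow> F (us @ x # ms @ y # vs) = - F (us @ y # ms @ x # vs)"
  using alt_move[of F us x "ms @ [y]" vs] alt_move[of F us y ms "x # vs"] by simp

lemma alt_perm: "alt F \<Longrightarrow> mset xs = mset ys \<Longrightarrow> F xs = F ys \<or> F xs = - F ys"
proof (induction xs arbitrary: F ys)
  case (Cons x xs)
  then have "x \<in> set ys" by (metis list.set_intros(1) set_mset_mset)
  then obtain us vs where ys: "ys = us @ x # vs" by (meson split_list)
  have "(-1::'f) ^ length us = 1 \<or> (-1::'f) ^ length us = -1" by (cases "even (length us)") auto
  then have 1: "F (x # us @ vs) = F ys \<or> F (x # us @ vs) = - F ys"
    using alt_move[OF Cons.prems(1), of "[]" x us vs] by (auto simp: ys)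
  have "contr x F xs = contr x F (us @ vs) \<or> contr x F xs = - contr x F (us @ vs)"
    using Cons.prems ys by (intro Cons.IH alt_contr) auto
  with 1 show ?case by (auto simp: contr_apply)
qed simp

lemma self_neg: "v = - v \<Longrightarrow> v = (0 :: 'v)"
proof -
  assume "v = - v"
  then have "s 2 v = 0" using V.scale_left_distrib[of 1 1 v] by (metis V.scale_one add.right_inverse one_add_one)
  then show "v = 0" by simp
qed

lemma alt_not_distinct: "alt F \<Longrightarrow> \<not> distinct xs \<Longrightarrow> F xs = 0"
proof -
  assume F: "alt F" and "\<not> distinct xs"
  then obtain us ms vs y where xs: "xs = us @ [y] @ ms @ [y] @ vs" by (meson not_distinct_decomp)
  show "F xs = 0" using alt_exchange[OF F, of us y ms y vs] xs by (intro self_neg) simp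
qed

text \<open>
  A transposition of two positions changes the sign because it is a product of an odd number of
  exchanges of neighbours (\<open>alt_exchange\<close>); transpositions generate all permutations.
\<close>

lemma alt_permute_list:
  assumes F: "alt F" and p: "p permutes {..<length xs}"
  shows "F (permute_list p xs) = s (of_int (sign p)) (F xs)"
proof -
  have tr: "F (permute_list (transpose a b) xs) = - F xs" if ab: "a < b" "b < length xs" for a b xs
  proof -
    define us x ms y vs where "us = take a xs" and "x = xs ! a" and "ms = take (b - Suc a) (drop (Suc a) xs)"
      and "y = xs ! b" and "vs = drop (Suc b) xs"
    have "xs = us @ x # drop (Suc a) xs" using ab by (simp add: us_def x_def id_take_nth_drop)
    moreover have "drop (Suc a) xs = ms @ drop b xs"
      using ab by (metis Suc_leI append_take_drop_id drop_drop le_add_diff_inverse2 ms_def)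
    moreover have "drop b xs = y # vs" using ab by (simp add: y_def vs_def Cons_nth_drop_Suc)
    ultimately have xs: "xs = us @ x # ms @ y # vs" by simp
    have len: "length us = a" "length ms = b - Suc a" using ab by (simp_all add: us_def ms_def)
    have "permute_list (transpose a b) xs = us @ y # ms @ x # vs"
    proof (rule nth_equalityI)
      show "length (permute_list (transpose a b) xs) = length (us @ y # ms @ x # vs)" by (simp add: xs)
      fix i assume i: "i < length (permute_list (transpose a b) xs)"
      have "permute_list (transpose a b) xs ! i = xs ! transpose a b i"
        using i by (simp add: permute_list_def)
      also have "\<dots> = (us @ y # ms @ x # vs) ! i"
        using ab len unfolding xs
        by (auto simp: nth_append nth_Cons transpose_def split: nat.splits)
      finally show "permute_list (transpose a b) xs ! i = (us @ y # ms @ x # vs) ! i" .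
    qed
    then show ?thesis using alt_exchange[OF F, of us y ms x vs] xs by simp
  qed
  have "finite {..<length xs}" by simp
  with p have "\<forall>ys. length ys = length xs \<longrightarrow> F (permute_list p ys) = s (of_int (sign p)) (F ys)"
  proof (induction p rule: permutes_induct)
    case (swap a b p)
    have "F (permute_list (transpose a b \<circ> p) ys) = s (of_int (sign (transpose a b \<circ> p))) (F ys)"
      if ys: "length ys = length xs" for ys
    proof -
      have "F (permute_list (transpose a b) ys) = - F ys"
        using tr[of a b ys] tr[of b a ys] swap.hyps ys
        by (cases "a < b") (auto simp: transpose_commute[of b a])
      moreover have "permutation p" using swap.hyps permutation_permutes by blast
      ultimately show ?thesis
        using swap ys by (simp add: permute_list_compose sign_compose permutation_swap_id sign_swap_id)
    qed
    then show ?case by blast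
  qed simp
  then show ?thesis by simp
qed

end


lemma nths_Cons_0: "nths (x # xs) (- {0}) = xs"
  by (simp add: nths_Cons nths_all)

lemma nths_Cons_Suc: "nths (x # xs) (- {Suc k}) = x # nths xs (- {k})"
  by (simp add: nths_Cons Compl_eq)

lemma nths_Cons_0_Suc: "nths (x # xs) (- {0, Suc k}) = nths xs (- {k})"
  by (simp add: nths_Cons Compl_eq)

lemma nths_Cons_Suc_Suc: "nths (x # xs) (- {Suc k, Suc l}) = x # nths xs (- {k, l})"
  by (simp add: nths_Cons Compl_eq)

context lie_basis
begin

lemma subst_act_sum:
  assumes "alt F"
  shows "subst_act x F ys = (\<Sum>i<length ys. s ((-1) ^ i * c x (ys ! i)) (F (mul x (ys ! i) # nths ys (- {i}))))"
  using assms
proof (induction ys arbitrary: F)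
  case (Cons y ys)
  have "(\<Sum>i<length ys. s ((-1) ^ i * c x (ys ! i)) (contr y F (mul x (ys ! i) # nths ys (- {i})))) =
      (\<Sum>i<length ys. s ((-1) ^ Suc i * c x (ys ! i)) (F (mul x (ys ! i) # y # nths ys (- {i}))))"
  proof (rule sum.cong[OF refl])
    fix i
    show "s ((-1) ^ i * c x (ys ! i)) (contr y F (mul x (ys ! i) # nths ys (- {i}))) =
        s ((-1) ^ Suc i * c x (ys ! i)) (F (mul x (ys ! i) # y # nths ys (- {i})))"
      using alt_swap0[OF Cons.prems, of y "mul x (ys ! i)" "nths ys (- {i})"] by (simp add: contr_apply)
  qed
  then show ?case
    using Cons.IH[OF alt_contr[OF Cons.prems, of y]]
    by (simp add: sum.lessThan_Suc_shift nths_Cons_0 nths_Cons_Suc del: sum.lessThan_Suc power_Suc)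
qed simp

text \<open>
  The familiar alternating sum. The bracket is placed in front, as in the definition of the
  differential of cochains, which is where \<open>alt F\<close> is used.
\<close>

lemma ce_sum:
  assumes "alt F"
  shows "ce F xs = (\<Sum>k<length xs. s ((-1) ^ k) (act (xs ! k) (F (nths xs (- {k}))))) +
    (\<Sum>l<length xs. \<Sum>k<l. s ((-1) ^ (k + l) * c (xs ! k) (xs ! l))
      (F (mul (xs ! k) (xs ! l) # nths xs (- {k, l}))))"
  using assms
proof (induction xs arbitrary: F)
  case (Cons x xs)
  have a: "s ((-1) ^ (k + l) * c (xs ! k) (xs ! l)) (contr x F (mul (xs ! k) (xs ! l) # nths xs (- {k, l}))) =
      - s ((-1) ^ (Suc k + Suc l) * c (xs ! k) (xs ! l)) (F (mul (xs ! k) (xs ! l) # x # nths xs (- {k, l})))" for k l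
    using alt_swap0[OF Cons.prems, of x "mul (xs ! k) (xs ! l)" "nths xs (- {k, l})"] by (simp add: contr_apply)
  have 1: "ce (contr x F) xs = - (\<Sum>k<length xs. s ((-1) ^ Suc k) (act (xs ! k) (F (x # nths xs (- {k}))))) -
    (\<Sum>l<length xs. \<Sum>k<l. s ((-1) ^ (Suc k + Suc l) * c (xs ! k) (xs ! l))
      (F (mul (xs ! k) (xs ! l) # x # nths xs (- {k, l}))))"
    unfolding Cons.IH[OF alt_contr[OF Cons.prems, of x]] a
    by (simp add: contr_apply sum_negf)
  have 2: "lie x F xs = act x (F xs) + (\<Sum>l<length xs. s ((-1) ^ Suc l * c x (xs ! l)) (F (mul x (xs ! l) # nths xs (- {l}))))"
    by (simp add: lie_def subst_act_sum[OF Cons.prems] sum_negf)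
  show ?case
    by (simp add: 1 2 sum.lessThan_Suc_shift nths_Cons_0 nths_Cons_Suc nths_Cons_0_Suc nths_Cons_Suc_Suc
        sum.distrib sum_negf sum_subtractf del: sum.lessThan_Suc)
qed simp

end


section \<open>The annihilation Lie algebra\<close>

text \<open>
  The generator in which the bracket of two generators is expressed; \<open>M_gen\<close> is a default value if the bracket is zero.
\<close>

fun gen_mul :: "sv_gen \<Rightarrow> sv_gen \<Rightarrow> sv_gen" where
  "gen_mul L_gen h = h"
| "gen_mul g L_gen = g"
| "gen_mul g h = M_gen"

text \<open>
  The coefficient of \<open>\<partial>\<close> in the bracket \<open>[g\<^sub>\<lambda> h]\<close>. By skew-symmetry the coefficient of \<open>\<lambda>\<close> is
  \<open>dcoeff g h + dcoeff h g\<close>.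
\<close>

fun dcoeff :: "sv_gen \<Rightarrow> sv_gen \<Rightarrow> 'f::field_char_0" where
  "dcoeff L_gen h = 1"
| "dcoeff M_gen h = 0"
| "dcoeff Y_gen L_gen = 1/2"
| "dcoeff Y_gen Y_gen = 1"
| "dcoeff Y_gen M_gen = 0"

lemma sv_gen_bracket_eq:
  "sv_gen_bracket g h = [:sv_scale (dcoeff g h) (sv_D (sv_of (gen_mul g h))),
     sv_scale (dcoeff g h + dcoeff h g) (sv_of (gen_mul g h)):]"
  by (cases g; cases h) simp_all

text \<open>
  The pair \<open>(g, n)\<close> stands for \<open>g\<^sub>(\<^sub>n\<^sub>)\<close>.
\<close>

type_synonym mode = "sv_gen \<times> nat"

fun mode_mul :: "mode \<Rightarrow> mode \<Rightarrow> mode" where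
  "mode_mul (g, m) (h, n) = (gen_mul g h, m + n - 1)"

fun mode_coeff :: "mode \<Rightarrow> mode \<Rightarrow> 'f::field_char_0" where
  "mode_coeff (g, m) (h, n) = of_nat m * dcoeff h g - of_nat n * dcoeff g h"

fun mode_act :: "mode \<Rightarrow> 'f::field_char_0 sv \<Rightarrow> 'f sv" where
  "mode_act (g, m) v = sv_scale (fact m) (coeff (sv_bracket (sv_of g) v) m)"

lemma gen_mul_comm: "gen_mul g h = gen_mul h g"
  by (cases g; cases h) simp_all

lemma gen_mul_assoc: "gen_mul g (gen_mul h k) = gen_mul (gen_mul g h) k"
  by (cases g; cases h; cases k) simp_all

lemma mode_mul_comm: "mode_mul x y = mode_mul y x"
  by (cases x; cases y) (simp add: gen_mul_comm add.commute)

lemma mode_coeff_skew: "mode_coeff x y = - (mode_coeff y x :: 'f::field_char_0)"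
  by (cases x; cases y) simp

text \<open>
  The truncated subtraction in \<open>mode_mul\<close> can be computed in the field, because the first factor vanishes
  for \<open>n + p = 0\<close>.
\<close>

lemma mode_coeff_2:
  "mode_coeff (h, n) (k, p) * mode_coeff (g, m) (mode_mul (h, n) (k, p)) =
    (of_nat n * dcoeff k h - of_nat p * dcoeff h k) *
    (of_nat m * dcoeff (gen_mul h k) g - (of_nat n + of_nat p - 1) * (dcoeff g (gen_mul h k) :: 'f::field_char_0))"
proof (cases "n + p = 0")
  case False
  then obtain k where k: "n + p = Suc k" by (metis not0_implies_Suc)
  then have "of_nat n + of_nat p = (of_nat k + 1 :: 'f)" by (metis of_nat_Suc of_nat_add add.commute)
  with k show ?thesis by simp
qed simp

lemma mode_jacobi_coeff:
  "mode_coeff y z * mode_coeff x (mode_mul y z) =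
    mode_coeff x y * mode_coeff (mode_mul x y) z + mode_coeff x z * (mode_coeff y (mode_mul x z) :: 'f::field_char_0)"
proof -
  obtain g m h n k p where x: "x = (g, m)" "y = (h, n)" "z = (k, p)" by (metis surj_pair)
  have 1: "mode_coeff x y * mode_coeff (mode_mul x y) z = - (mode_coeff x y * (mode_coeff z (mode_mul x y) :: 'f))"
    using mode_coeff_skew[of "mode_mul x y" z, where 'f = 'f] by simp
  show ?thesis
    unfolding 1 unfolding x mode_coeff_2
    by (cases g; cases h; cases k) (simp_all add: field_simps)
qed

lemma mode_jacobi:
  fixes G :: "mode \<Rightarrow> 'f::field_char_0 sv"
  shows "sv_scale (mode_coeff y z * mode_coeff x (mode_mul y z)) (G (mode_mul x (mode_mul y z))) =
    sv_scale (mode_coeff x y * mode_coeff (mode_mul x y) z) (G (mode_mul (mode_mul x y) z)) +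
    sv_scale (mode_coeff x z * mode_coeff y (mode_mul x z)) (G (mode_mul y (mode_mul x z)))"
proof -
  obtain g m h n k p where x: "x = (g, m)" "y = (h, n)" "z = (k, p)" by (metis surj_pair)
  \<comment> \<open>all three iterated products are \<open>w\<close>, unless their coefficient is zero\<close>
  define w where "w = (gen_mul g (gen_mul h k), m + n + p - 2)"
  have 1: "mode_coeff y z = (0::'f) \<or> mode_mul x (mode_mul y z) = w"
    by (cases "n + p = 0") (auto simp: x w_def)
  have 2: "mode_coeff x y = (0::'f) \<or> mode_mul (mode_mul x y) z = w"
    by (cases "m + n = 0") (auto simp: x w_def gen_mul_assoc)
  have 3: "mode_coeff x z = (0::'f) \<or> mode_mul y (mode_mul x z) = w"
    by (cases "m + p = 0") (auto simp: x w_def gen_mul_assoc gen_mul_comm[of h g])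
  have a: "sv_scale (mode_coeff y z * mode_coeff x (mode_mul y z)) (G (mode_mul x (mode_mul y z))) =
      sv_scale (mode_coeff y z * mode_coeff x (mode_mul y z)) (G w)"
    "sv_scale (mode_coeff x y * mode_coeff (mode_mul x y) z) (G (mode_mul (mode_mul x y) z)) =
      sv_scale (mode_coeff x y * mode_coeff (mode_mul x y) z) (G w)"
    "sv_scale (mode_coeff x z * mode_coeff y (mode_mul x z)) (G (mode_mul y (mode_mul x z))) =
      sv_scale (mode_coeff x z * mode_coeff y (mode_mul x z)) (G w)"
    using 1 2 3 by auto
  show ?thesis
    unfolding a using mode_jacobi_coeff[of y z x, where 'f = 'f]
    by (simp flip: SV_V.scale_left_distrib)
qed

section \<open>Coefficients of substituted polynomials\<close>

abbreviation lk :: "('a \<Rightarrow>\<^sub>0 'b::zero) \<Rightarrow> 'a \<Rightarrow> 'b" where "lk \<equiv> Poly_Mapping.lookup"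
abbreviation sg :: "'a \<Rightarrow> 'b \<Rightarrow> 'a \<Rightarrow>\<^sub>0 'b::zero" where "sg \<equiv> Poly_Mapping.single"

lemma lpoly_sum_monomials: "(\<Sum>m\<in>Poly_Mapping.keys P. sg m (lk P m)) = (P :: 'v::ab_group_add lpoly)"
  by (rule poly_mapping_eqI) (auto simp: lookup_sum lookup_single when_def in_keys_iff)

lemma lpoly_keys_induct [consumes 1, case_names zero single add]:
  fixes P :: "'v::ab_group_add lpoly"
  assumes "\<forall>m\<in>Poly_Mapping.keys P. A m"
  assumes "Q 0" "\<And>m v. A m \<Longrightarrow> Q (sg m v)" "\<And>P R. Q P \<Longrightarrow> Q R \<Longrightarrow> Q (P + R)"
  shows "Q P"
proof -
  have "Q (\<Sum>m\<in>M. sg m (lk P m))" if "finite M" "M \<subseteq> Poly_Mapping.keys P" for M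
    using that assms by (induction M) auto
  from this[of "Poly_Mapping.keys P"] show ?thesis by (simp add: lpoly_sum_monomials)
qed

definition erase :: "nat \<Rightarrow> (nat \<Rightarrow>\<^sub>0 nat) \<Rightarrow> nat \<Rightarrow>\<^sub>0 nat" where
  "erase k m = Poly_Mapping.update k 0 m"

lemma lookup_erase: "lk (erase k m) i = (if i = k then 0 else lk m i)"
  by (simp add: erase_def lookup_update)

lemma add_single_eq_iff:
  assumes "lk m' k = 0"
  shows "m' + sg k n = m \<longleftrightarrow> m' = erase k m \<and> n = lk m k"
  using assms by (auto simp: poly_mapping_eq_iff fun_eq_iff lookup_add lookup_single lookup_erase when_def split: if_splits)

lemma ev_lam: "SV_B.ev (lam k) P = (\<Sum>n\<le>Polynomial.degree P. sg (sg k n) (coeff P n))"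
  by (simp add: SV_V.usubst_def SV_V.lam_power SV_V.pscale_single)

text \<open>
  If \<open>\<lambda>\<^sub>k\<close> does not occur in \<open>Q\<close>, then its exponent in \<open>a\<^bsub>\<lambda>\<^sub>k\<^esub> Q\<close> comes from the bracket alone.
\<close>

lemma lookup_app_lam:
  assumes "\<forall>m'\<in>Poly_Mapping.keys Q. lk m' k = 0"
  shows "lk (SV_B.app (lam k) a Q) m = coeff (sv_bracket a (lk Q (erase k m))) (lk m k)"
  using assms
proof (induction Q rule: lpoly_keys_induct)
  case (single m' v)
  let ?P = "sv_bracket a v"
  have "lk (SV_B.app (lam k) a (sg m' v)) m = (\<Sum>n\<le>Polynomial.degree ?P. lk (sg (m' + sg k n) (coeff ?P n)) m)"
    by (simp add: SV_B.app_single ev_lam SV_V.pscale_sum_right SV_V.pscale_single lookup_sum)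
  also have "\<dots> = (\<Sum>n\<le>Polynomial.degree ?P. if n = lk m k then (if m' = erase k m then coeff ?P n else 0) else 0)"
    by (rule sum.cong) (auto simp: lookup_single when_def add_single_eq_iff[OF single])
  also have "\<dots> = coeff (sv_bracket a (lk (sg m' v) (erase k m))) (lk m k)"
    by (auto simp: lookup_single when_def coeff_eq_0)
  finally show ?case .
qed (simp_all add: SV_B.app_add lookup_add SV_B.br_add_right)

lemma lookup_pscale_const: "lk (SV_V.pscale p (const v)) m = sv_scale (lk p m) v"
  by (induction p rule: lpoly_induct)
    (simp_all add: SV_V.pscale_single SV_V.pscale_add_left lookup_add lookup_single when_def SV_V.scale_left_distrib)

lemma lookup_pscale_C: "lk (SV_V.pscale (const c) Q) m = sv_scale c (lk Q m)"
  by (induction Q rule: lpoly_induct)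
    (simp_all add: SV_V.pscale_single SV_V.pscale_add_right lookup_add lookup_single when_def SV_V.scale_right_distrib)

lemma lookup_pscale_lam:
  "lk (SV_V.pscale (lam k) Q) m = (if lk m k = 0 then 0 else lk Q (m - sg k 1))"
proof (induction Q rule: lpoly_induct)
  case (single m' v)
  have "sg k 1 + m' = m \<longleftrightarrow> lk m k \<noteq> 0 \<and> m' = m - sg k 1"
    by (auto simp: poly_mapping_eq_iff fun_eq_iff lookup_add lookup_minus lookup_single when_def split: if_splits)
  then show ?case by (auto simp: lam_def SV_V.pscale_single lookup_single when_def)
qed (simp_all add: SV_V.pscale_add_right lookup_add)

definition mon :: "(nat \<Rightarrow> 'f::field_char_0 lpoly) \<Rightarrow> (nat \<Rightarrow>\<^sub>0 nat) \<Rightarrow> 'f lpoly" where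
  "mon \<sigma> m = (\<Prod>i\<in>Poly_Mapping.keys m. \<sigma> i ^ lk m i)"

abbreviation subst_vars :: "(nat \<Rightarrow> 'f::field_char_0 lpoly) \<Rightarrow> 'f sv lpoly \<Rightarrow> 'f sv lpoly" where
  "subst_vars \<equiv> SV_V.msubst const"

lemma mon_expand: "finite A \<Longrightarrow> Poly_Mapping.keys m \<subseteq> A \<Longrightarrow> mon \<sigma> m = (\<Prod>i\<in>A. \<sigma> i ^ lk m i)"
  unfolding mon_def by (rule prod.mono_neutral_left) (auto simp: in_keys_iff)

lemma mon_add: "mon \<sigma> (m + n) = mon \<sigma> m * mon \<sigma> n"
proof -
  let ?A = "Poly_Mapping.keys m \<union> Poly_Mapping.keys n"
  have "Poly_Mapping.keys (m + n) \<subseteq> ?A" by (rule keys_add)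
  then show ?thesis by (simp add: mon_expand[of ?A] lookup_add power_add prod.distrib)
qed

lemma sb_add: "subst_vars \<sigma> (P + R) = subst_vars \<sigma> P + subst_vars \<sigma> R"
  by (rule SV_V.msubst_add) (rule single_add)

lemma sb_single: "subst_vars \<sigma> (sg m v) = SV_V.pscale (mon \<sigma> m) (const v)"
  by (simp add: SV_V.msubst_expand[of _ "{m}"] mon_def)

lemma sb_minus: "subst_vars \<sigma> (- P) = - subst_vars \<sigma> P"
  using sb_add[of \<sigma> P "- P"] by (simp add: eq_neg_iff_add_eq_0 add.commute)

lemma sb_pscale_C: "subst_vars \<sigma> (SV_V.pscale (const c) P) = SV_V.pscale (const c) (subst_vars \<sigma> P)"
proof (induction P rule: lpoly_induct)
  case (single m v)
  have "subst_vars \<sigma> (SV_V.pscale (const c) (sg m v)) = SV_V.pscale (mon \<sigma> m * const c) (const v)"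
    unfolding SV_V.pscale_mult by (simp add: SV_V.pscale_single sb_single)
  also have "\<dots> = SV_V.pscale (const c) (subst_vars \<sigma> (sg m v))"
    by (simp add: sb_single mult.commute[of "mon \<sigma> m"] SV_V.pscale_mult)
  finally show ?case .
qed (simp_all add: SV_V.pscale_add_right sb_add)

lemma sb_pscale_lam: "subst_vars \<sigma> (SV_V.pscale (lam i) P) = SV_V.pscale (\<sigma> i) (subst_vars \<sigma> P)"
proof (induction P rule: lpoly_induct)
  case (single m v)
  have "mon \<sigma> (sg i 1) = \<sigma> i" by (simp add: mon_def)
  then show ?case by (simp add: lam_def SV_V.pscale_single sb_single mon_add SV_V.pscale_mult)
qed (simp_all add: SV_V.pscale_add_right sb_add)

lemma lookup_sb: "lk (subst_vars \<sigma> P) m = (\<Sum>m'\<in>Poly_Mapping.keys P. sv_scale (lk (mon \<sigma> m') m) (lk P m'))"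
  by (simp add: SV_V.msubst_def lookup_sum lookup_pscale_const mon_def)

text \<open>
  The exponents of the monomial that results from renaming \<open>\<lambda>\<^sub>i\<close> to \<open>\<lambda>\<^bsub>js ! i\<^esub>\<close>.
\<close>

definition push :: "nat list \<Rightarrow> (nat \<Rightarrow>\<^sub>0 nat) \<Rightarrow> nat \<Rightarrow>\<^sub>0 nat" where
  "push js m = (\<Sum>i<length js. sg (js ! i) (lk m i))"

lemma mon_lam:
  fixes js :: "nat list"
  assumes "Poly_Mapping.keys m \<subseteq> {..<length js}"
  shows "mon (\<lambda>i. map lam js ! i) m = (sg (push js m) 1 :: 'f::field_char_0 lpoly)"
proof -
  have "mon (\<lambda>i. map lam js ! i) m = (\<Prod>i<length js. lam (js ! i) ^ lk m i :: 'f lpoly)"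
    using assms by (simp add: mon_expand[of "{..<length js}"])
  also have "\<dots> = (\<Prod>i<length js. sg (sg (js ! i) (lk m i)) 1)"
    by (simp add: SV_V.lam_power)
  also have "\<dots> = sg (push js m) 1"
  proof -
    have "(\<Prod>i\<in>I. sg (h i) 1) = (sg (\<Sum>i\<in>I. h i) 1 :: 'f lpoly)" if "finite I" for I :: "nat set" and h :: "nat \<Rightarrow> nat \<Rightarrow>\<^sub>0 nat"
      using that by (induction I) (simp_all add: mult_single)
    then show ?thesis by (simp add: push_def)
  qed
  finally show ?thesis .
qed

lemma lookup_push_nth:
  assumes "distinct js" "i < length js"
  shows "lk (push js m) (js ! i) = lk m i"
proof -
  have "lk (push js m) (js ! i) = (\<Sum>k<length js. if k = i then lk m k else 0)"
    unfolding push_def lookup_sum using assms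
    by (intro sum.cong) (auto simp: lookup_single when_def nth_eq_iff_index_eq)
  then show ?thesis using assms by simp
qed

lemma lookup_push_other: "j \<notin> set js \<Longrightarrow> lk (push js m) j = 0"
  by (auto simp: push_def lookup_sum lookup_single when_def intro!: sum.neutral)

lemma lookup_nth_map: "lk (Poly_Mapping.nth (map h js)) i = (if i < length js then h (js ! i) else 0)"
  by (simp add: nth_default_def)

lemma push_eq_iff:
  assumes "distinct js" "Poly_Mapping.keys m' \<subseteq> {..<length js}"
  shows "push js m' = m \<longleftrightarrow> Poly_Mapping.keys m \<subseteq> set js \<and> m' = Poly_Mapping.nth (map (lk m) js)"
proof
  assume p: "push js m' = m"
  have "Poly_Mapping.keys m \<subseteq> set js" using lookup_push_other[of _ js m'] p by (auto simp: in_keys_iff)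
  moreover have "m' = Poly_Mapping.nth (map (lk m) js)"
  proof (rule poly_mapping_eqI)
    fix i show "lk m' i = lk (Poly_Mapping.nth (map (lk m) js)) i"
      using assms lookup_push_nth[OF assms(1), of i m'] p
      by (cases "i < length js") (auto simp: lookup_nth_map in_keys_iff simp del: lookup_nth)
  qed
  ultimately show "Poly_Mapping.keys m \<subseteq> set js \<and> m' = Poly_Mapping.nth (map (lk m) js)" by blast
next
  assume p: "Poly_Mapping.keys m \<subseteq> set js \<and> m' = Poly_Mapping.nth (map (lk m) js)"
  show "push js m' = m"
  proof (rule poly_mapping_eqI)
    fix j show "lk (push js m') j = lk m j"
    proof (cases "j \<in> set js")
      case True
      then obtain i where "i < length js" "j = js ! i" by (auto simp: in_set_conv_nth)
      then show ?thesis using assms p by (simp add: lookup_push_nth lookup_nth_map del: lookup_nth)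
    next
      case False
      then show ?thesis using p by (auto simp: lookup_push_other in_keys_iff)
    qed
  qed
qed

lemma lookup_sb_lam:
  assumes "distinct js" "\<And>m'. m' \<in> Poly_Mapping.keys P \<Longrightarrow> Poly_Mapping.keys m' \<subseteq> {..<length js}"
  shows "lk (subst_vars (\<lambda>i. map lam js ! i) P) m =
    (if Poly_Mapping.keys m \<subseteq> set js then lk P (Poly_Mapping.nth (map (lk m) js)) else 0)"
proof -
  have "lk (subst_vars (\<lambda>i. map lam js ! i) P) m = (\<Sum>m'\<in>Poly_Mapping.keys P.
      if m' = Poly_Mapping.nth (map (lk m) js) then (if Poly_Mapping.keys m \<subseteq> set js then lk P m' else 0) else 0)"
    unfolding lookup_sb using assms
    by (intro sum.cong refl) (auto simp: mon_lam push_eq_iff lookup_single when_def)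
  then show ?thesis by (auto simp: in_keys_iff)
qed


text \<open>
  The substitution of \<open>\<lambda>\<^sub>k + \<lambda>\<^sub>l\<close> for the first variable produces a binomial coefficient in the exponents of
  \<open>\<lambda>\<^sub>k\<close> and \<open>\<lambda>\<^sub>l\<close>, whose sum is the exponent of that variable.
\<close>

lemma lookup_sb_merge:
  assumes d: "distinct (k # l # js)" and P: "\<forall>m'\<in>Poly_Mapping.keys P. Poly_Mapping.keys m' \<subseteq> {..<Suc (length js)}"
    and m: "Poly_Mapping.keys m \<subseteq> set (k # l # js)"
  shows "lk (subst_vars (\<lambda>i. ((lam k + lam l) # map lam js) ! i) P) m =
    sv_scale (of_nat ((lk m k + lk m l) choose lk m k)) (lk P (Poly_Mapping.nth ((lk m k + lk m l) # map (lk m) js)))"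
    (is "lk (subst_vars ?\<sigma> P) m = sv_scale ?C (lk P ?t)")
proof -
  have *: "lk (mon ?\<sigma> m') m = (if m' = ?t then ?C else 0)" if m': "Poly_Mapping.keys m' \<subseteq> {..<Suc (length js)}" for m'
  proof -
    define a where "a = lk m' 0"
    \<comment> \<open>exponents of the \<open>b\<close>-th term of the binomial expansion\<close>
    define M where "M b = Poly_Mapping.nth (b # (a - b) # map (\<lambda>i. lk m' (Suc i)) [0..<length js])" for b
    have lM: "lk (M b) 0 = b" "lk (M b) (Suc 0) = a - b" "i < length js \<Longrightarrow> lk (M b) (Suc (Suc i)) = lk m' (Suc i)" for b i
      by (simp_all add: M_def nth_default_def)
    have push: "push (k # l # js) (M b) = sg k b + sg l (a - b) + (\<Sum>i<length js. sg (js ! i) (lk m' (Suc i)))" for b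
      by (simp add: push_def sum.lessThan_Suc_shift lM add.assoc del: sum.lessThan_Suc)
    have "mon ?\<sigma> m' = (lam k + lam l) ^ a * (\<Prod>i<length js. lam (js ! i) ^ lk m' (Suc i))"
      using m' by (simp add: mon_expand[of "{..<Suc (length js)}"] prod.lessThan_Suc_shift a_def del: prod.lessThan_Suc)
    also have "(\<Prod>i<length js. lam (js ! i) ^ lk m' (Suc i)) = (sg (\<Sum>i<length js. sg (js ! i) (lk m' (Suc i))) 1 :: 'a lpoly)"
    proof -
      have "(\<Prod>i\<in>I. sg (h i) 1) = (sg (\<Sum>i\<in>I. h i) 1 :: 'a lpoly)" if "finite I" for I :: "nat set" and h :: "nat \<Rightarrow> nat \<Rightarrow>\<^sub>0 nat"
        using that by (induction I) (simp_all add: mult_single)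
      then show ?thesis by (simp add: SV_V.lam_power)
    qed
    also have "(lam k + lam l) ^ a = (\<Sum>b\<le>a. sg (sg k b + sg l (a - b)) (of_nat (a choose b)) :: 'a lpoly)"
      unfolding binomial_ring by (simp add: SV_V.lam_power mult_single flip: single_of_nat)
    also have "\<dots> * sg (\<Sum>i<length js. sg (js ! i) (lk m' (Suc i))) 1 = (\<Sum>b\<le>a. sg (push (k # l # js) (M b)) (of_nat (a choose b)))"
      by (simp add: sum_distrib_right mult_single push)
    finally have "lk (mon ?\<sigma> m') m = (\<Sum>b\<le>a. lk (sg (push (k # l # js) (M b)) (of_nat (a choose b))) m)"
      by (simp only: lookup_sum)
    also have "\<dots> = (\<Sum>b\<le>a. if b = lk m k then (if m' = ?t then ?C else 0) else 0)"
    proof (rule sum.cong[OF refl])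
      fix b assume b: "b \<in> {..a}"
      have eq: "push (k # l # js) (M b) = m \<longleftrightarrow> b = lk m k \<and> m' = ?t"
      proof
        assume p: "push (k # l # js) (M b) = m"
        have 1: "lk m k = b" "lk m l = a - b" "i < length js \<Longrightarrow> lk m (js ! i) = lk m' (Suc i)" for i
          using lookup_push_nth[OF d, of 0 "M b"] lookup_push_nth[OF d, of 1 "M b"] lookup_push_nth[OF d, of "Suc (Suc i)" "M b"]
          by (simp_all add: p lM)
        have "m' = ?t"
        proof (rule poly_mapping_eqI)
          fix i show "lk m' i = lk ?t i"
            using 1 b m' by (cases i) (auto simp: nth_default_def a_def in_keys_iff)
        qed
        with 1 show "b = lk m k \<and> m' = ?t" by simp
      next
        assume p: "b = lk m k \<and> m' = ?t"
        then have m't: "m' = ?t" by blast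
        have a: "a = lk m k + lk m l" unfolding a_def m't by simp
        have mi: "lk m' (Suc i) = lk m (js ! i)" if "i < length js" for i
          using that unfolding m't by (simp add: nth_default_def)
        have "M b = Poly_Mapping.nth (map (lk m) (k # l # js))"
          unfolding M_def using p a mi by (intro arg_cong[of _ _ Poly_Mapping.nth] nth_equalityI) (auto simp: nth_Cons split: nat.splits)
        moreover have "Poly_Mapping.keys (M b) \<subseteq> {..<length (k # l # js)}"
          unfolding calculation by (auto simp: in_keys_iff nth_default_def simp del: keys_nth split: if_splits)
        ultimately show "push (k # l # js) (M b) = m" using push_eq_iff[OF d, of "M b" m] m by blast
      qed
      have "a = lk m k + lk m l" if "m' = ?t" unfolding a_def that by simp
      with eq show "lk (sg (push (k # l # js) (M b)) (of_nat (a choose b))) m = (if b = lk m k then (if m' = ?t then ?C else 0) else 0)"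
        by (auto simp: lookup_single when_def)
    qed
    also have "\<dots> = (if m' = ?t then ?C else 0)"
    proof -
      have "lk m k \<le> a" if "m' = ?t" unfolding a_def that by simp
      then show ?thesis by auto
    qed
    finally show ?thesis .
  qed
  have "lk (subst_vars ?\<sigma> P) m = (\<Sum>m'\<in>Poly_Mapping.keys P. if m' = ?t then sv_scale ?C (lk P m') else 0)"
    unfolding lookup_sb using P by (intro sum.cong) (auto simp: *)
  then show ?thesis by (auto simp: in_keys_iff)
qed

text \<open>
  With the normalisation by factorials the binomial coefficients of the previous lemma turn into
  the structure constants of the annihilation algebra: \<open>m! n! (m+n-1 choose m-1) = m (m+n-1)!\<close>.
\<close>

lemma merge_coefficient:
  fixes X :: "'f::field_char_0 sv lpoly"
  assumes kl: "k \<noteq> l"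
    and X: "\<And>m'. (\<And>i. i \<noteq> k \<Longrightarrow> i \<noteq> l \<Longrightarrow> lk m' i = lk m i) \<Longrightarrow>
      lk X m' = sv_scale (of_nat ((lk m' k + lk m' l) choose lk m' k)) (U (lk m' k + lk m' l))"
  shows "sv_scale (fact (lk m k) * fact (lk m l))
      (lk (SV_V.pscale (const b) (SV_V.pscale (lam k) X) - SV_V.pscale (const a) (SV_V.pscale (lam l) X)) m) =
    sv_scale ((of_nat (lk m k) * b - of_nat (lk m l) * a) * fact (lk m k + lk m l - 1)) (U (lk m k + lk m l - 1))"
proof -
  have 1: "sv_scale (fact (lk m k) * fact (lk m l)) (lk (SV_V.pscale (lam k) X) m) =
      sv_scale (of_nat (lk m k) * fact (lk m k + lk m l - 1)) (U (lk m k + lk m l - 1))"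
  proof (cases "lk m k")
    case (Suc p)
    have "lk X (m - sg k 1) = sv_scale (of_nat ((p + lk m l) choose p)) (U (p + lk m l))"
      using kl Suc by (subst X) (simp_all add: lookup_minus lookup_single)
    moreover have "fact (Suc p) * fact (lk m l) * of_nat ((p + lk m l) choose p) = (of_nat (Suc p) * fact (p + lk m l) :: 'f)"
      by (simp add: binomial_fact field_simps)
    ultimately show ?thesis using Suc by (simp add: lookup_pscale_lam del: fact_Suc of_nat_Suc)
  qed (simp add: lookup_pscale_lam)
  have 2: "sv_scale (fact (lk m k) * fact (lk m l)) (lk (SV_V.pscale (lam l) X) m) =
      sv_scale (of_nat (lk m l) * fact (lk m k + lk m l - 1)) (U (lk m k + lk m l - 1))"
  proof (cases "lk m l")
    case (Suc p)
    have "lk X (m - sg l 1) = sv_scale (of_nat ((lk m k + p) choose lk m k)) (U (lk m k + p))"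
      using kl Suc by (subst X) (simp_all add: lookup_minus lookup_single)
    moreover have "fact (lk m k) * fact (Suc p) * of_nat ((lk m k + p) choose lk m k) = (of_nat (Suc p) * fact (lk m k + p) :: 'f)"
      by (simp add: binomial_fact field_simps)
    ultimately show ?thesis using Suc by (simp add: lookup_pscale_lam del: fact_Suc of_nat_Suc)
  qed (simp add: lookup_pscale_lam)
  have "sv_scale (fact (lk m k) * fact (lk m l)) (lk (SV_V.pscale (const b) (SV_V.pscale (lam k) X) - SV_V.pscale (const a) (SV_V.pscale (lam l) X)) m) =
    sv_scale b (sv_scale (fact (lk m k) * fact (lk m l)) (lk (SV_V.pscale (lam k) X) m)) -
    sv_scale a (sv_scale (fact (lk m k) * fact (lk m l)) (lk (SV_V.pscale (lam l) X) m))"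
    by (simp add: lookup_minus lookup_pscale_C SV_V.scale_right_diff_distrib mult.commute mult.left_commute)
  also have "\<dots> = sv_scale ((of_nat (lk m k) * b - of_nat (lk m l) * a) * fact (lk m k + lk m l - 1)) (U (lk m k + lk m l - 1))"
    unfolding 1 2 by (simp add: algebra_simps flip: SV_V.scale_left_diff_distrib)
  finally show ?thesis .
qed

lemma usubst_gen_bracket:
  assumes add: "\<And>v w. G (v + w) = G v + G w"
    and D: "\<And>v. G (sv_D v) = - SV_V.pscale (lam k + lam l) (G v)"
    and sc: "\<And>r v. G (sv_scale r v) = SV_V.pscale (const r) (G v)"
  shows "SV_V.usubst G (lam k) (sv_bracket (sv_of g) (sv_of h)) =
    SV_V.pscale (const (dcoeff h g)) (SV_V.pscale (lam k) (G (sv_of (gen_mul g h)))) -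
    SV_V.pscale (const (dcoeff g h)) (SV_V.pscale (lam l) (G (sv_of (gen_mul g h))))"
proof -
  have G0: "G 0 = 0" using add[of 0 0] by simp
  have c: "SV_V.pscale (lam k) (SV_V.pscale (const r) X) = SV_V.pscale (const r) (SV_V.pscale (lam k) X)" for r X
    by (simp add: mult.commute flip: SV_V.pscale_mult)
  show ?thesis
    unfolding sv_bracket_gen sv_gen_bracket_eq
    by (simp add: SV_V.usubst_pCons SV_V.usubst_0 G0 sc D SV_V.pscale_minus_right SV_V.pscale_add_left single_add
        SV_V.pscale_add_right SV_B.pscale_diff c)
qed

lemma ev_sb: "SV_B.ev (\<sigma> 0) R = subst_vars \<sigma> (SV_B.ev (lam 0) R)"
proof (induction R)
  case (pCons a R)
  then show ?case by (simp add: SV_B.ev_pCons sb_add sb_pscale_lam sb_single mon_def)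
qed (simp add: SV_B.ev_0)

lemma lookup_ev_lam0: "lk (SV_B.ev (lam 0) R) m = (if Poly_Mapping.keys m \<subseteq> {0} then coeff R (lk m 0) else 0)"
proof -
  have "(sg 0 n = m) \<longleftrightarrow> Poly_Mapping.keys m \<subseteq> {0} \<and> n = lk m 0" for n
    by (auto simp: poly_mapping_eq_iff fun_eq_iff lookup_single in_keys_iff when_def split: if_splits)
  then have "lk (SV_B.ev (lam 0) R) m = (\<Sum>n\<le>Polynomial.degree R. if n = lk m 0 then (if Poly_Mapping.keys m \<subseteq> {0} then coeff R n else 0) else 0)"
    unfolding ev_lam lookup_sum by (intro sum.cong) (auto simp: lookup_single when_def)
  then show ?thesis by (auto simp: coeff_eq_0)
qed

text \<open>
  The module axiom is the Jacobi identity of the conformal algebra, compared at \<open>\<lambda>\<^sub>0\<^sup>m \<lambda>\<^sub>1\<^sup>n\<close>.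
\<close>

lemma mode_act_act:
  "mode_act x (mode_act y v) - mode_act y (mode_act x v) = sv_scale (mode_coeff x y) (mode_act (mode_mul x y) v)"
proof -
  obtain g m h n where xy: "x = (g, m)" "y = (h, n)" by (metis surj_pair)
  define M where "M = Poly_Mapping.nth [m, n]"
  have M: "lk M 0 = m" "lk M 1 = n" "lk M (Suc 0) = n" by (simp_all add: M_def nth_default_def)
  have M': "lk M i = 0" if "i \<noteq> 0" "i \<noteq> 1" for i
    using that by (simp add: M_def nth_default_def)
  let ?a = "sv_of g" and ?b = "sv_of h"
  have 1: "lk (SV_B.app (lam i) a (SV_B.app (lam j) b (const v))) M =
      coeff (sv_bracket a (coeff (sv_bracket b v) (lk M j))) (lk M i)"
    if ij: "i \<noteq> j" "i \<in> {0, 1}" "j \<in> {0, 1}" for i j :: nat and a b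
  proof -
    have Q: "lk (SV_B.app (lam j) b (const v)) m' = coeff (sv_bracket b (if erase j m' = 0 then v else 0)) (lk m' j)" for m'
      by (subst lookup_app_lam) (auto simp: lookup_single when_def)
    have e0: "erase j m' = 0 \<longleftrightarrow> (\<forall>i. i \<noteq> j \<longrightarrow> lk m' i = 0)" for m'
      by (auto simp: poly_mapping_eq_iff fun_eq_iff lookup_erase)
    have z: "erase j (erase i M) = 0"
      using ij M' by (auto simp: e0 lookup_erase)
    have "lk m' i = 0" if "m' \<in> Poly_Mapping.keys (SV_B.app (lam j) b (const v))" for m'
      using that ij by (auto simp: in_keys_iff Q e0 split: if_splits)
    then show ?thesis
      using ij by (subst lookup_app_lam) (auto simp: Q z lookup_erase)
  qed
  define X where "X = SV_B.app (lam 0 + lam 1) (sv_of (gen_mul g h)) (const v)"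
  define U where "U N = coeff (sv_bracket (sv_of (gen_mul g h)) v) N" for N
  have "SV_B.app (lam 0) ?a (SV_B.app (lam 1) ?b (const v)) - SV_B.app (lam 1) ?b (SV_B.app (lam 0) ?a (const v)) =
      SV_V.usubst (\<lambda>e. SV_B.app (lam 0 + lam 1) e (const v)) (lam 0) (sv_bracket ?a ?b)"
    using lie_conformal_algebra.br_jacobi[OF sv_lie_conformal_algebra, of ?a ?b v] by (simp add: algebra_simps)
  also have "\<dots> = SV_V.pscale (const (dcoeff h g)) (SV_V.pscale (lam 0) X) - SV_V.pscale (const (dcoeff g h)) (SV_V.pscale (lam 1) X)"
    unfolding X_def by (rule usubst_gen_bracket) (simp_all add: SV_B.app_add_left SV_B.app_D_left SV_B.app_scale_left)
  finally have J: "SV_B.app (lam 0) ?a (SV_B.app (lam 1) ?b (const v)) - SV_B.app (lam 1) ?b (SV_B.app (lam 0) ?a (const v)) =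
      SV_V.pscale (const (dcoeff h g)) (SV_V.pscale (lam 0) X) - SV_V.pscale (const (dcoeff g h)) (SV_V.pscale (lam 1) X)" .
  have X: "lk X m' = sv_scale (of_nat ((lk m' 0 + lk m' 1) choose lk m' 0)) (U (lk m' 0 + lk m' 1))"
    if "\<And>i. i \<noteq> 0 \<Longrightarrow> i \<noteq> 1 \<Longrightarrow> lk m' i = lk M i" for m'
  proof -
    have k: "Poly_Mapping.keys m' \<subseteq> {0, 1}"
    proof
      fix i assume "i \<in> Poly_Mapping.keys m'"
      then have "lk m' i \<noteq> 0" by (simp add: in_keys_iff)
      then show "i \<in> {0, 1}" using that[of i] M'[of i] by auto
    qed
    have "X = subst_vars (\<lambda>i. ((lam 0 + lam 1) # map lam []) ! i) (SV_B.ev (lam 0) (sv_bracket (sv_of (gen_mul g h)) v))"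
      unfolding X_def SV_B.app_const by (subst ev_sb[symmetric]) simp
    moreover have "\<forall>m'\<in>Poly_Mapping.keys (SV_B.ev (lam 0) (sv_bracket (sv_of (gen_mul g h)) v)). Poly_Mapping.keys m' \<subseteq> {..<Suc (length [])}"
      by (auto simp: in_keys_iff[of _ "SV_B.ev _ _"] lookup_ev_lam0 split: if_splits)
    ultimately have "lk X m' = sv_scale (of_nat ((lk m' 0 + lk m' 1) choose lk m' 0))
       (lk (SV_B.ev (lam 0) (sv_bracket (sv_of (gen_mul g h)) v)) (Poly_Mapping.nth [lk m' 0 + lk m' 1]))"
      using lookup_sb_merge[of 0 1 "[]" "SV_B.ev (lam 0) (sv_bracket (sv_of (gen_mul g h)) v)" m'] k by simp
    moreover have "Poly_Mapping.keys (Poly_Mapping.nth [N]) \<subseteq> {0::nat}" for N :: nat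
      by (auto simp: in_keys_iff nth_default_def simp del: keys_nth split: if_splits)
    ultimately show ?thesis by (simp add: lookup_ev_lam0 U_def)
  qed
  have "sv_scale (fact (lk M 0) * fact (lk M 1)) (lk (SV_B.app (lam 0) ?a (SV_B.app (lam 1) ?b (const v)) - SV_B.app (lam 1) ?b (SV_B.app (lam 0) ?a (const v))) M) =
     sv_scale ((of_nat (lk M 0) * dcoeff h g - of_nat (lk M 1) * dcoeff g h) * fact (lk M 0 + lk M 1 - 1)) (U (lk M 0 + lk M 1 - 1))"
    unfolding J by (rule merge_coefficient) (simp_all add: X)
  then show ?thesis
    by (simp add: lookup_minus 1 M xy U_def SV_B.br_scale_right coeff_map_poly SV_V.scale_right_diff_distrib mult.commute)
qed

interpretation SVL: lie_basis sv_scale mode_coeff mode_mul "mode_act :: mode \<Rightarrow> 'f::field_char_0 sv \<Rightarrow> 'f sv"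
proof
  fix x y z :: mode and v w :: "'f sv" and k :: 'f
  show "mode_mul x y = mode_mul y x" by (rule mode_mul_comm)
  show "mode_coeff x y = - (mode_coeff y x :: 'f)" by (rule mode_coeff_skew)
  show "mode_act x (v + w) = mode_act x v + mode_act x w"
    by (cases x) (simp add: SV_B.br_add_right SV_V.scale_right_distrib)
  show "mode_act x (sv_scale k v) = sv_scale k (mode_act x v)"
    by (cases x) (simp add: SV_B.br_scale_right coeff_map_poly mult.commute)
qed (rule mode_jacobi mode_act_act)+


section \<open>Sesquilinearity\<close>

text \<open>
  \<open>h\<close> is linear in its \<open>i\<close>-th argument and turns \<open>\<partial>\<close> there into \<open>-\<sigma>\<close>.
\<close>

definition sesqui :: "nat \<Rightarrow> nat \<Rightarrow> 'f lpoly \<Rightarrow> ('f::field_char_0 sv list \<Rightarrow> 'f sv lpoly) \<Rightarrow> bool" where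
  "sesqui n i \<sigma> h \<longleftrightarrow> (\<forall>as. length as = n \<longrightarrow>
     (\<forall>a b. h (as[i := a + b]) = h (as[i := a]) + h (as[i := b])) \<and>
     (\<forall>c a. h (as[i := sv_scale c a]) = SV_V.pscale (const c) (h (as[i := a]))) \<and>
     (\<forall>a. h (as[i := sv_D a]) = - SV_V.pscale \<sigma> (h (as[i := a]))))"

lemma sesquiD:
  assumes "sesqui n i \<sigma> h" "length as = n"
  shows "h (as[i := a + b]) = h (as[i := a]) + h (as[i := b])"
    "h (as[i := sv_scale c a]) = SV_V.pscale (const c) (h (as[i := a]))"
    "h (as[i := sv_D a]) = - SV_V.pscale \<sigma> (h (as[i := a]))"
  using assms by (auto simp: sesqui_def)

lemma pscale_comm: "SV_V.pscale p (SV_V.pscale r P) = SV_V.pscale r (SV_V.pscale p P)"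
  by (simp add: mult.commute flip: SV_V.pscale_mult)

lemma sesqui_add: "sesqui n i \<sigma> h \<Longrightarrow> sesqui n i \<sigma> h' \<Longrightarrow> sesqui n i \<sigma> (\<lambda>as. h as + h' as)"
  by (simp add: sesqui_def SV_V.pscale_add_right)

lemma sesqui_pscale: "sesqui n i \<sigma> h \<Longrightarrow> sesqui n i \<sigma> (\<lambda>as. SV_V.pscale p (h as))"
  by (simp add: sesqui_def SV_V.pscale_add_right SV_V.pscale_minus_right pscale_comm[of p])

lemma sesqui_0: "sesqui n i \<sigma> (\<lambda>as. 0)"
  by (simp add: sesqui_def)

lemma sesqui_sum: "(\<And>x. x \<in> X \<Longrightarrow> sesqui n i \<sigma> (h x)) \<Longrightarrow> sesqui n i \<sigma> (\<lambda>as. \<Sum>x\<in>X. h x as)"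
  by (induction X rule: infinite_finite_induct) (simp_all add: sesqui_0 sesqui_add)

lemma sesqui_cong: "(\<And>as. length as = n \<Longrightarrow> h as = h' as) \<Longrightarrow> sesqui n i \<sigma> h \<longleftrightarrow> sesqui n i \<sigma> h'"
  by (simp add: sesqui_def)

lemma map_nth_update:
  assumes "distinct js" "j < length js" "set js \<subseteq> {..<length as}"
  shows "map ((!) (as[js ! j := a])) js = (map ((!) as) js)[j := a]"
proof -
  have "js ! j < length as" using assms by (meson lessThan_iff nth_mem subsetD)
  then show ?thesis
    using assms by (intro nth_equalityI) (auto simp: nth_list_update nth_eq_iff_index_eq)
qed

lemma sesqui_sb:
  assumes f: "sesqui p j (lam j) f" and js: "distinct js" "length js = p" "j < p" "set js \<subseteq> {..<n}"
  shows "sesqui n (js ! j) (\<sigma> j) (\<lambda>as. subst_vars \<sigma> (f (map ((!) as) js)))"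
  unfolding sesqui_def
proof (intro allI impI)
  fix as :: "'a sv list" assume as: "length as = n"
  have u: "map ((!) (as[js ! j := a])) js = (map ((!) as) js)[j := a]" for a
    using js as by (intro map_nth_update) auto
  show "(\<forall>a b. subst_vars \<sigma> (f (map ((!) (as[js ! j := a + b])) js)) =
      subst_vars \<sigma> (f (map ((!) (as[js ! j := a])) js)) + subst_vars \<sigma> (f (map ((!) (as[js ! j := b])) js))) \<and>
    (\<forall>c a. subst_vars \<sigma> (f (map ((!) (as[js ! j := sv_scale c a])) js)) =
      SV_V.pscale (const c) (subst_vars \<sigma> (f (map ((!) (as[js ! j := a])) js)))) \<and>
    (\<forall>a. subst_vars \<sigma> (f (map ((!) (as[js ! j := sv_D a])) js)) =
      - SV_V.pscale (\<sigma> j) (subst_vars \<sigma> (f (map ((!) (as[js ! j := a])) js))))"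
    unfolding u using sesquiD[OF f, of "map ((!) as) js"] js
    by (simp add: sb_add sb_pscale_C sb_minus sb_pscale_lam)
qed

lemma sesqui_app:
  assumes "sesqui n i \<sigma> h" "i \<noteq> k"
  shows "sesqui n i \<sigma> (\<lambda>as. SV_B.app \<tau> (as ! k) (h as))"
  using assms by (simp add: sesqui_def SV_B.app_add SV_B.app_pscale SV_B.app_minus)

lemma sesqui_app_self:
  assumes "\<And>as a. length as = n \<Longrightarrow> h (as[k := a]) = h as" "k < n"
  shows "sesqui n k \<tau> (\<lambda>as. SV_B.app \<tau> (as ! k) (h as))"
  using assms by (simp add: sesqui_def SV_B.app_add_left SV_B.app_scale_left SV_B.app_D_left)

text \<open>
  Conformally linear maps of one argument, with \<open>\<partial>\<close> acting as \<open>-\<tau>\<close>.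
\<close>

definition clin :: "'f lpoly \<Rightarrow> ('f::field_char_0 sv \<Rightarrow> 'f sv lpoly) \<Rightarrow> bool" where
  "clin \<tau> G \<longleftrightarrow> (\<forall>v w. G (v + w) = G v + G w) \<and> (\<forall>r v. G (sv_scale r v) = SV_V.pscale (const r) (G v)) \<and>
     (\<forall>v. G (sv_D v) = - SV_V.pscale \<tau> (G v))"

lemma clin_0: "clin \<tau> G \<Longrightarrow> G 0 = 0"
  unfolding clin_def by (metis add_cancel_right_right)

lemma clin_usubst:
  assumes G: "clin \<tau> G"
  shows "SV_V.usubst G \<sigma> (P + R) = SV_V.usubst G \<sigma> P + SV_V.usubst G \<sigma> R"
    "SV_V.usubst G \<sigma> (- P) = - SV_V.usubst G \<sigma> P"
    "SV_V.usubst G \<sigma> (pCons 0 P) = SV_V.pscale \<sigma> (SV_V.usubst G \<sigma> P)"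
    "SV_V.usubst G \<sigma> (map_poly (sv_scale c) P) = SV_V.pscale (const c) (SV_V.usubst G \<sigma> P)"
    "SV_V.usubst G \<sigma> (map_poly sv_D P) = - SV_V.pscale \<tau> (SV_V.usubst G \<sigma> P)"
proof -
  note G0 = clin_0[OF G]
  have add: "SV_V.usubst G \<sigma> (P + R) = SV_V.usubst G \<sigma> P + SV_V.usubst G \<sigma> R" for P R
    using G by (intro SV_V.usubst_add) (simp add: clin_def)
  show "SV_V.usubst G \<sigma> (P + R) = SV_V.usubst G \<sigma> P + SV_V.usubst G \<sigma> R" by (rule add)
  show "SV_V.usubst G \<sigma> (- P) = - SV_V.usubst G \<sigma> P"
    using add[of P "- P"] by (simp add: SV_V.usubst_0 G0 eq_neg_iff_add_eq_0 add.commute)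
  show "SV_V.usubst G \<sigma> (pCons 0 P) = SV_V.pscale \<sigma> (SV_V.usubst G \<sigma> P)"
    by (simp add: SV_V.usubst_pCons G0)
  show "SV_V.usubst G \<sigma> (map_poly (sv_scale c) P) = SV_V.pscale (const c) (SV_V.usubst G \<sigma> P)"
  proof (induction P)
    case (pCons a P)
    have "G (sv_scale c a) = SV_V.pscale (const c) (G a)" using G by (simp add: clin_def)
    then show ?case
      by (simp add: map_poly_pCons SV_V.usubst_pCons G0 pCons SV_V.pscale_add_right pscale_comm[of \<sigma>])
  qed (simp add: SV_V.usubst_0 G0)
  show "SV_V.usubst G \<sigma> (map_poly sv_D P) = - SV_V.pscale \<tau> (SV_V.usubst G \<sigma> P)"
  proof (induction P)
    case (pCons a P)
    have "G (sv_D a) = - SV_V.pscale \<tau> (G a)" using G by (simp add: clin_def)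
    then show ?case
      by (simp add: map_poly_pCons SV_V.usubst_pCons G0 pCons SV_V.pscale_add_right SV_V.pscale_minus_right pscale_comm[of \<sigma>])
  qed (simp add: SV_V.usubst_0 G0)
qed

text \<open>
  In the second argument of the bracket \<open>\<partial>\<close> becomes \<open>\<partial> + \<sigma>\<close>, and \<open>G\<close> turns this into
  \<open>-(\<sigma> + \<tau>) + \<sigma> = -\<tau>\<close>.
\<close>

lemma sesqui_usubst_bracket:
  assumes G: "\<And>as. length as = n \<Longrightarrow> clin (\<sigma> + \<tau>) (G as)"
    and inv: "\<And>as a i. length as = n \<Longrightarrow> i \<in> {k, l} \<Longrightarrow> G (as[i := a]) = G as"
    and kl: "k \<noteq> l" "k < n" "l < n"
  shows "sesqui n k \<sigma> (\<lambda>as. SV_V.usubst (G as) \<sigma> (sv_bracket (as ! k) (as ! l)))"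
    "sesqui n l \<tau> (\<lambda>as. SV_V.usubst (G as) \<sigma> (sv_bracket (as ! k) (as ! l)))"
  unfolding sesqui_def
  using assms(3-) inv clin_usubst[OF G]
  by (simp_all add: SV_B.br_add_left SV_B.br_scale_left SV_B.br_D_left SV_B.br_add_right SV_B.br_scale_right
      SV_B.br_D_right SV_V.pscale_add_left SV_V.pscale_minus_right)

lemma sesqui_usubst_arg:
  assumes G: "\<And>c. sesqui n i \<rho> (\<lambda>as. G as c)" and i: "i \<noteq> k" "i \<noteq> l"
  shows "sesqui n i \<rho> (\<lambda>as. SV_V.usubst (G as) \<sigma> (sv_bracket (as ! k) (as ! l)))"
  unfolding sesqui_def SV_V.usubst_def
  using i sesquiD[OF G]
  by (simp add: SV_V.pscale_add_right sum.distrib SV_V.pscale_minus_right sum_negf SV_V.pscale_sum_right)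
    (simp add: pscale_comm)

section \<open>Variables occurring in a polynomial\<close>

definition vars :: "nat \<Rightarrow> 'v::zero lpoly \<Rightarrow> bool" where
  "vars n P \<longleftrightarrow> (\<forall>m\<in>Poly_Mapping.keys P. Poly_Mapping.keys m \<subseteq> {..<n})"

lemma vars_0: "vars n 0" by (simp add: vars_def)
lemma vars_single: "Poly_Mapping.keys m \<subseteq> {..<n} \<Longrightarrow> vars n (sg m v)" by (simp add: vars_def)
lemma vars_lam: "i < n \<Longrightarrow> vars n (lam i)" unfolding lam_def by (rule vars_single) simp
lemma vars_add: "vars n P \<Longrightarrow> vars n R \<Longrightarrow> vars n (P + R)" for P R :: "'v::monoid_add lpoly"
  unfolding vars_def using keys_add[of P R] by blast

lemma vars_sum: "(\<And>x. x \<in> X \<Longrightarrow> vars n (h x)) \<Longrightarrow> vars n (sum h X)" for h :: "'x \<Rightarrow> 'v::comm_monoid_add lpoly"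
  by (induction X rule: infinite_finite_induct) (simp_all add: vars_0 vars_add)

lemma vars_minus: "vars n P \<Longrightarrow> vars n (- P)" for P :: "'v::ab_group_add lpoly"
  by (simp add: vars_def in_keys_iff)

lemma vars_pscale:
  assumes "vars n p" "vars n P"
  shows "vars n (SV_V.pscale p P)"
  unfolding SV_V.pscale_def
proof (intro vars_sum vars_single)
  fix m m' assume "m \<in> Poly_Mapping.keys p" "m' \<in> Poly_Mapping.keys P"
  then have "Poly_Mapping.keys m \<subseteq> {..<n}" "Poly_Mapping.keys m' \<subseteq> {..<n}" using assms by (auto simp: vars_def)
  then show "Poly_Mapping.keys (m + m') \<subseteq> {..<n}" using keys_add[of m m'] by blast
qed

lemma vars_mult:
  fixes p r :: "'f::field_char_0 lpoly"
  assumes "vars n p" "vars n r"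
  shows "vars n (p * r)"
  unfolding vars_def
proof
  fix m assume "m \<in> Poly_Mapping.keys (p * r)"
  then obtain a b where ab: "m = a + b" "a \<in> Poly_Mapping.keys p" "b \<in> Poly_Mapping.keys r" using keys_mult[of p r] by blast
  then have "Poly_Mapping.keys a \<subseteq> {..<n}" "Poly_Mapping.keys b \<subseteq> {..<n}" using assms by (auto simp: vars_def)
  then show "Poly_Mapping.keys m \<subseteq> {..<n}" using ab keys_add[of a b] by blast
qed

lemma vars_1: "vars n (1 :: 'f::field_char_0 lpoly)"
  using vars_single[of 0 n "1::'f"] by simp

lemma vars_power: "vars n p \<Longrightarrow> vars n (p ^ k)" for p :: "'f::field_char_0 lpoly"
  by (induction k) (simp_all add: vars_1 vars_mult)

lemma vars_prod: "(\<And>x. x \<in> X \<Longrightarrow> vars n (h x)) \<Longrightarrow> vars n (prod h X)" for h :: "'x \<Rightarrow> 'f::field_char_0 lpoly"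
  by (induction X rule: infinite_finite_induct) (simp_all add: vars_1 vars_mult)

lemma vars_const: "vars n (const v)" by (rule vars_single) simp

lemma vars_usubst: "vars n \<sigma> \<Longrightarrow> (\<And>v. vars n (G v)) \<Longrightarrow> vars n (SV_V.usubst G \<sigma> P)"
  unfolding SV_V.usubst_def by (intro vars_sum vars_pscale vars_power)

lemma vars_msubst:
  assumes "vars p P" "\<And>i. i < p \<Longrightarrow> vars n (\<sigma> i)" "\<And>v. vars n (G v)"
  shows "vars n (SV_V.msubst G \<sigma> P)"
  unfolding SV_V.msubst_def
proof (intro vars_sum vars_pscale vars_prod vars_power assms(2,3))
  fix m i assume "m \<in> Poly_Mapping.keys P" "i \<in> Poly_Mapping.keys m"
  then show "i < p" using assms(1) by (auto simp: vars_def)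
qed

lemma vars_app: "vars n \<sigma> \<Longrightarrow> vars n P \<Longrightarrow> vars n (SV_B.app \<sigma> a P)"
  unfolding SV_V.at_lam_def by (rule vars_msubst[of n]) (auto intro: vars_lam vars_usubst vars_const)

section \<open>Coefficients of a cochain\<close>

text \<open>
  Cochains without the condition of skew-symmetry.
\<close>

definition sesq :: "nat \<Rightarrow> ('f::field_char_0 sv, 'f sv) cochain set" where
  "sesq q = {f. (\<forall>as. length as \<noteq> q \<longrightarrow> f as = 0) \<and> (\<forall>as. vars q (f as)) \<and> (\<forall>i<q. sesqui q i (lam i) f)}"

lemma map_sv_scale: "Poly_Mapping.map (sv_scale c) P = SV_V.pscale (const c) P"
  by (rule poly_mapping_eqI) (simp add: lookup_pscale_C Poly_Mapping.map.rep_eq when_def)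

definition skew :: "nat \<Rightarrow> ('f::field_char_0 sv, 'f sv) cochain \<Rightarrow> bool" where
  "skew q f \<longleftrightarrow> (\<forall>as \<pi>. length as = q \<and> \<pi> permutes {..<q} \<longrightarrow>
     subst_vars (\<lambda>i. map lam (permute_list \<pi> [0..<q]) ! i) (f (permute_list \<pi> as)) = SV_V.pscale (of_int (sign \<pi>)) (f as))"

lemma cochains_sesq: "SV.cochains q = {f \<in> sesq q. skew q f}"
  unfolding SV.cochains_def sesq_def sesqui_def vars_def skew_def SV.cochain_at_def map_sv_scale
  by (rule Collect_cong) blast

lemma sesq_add: "f \<in> sesq q \<Longrightarrow> g \<in> sesq q \<Longrightarrow> (\<lambda>as. f as + g as) \<in> sesq q"
  by (auto simp: sesq_def vars_add sesqui_add)

lemma sesq_pscale: "f \<in> sesq q \<Longrightarrow> (\<lambda>as. SV_V.pscale (const c) (f as)) \<in> sesq q"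
  by (auto simp: sesq_def vars_pscale vars_const sesqui_pscale)

text \<open>
  The arguments are replaced by generators one at a time: \<open>SV\<close> is spanned by the generators under
  addition, scaling and \<open>\<partial>\<close>, and these operations preserve \<open>h = 0\<close>.
\<close>

lemma sesq_generators:
  assumes h: "h \<in> sesq q" and gen: "\<And>gs. length gs = q \<Longrightarrow> h (map sv_of gs) = 0"
  shows "h as = 0"
proof (cases "length as = q")
  case True
  have "k \<le> q \<Longrightarrow> \<forall>as. length as = q \<and> (\<forall>i. k \<le> i \<and> i < q \<longrightarrow> as ! i \<in> range sv_of) \<longrightarrow> h as = 0" for k
  proof (induction k)
    case 0
    have "h as = 0" if as: "length as = q" "\<forall>i<q. as ! i \<in> range sv_of" for as
    proof -
      have "\<forall>a\<in>set as. a \<in> range sv_of" using as by (auto simp: in_set_conv_nth)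
      then have "as \<in> range (map sv_of)"
        using ex_map_conv[of as sv_of] by auto
      then obtain gs where "as = map sv_of gs" by auto
      then show ?thesis using gen[of gs] as by simp
    qed
    then show ?case by simp
  next
    case (Suc k)
    show ?case
    proof (intro allI impI)
      fix as :: "'a sv list" assume as: "length as = q \<and> (\<forall>i. Suc k \<le> i \<and> i < q \<longrightarrow> as ! i \<in> range sv_of)"
      have s: "sesqui q k (lam k) h" using h Suc.prems by (auto simp: sesq_def)
      have "as ! k \<in> {a. h (as[k := a]) = 0}"
      proof (rule sv_span)
        show "range sv_of \<subseteq> {a. h (as[k := a]) = 0}"
        proof
          fix a :: "'a sv" assume a: "a \<in> range sv_of"
          have "\<forall>i. k \<le> i \<and> i < q \<longrightarrow> as[k := a] ! i \<in> range sv_of"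
            using a as by (auto simp: nth_list_update)
          then show "a \<in> {a. h (as[k := a]) = 0}" using Suc as by simp
        qed
      qed (use sesquiD[OF s, of as] as in auto)
      then show "h as = 0" by simp
    qed
  qed
  from this[of q] True show ?thesis by auto
next
  case False
  then show ?thesis using h by (simp add: sesq_def)
qed

text \<open>
  The value of the alternating function of a cochain on a word of modes: the coefficient of
  \<open>\<lambda>\<^sub>1\<^bsup>n\<^sub>1\<^esup>/n\<^sub>1! \<cdots> \<lambda>\<^sub>q\<^bsup>n\<^sub>q\<^esup>/n\<^sub>q!\<close> at generators.
\<close>

definition phi :: "('f::field_char_0 sv, 'f sv) cochain \<Rightarrow> mode list \<Rightarrow> 'f sv" where
  "phi f xs = sv_scale (\<Prod>x\<leftarrow>xs. fact (snd x)) (lk (f (map (sv_of \<circ> fst) xs)) (Poly_Mapping.nth (map snd xs)))"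

lemma phi_length: "f \<in> sesq q \<Longrightarrow> length xs \<noteq> q \<Longrightarrow> phi f xs = 0"
  by (simp add: phi_def sesq_def)

lemma prod_list_fact_nonzero: "(\<Prod>x\<leftarrow>xs. fact (snd x)) \<noteq> (0 :: 'f::field_char_0)"
  by (induction xs) auto

lemma nth_map_upt:
  assumes "Poly_Mapping.keys m \<subseteq> {..<q}"
  shows "Poly_Mapping.nth (map (lk m) [0..<q]) = m"
  by (rule poly_mapping_eqI) (use assms in \<open>auto simp: nth_default_def in_keys_iff\<close>)

lemma lookup_eq_phi:
  assumes "length gs = q" "Poly_Mapping.keys m \<subseteq> {..<q}"
  shows "lk (f (map sv_of gs)) m = sv_scale (1 / (\<Prod>i<q. fact (lk m i))) (phi f (zip gs (map (lk m) [0..<q])))"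
proof -
  have 1: "map (sv_of \<circ> fst) (zip gs (map (lk m) [0..<q])) = map sv_of gs"
    using assms by (simp flip: map_map)
  have 2: "map snd (zip gs (map (lk m) [0..<q])) = map (lk m) [0..<q]" using assms by simp
  have "(\<Prod>x\<leftarrow>zip gs (map (lk m) [0..<q]). fact (snd x)) = prod_list (map fact (map snd (zip gs (map (lk m) [0..<q]))) :: 'a list)"
    by (simp add: comp_def)
  also have "\<dots> = (\<Prod>i<q. fact (lk m i))"
    unfolding 2 by (simp add: comp_def prod.list_conv_set_nth atLeast0LessThan)
  finally have 3: "(\<Prod>x\<leftarrow>zip gs (map (lk m) [0..<q]). fact (snd x)) = (\<Prod>i<q. fact (lk m i) :: 'a)" .
  show ?thesis
    unfolding phi_def 1 2 3 nth_map_upt[OF assms(2)] by simp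
qed

lemma phi_inject:
  assumes f: "f \<in> sesq q" and g: "g \<in> sesq q" and eq: "\<And>xs. length xs = q \<Longrightarrow> phi f xs = phi g xs"
  shows "f = g"
proof
  fix as
  let ?h = "\<lambda>as. f as + SV_V.pscale (const (-1)) (g as)"
  have h: "?h \<in> sesq q" by (intro sesq_add sesq_pscale f g)
  have "?h as = 0"
  proof (rule sesq_generators[OF h])
    fix gs :: "sv_gen list" assume gs: "length gs = q"
    have "lk (f (map sv_of gs)) m = lk (g (map sv_of gs)) m" for m
    proof (cases "Poly_Mapping.keys m \<subseteq> {..<q}")
      case True
      then show ?thesis using gs by (simp add: lookup_eq_phi eq)
    next
      case False
      have "vars q (f (map sv_of gs))" "vars q (g (map sv_of gs))" using f g by (auto simp: sesq_def)
      then have "m \<notin> Poly_Mapping.keys (f (map sv_of gs))" "m \<notin> Poly_Mapping.keys (g (map sv_of gs))"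
        using False by (auto simp: vars_def)
      then show ?thesis by (simp add: in_keys_iff)
    qed
    then show "?h (map sv_of gs) = 0" by (intro poly_mapping_eqI) (simp add: lookup_add lookup_pscale_C)
  qed
  then show "f as = g as" by (simp add: single_uminus SV_V.pscale_minus_left)
qed


lemma permute_upt:
  assumes "p permutes {..<q}"
  shows "distinct (permute_list p [0..<q])" "set (permute_list p [0..<q]) = {..<q}" "length (permute_list p [0..<q]) = q"
  using assms by (simp_all add: distinct_permute_list set_permute_list lessThan_atLeast0)

lemma permute_list_upt:
  assumes "p permutes {..<q}" "length xs = q"
  shows "permute_list p xs = map ((!) xs) (permute_list p [0..<q])"
proof -
  have "map ((!) xs) (permute_list p [0..<q]) = permute_list p (map ((!) xs) [0..<q])"
    using assms by (intro permute_list_map[symmetric]) simp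
  moreover have "map ((!) xs) [0..<q] = xs" using assms map_nth[of xs] by simp
  ultimately show ?thesis by simp
qed

abbreviation perm_lams :: "(nat \<Rightarrow> nat) \<Rightarrow> nat \<Rightarrow> nat \<Rightarrow> 'f::field_char_0 lpoly" where
  "perm_lams p q \<equiv> \<lambda>i. map lam (permute_list p [0..<q]) ! i"

lemma prod_list_permute:
  fixes h :: "'a \<Rightarrow> 'f::comm_monoid_mult"
  assumes "p permutes {..<length xs}"
  shows "prod_list (map h (permute_list p xs)) = prod_list (map h xs)"
  using assms by (metis mset_map mset_permute_list prod_mset_prod_list)

lemma phi_permute:
  assumes f: "f \<in> sesq q" and p: "p permutes {..<q}" and xs: "length xs = q"
  shows "phi f (permute_list p xs) = sv_scale (\<Prod>x\<leftarrow>xs. fact (snd x))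
    (lk (subst_vars (perm_lams p q) (f (permute_list p (map (sv_of \<circ> fst) xs)))) (Poly_Mapping.nth (map snd xs)))"
proof -
  let ?m = "Poly_Mapping.nth (map snd xs)"
  have k: "Poly_Mapping.keys ?m \<subseteq> {..<q}"
    using xs by (auto simp: in_keys_iff nth_default_def simp del: keys_nth split: if_splits)
  have "map (lk ?m) (permute_list p [0..<q]) = permute_list p (map (lk ?m) [0..<q])"
    using p by (intro permute_list_map[symmetric]) simp
  also have "map (lk ?m) [0..<q] = map snd xs"
    using xs by (intro nth_equalityI) (simp_all add: nth_default_def)
  finally have n: "map (lk ?m) (permute_list p [0..<q]) = permute_list p (map snd xs)" .
  have "lk (subst_vars (perm_lams p q) (f (permute_list p (map (sv_of \<circ> fst) xs)))) ?m =
      lk (f (permute_list p (map (sv_of \<circ> fst) xs))) (Poly_Mapping.nth (permute_list p (map snd xs)))"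
    unfolding n[symmetric] using f k
    by (subst lookup_sb_lam) (auto simp: permute_upt[OF p] sesq_def vars_def simp del: keys_nth lookup_nth)
  then show ?thesis
    using p xs by (simp add: phi_def permute_list_map prod_list_permute)
qed

lemma skew_imp_alt:
  assumes f: "f \<in> sesq q" and s: "skew q f"
  shows "SVL.alt (phi f)"
  unfolding SVL.alt_def
proof (intro allI)
  fix us vs :: "mode list" and x y
  let ?xs = "us @ x # y # vs"
  show "phi f ?xs = - phi f (us @ y # x # vs)"
  proof (cases "length ?xs = q")
    case True
    let ?i = "length us"
    let ?p = "transpose ?i (Suc ?i)"
    have p: "?p permutes {..<q}" using True by (intro permutes_swap_id) auto
    have xs: "permute_list ?p ?xs = us @ y # x # vs"
    proof (rule nth_equalityI)
      fix i assume i: "i < length (permute_list ?p ?xs)"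
      have "permute_list ?p ?xs ! i = ?xs ! ?p i"
        using i by (simp add: permute_list_def del: upt_Suc)
      moreover have "?xs ! ?p i = (us @ y # x # vs) ! i"
      proof -
        consider "i < ?i" | "i = ?i" | "i = Suc ?i" | k where "i = ?i + Suc (Suc k)"
          by (metis add_Suc_right add_0_right less_imp_Suc_add linorder_neqE_nat not_less_eq)
        then show ?thesis by cases (simp_all add: nth_append transpose_def)
      qed
      ultimately show "permute_list ?p ?xs ! i = (us @ y # x # vs) ! i" by simp
    qed simp
    have "sign ?p = -1" by (simp add: sign_swap_id)
    then have "subst_vars (perm_lams ?p q) (f (permute_list ?p (map (sv_of \<circ> fst) ?xs))) = - f (map (sv_of \<circ> fst) ?xs)"
      using s[unfolded skew_def, rule_format, of "map (sv_of \<circ> fst) ?xs" ?p] p True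
      by (simp add: SV_V.pscale_minus_left)
    then have "phi f (permute_list ?p ?xs) = - phi f ?xs"
      unfolding phi_permute[OF f p True] by (simp add: phi_def)
    then show ?thesis by (simp add: xs)
  next
    case False
    then show ?thesis using phi_length[OF f] by simp
  qed
qed

lemma vars_perm_lams: "p permutes {..<q} \<Longrightarrow> i < q \<Longrightarrow> vars q (perm_lams p q i)"
  using permute_upt(2,3)[of p q] nth_mem[of i "permute_list p [0..<q]"] by (auto intro!: vars_lam)

text \<open>
  Both sides of the condition of skew-symmetry are sesquilinear in the arguments, hence determined by their
  coefficients at generators, where the condition is \<open>alt_permute_list\<close>.
\<close>

lemma alt_imp_skew:
  fixes f :: "('f::field_char_0 sv, 'f sv) cochain"
  assumes f: "f \<in> sesq q" and a: "SVL.alt (phi f)"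
  shows "skew q f"
  unfolding skew_def
proof (intro allI impI)
  fix as :: "'f sv list" and p assume "length as = q \<and> p permutes {..<q}"
  then have as: "length as = q" and p: "p permutes {..<q}" by auto
  define g where "g as = (if length as = q then subst_vars (perm_lams p q) (f (permute_list p as)) else 0)" for as :: "'f sv list"
  have "g \<in> sesq q"
  proof -
    have "vars q (g as)" for as
      using f p unfolding g_def sesq_def
      by (auto intro!: vars_msubst[of q] vars_const vars_0 vars_perm_lams simp del: nth_map)
    moreover have "sesqui q i (lam i) g" if i: "i < q" for i
    proof -
      have "i \<in> set (permute_list p [0..<q])" using i permute_upt(2)[OF p] by simp
      then obtain j where j: "j < q" "permute_list p [0..<q] ! j = i"
        using permute_upt(3)[OF p] unfolding in_set_conv_nth by auto
      have "sesqui q (permute_list p [0..<q] ! j) (perm_lams p q j)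
         (\<lambda>as. subst_vars (perm_lams p q) (f (map ((!) as) (permute_list p [0..<q]))))"
      proof (rule sesqui_sb)
        show "sesqui q j (lam j) f" using f j by (simp add: sesq_def)
      qed (use j permute_upt[OF p] in simp_all)
      moreover have pl: "perm_lams p q j = lam i"
        using j permute_upt(3)[OF p] by simp
      ultimately have "sesqui q i (lam i) (\<lambda>as. subst_vars (perm_lams p q) (f (map ((!) as) (permute_list p [0..<q]))))"
        unfolding j(2) pl by blast
      then show ?thesis
        by (rule iffD1[OF sesqui_cong, rotated]) (simp add: g_def flip: permute_list_upt[OF p])
    qed
    ultimately show ?thesis by (simp add: sesq_def g_def)
  qed
  moreover have "(\<lambda>as. SV_V.pscale (const (of_int (sign p))) (f as)) \<in> sesq q" by (rule sesq_pscale[OF f])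
  ultimately have "g = (\<lambda>as. SV_V.pscale (const (of_int (sign p))) (f as))"
  proof (rule phi_inject)
    fix xs :: "mode list" assume xs: "length xs = q"
    have "phi g xs = phi f (permute_list p xs)"
      unfolding phi_permute[OF f p xs] using xs by (simp add: phi_def g_def)
    also have "\<dots> = sv_scale (of_int (sign p)) (phi f xs)"
      using SVL.alt_permute_list[OF a] p xs by simp
    also have "\<dots> = phi (\<lambda>as. SV_V.pscale (const (of_int (sign p))) (f as)) xs"
      unfolding phi_def lookup_pscale_C by (simp add: mult.commute)
    finally show "phi g xs = phi (\<lambda>as. SV_V.pscale (const (of_int (sign p))) (f as)) xs" .
  qed
  from fun_cong[OF this, of as] as
  show "subst_vars (perm_lams p q) (f (permute_list p as)) = SV_V.pscale (of_int (sign p)) (f as)"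
    by (simp add: g_def)
qed

lemma cochains_iff: "f \<in> SV.cochains q \<longleftrightarrow> f \<in> sesq q \<and> SVL.alt (phi f)"
  unfolding cochains_sesq using skew_imp_alt alt_imp_skew by blast

section \<open>The differential in terms of coefficients\<close>

abbreviation omit :: "nat \<Rightarrow> nat set \<Rightarrow> nat list" where
  "omit n I \<equiv> nths [0..<n] (- I)"

lemma nths_omit: "length xs = n \<Longrightarrow> nths xs I = map ((!) xs) (nths [0..<n] I)"
  using map_nth[of xs] by (simp flip: nths_map)

lemma set_omit: "set (omit n I) = {..<n} - I"
  by (auto simp: set_nths intro: nth_upt[of 0, simplified, symmetric])

lemma length_omit: "I \<subseteq> {..<n} \<Longrightarrow> length (omit n I) = n - card I"
proof -
  assume I: "I \<subseteq> {..<n}"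
  have "length (omit n I) = card (set (omit n I))" by (simp add: distinct_card)
  also have "\<dots> = n - card I"
    unfolding set_omit using I finite_subset[OF I] by (simp add: card_Diff_subset)
  finally show ?thesis .
qed

text \<open>
  The terms of the two sums in the differential.
\<close>

definition term1 :: "nat \<Rightarrow> nat \<Rightarrow> ('f::field_char_0 sv, 'f sv) cochain \<Rightarrow> ('f sv, 'f sv) cochain" where
  "term1 q k f as = SV_B.app (lam k) (as ! k)
     (subst_vars (\<lambda>i. map lam (omit (Suc q) {k}) ! i) (f (map ((!) as) (omit (Suc q) {k}))))"

definition term2 :: "nat \<Rightarrow> nat \<Rightarrow> nat \<Rightarrow> ('f::field_char_0 sv, 'f sv) cochain \<Rightarrow> ('f sv, 'f sv) cochain" where
  "term2 q k l f as = SV_V.usubst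
     (\<lambda>c. subst_vars (\<lambda>i. ((lam k + lam l) # map lam (omit (Suc q) {k, l})) ! i) (f (c # map ((!) as) (omit (Suc q) {k, l}))))
     (lam k) (sv_bracket (as ! k) (as ! l))"

lemma diff_eq:
  "SV.diff q f as = (if length as \<noteq> Suc q then 0 else
     (\<Sum>k<Suc q. SV_V.pscale ((-1) ^ k) (term1 q k f as)) +
     (\<Sum>l<Suc q. \<Sum>k<l. SV_V.pscale ((-1) ^ (k + l)) (term2 q k l f as)))"
proof (cases "length as = Suc q")
  case True
  show ?thesis
    unfolding SV.diff_def SV.cochain_at_def term1_def term2_def nths_omit[OF True] ..
next
  case False
  then show ?thesis by (simp only: SV.diff_def if_True not_False_eq_True)
qed

lemma clin_sb:
  assumes f: "f \<in> sesq (Suc p)" and as: "length as = p"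
  shows "clin (\<sigma> 0) (\<lambda>c. subst_vars \<sigma> (f (c # as)))"
proof -
  have "sesqui (Suc p) 0 (lam 0) f" using f by (simp add: sesq_def)
  from sesquiD[OF this, of "0 # as"] as show ?thesis
    by (simp add: clin_def sb_add sb_pscale_C sb_minus sb_pscale_lam)
qed

lemma sesqui_term1:
  assumes f: "f \<in> sesq q" and k: "k < Suc q" and i: "i < Suc q"
  shows "sesqui (Suc q) i (lam i) (term1 q k f)"
proof (cases "i = k")
  case True
  show ?thesis
    unfolding term1_def True
  proof (rule sesqui_app_self)
    fix as :: "'a sv list" and a
    have "map ((!) (as[k := a])) (omit (Suc q) {k}) = map ((!) as) (omit (Suc q) {k})"
      by (rule map_cong) (auto simp: set_omit simp del: upt_Suc)
    then show "subst_vars ((!) (map lam (omit (Suc q) {k}))) (f (map ((!) (as[k := a])) (omit (Suc q) {k}))) =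
      subst_vars ((!) (map lam (omit (Suc q) {k}))) (f (map ((!) as) (omit (Suc q) {k})))" by (simp only:)
  qed (rule k)
next
  case False
  have len: "length (omit (Suc q) {k}) = q" using k by (subst length_omit) auto
  have "i \<in> set (omit (Suc q) {k})" using False i by (simp add: set_omit del: upt_Suc)
  then obtain j where j: "j < q" "omit (Suc q) {k} ! j = i" unfolding in_set_conv_nth len by blast
  have "sesqui (Suc q) (omit (Suc q) {k} ! j) (map lam (omit (Suc q) {k}) ! j)
      (\<lambda>as. subst_vars (\<lambda>i. map lam (omit (Suc q) {k}) ! i) (f (map ((!) as) (omit (Suc q) {k}))))"
  proof (rule sesqui_sb)
    show "sesqui q j (lam j) f" using f j by (simp add: sesq_def)
  qed (use j len in \<open>auto simp: set_omit simp del: upt_Suc\<close>)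
  then show ?thesis
    unfolding term1_def using j False len by (intro sesqui_app) simp_all
qed

lemma sesqui_term2:
  assumes f: "f \<in> sesq q" and kl: "k < l" "l < Suc q" and i: "i < Suc q"
  shows "sesqui (Suc q) i (lam i) (term2 q k l f)"
proof -
  let ?js = "omit (Suc q) {k, l}"
  have len: "length ?js = q - 1" using kl by (subst length_omit) auto
  obtain p where p: "q = Suc p" using kl by (cases q) auto
  show ?thesis
  proof (cases "i \<in> {k, l}")
    case True
    have inv: "map ((!) (as[i := a])) ?js = map ((!) as) ?js" if "i \<in> {k, l}" for as :: "'a sv list" and a i
      using that by (intro map_cong) (auto simp: set_omit simp del: upt_Suc)
    define G where "G as c = subst_vars ((!) ((lam k + lam l) # map lam ?js)) (f (c # map ((!) as) ?js))" for as c
    have cl: "clin (lam k + lam l) (G as)" for as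
      using clin_sb[of f p "map ((!) as) ?js" "(!) ((lam k + lam l) # map lam ?js)"] f len p
      unfolding G_def by simp
    have iv: "G (as[i := a]) = G as" if "i \<in> {k, l}" for as i a
      unfolding G_def inv[OF that] ..
    note s = sesqui_usubst_bracket[where n = "Suc q" and k = k and l = l and G = G, OF cl iv]
    have t: "term2 q k l f = (\<lambda>as. SV_V.usubst (G as) (lam k) (sv_bracket (as ! k) (as ! l)))"
      by (simp only: term2_def[abs_def] G_def[abs_def])
    show ?thesis
      using s kl True unfolding t by auto
  next
    case False
    have "i \<in> set ?js" using False i by (simp add: set_omit del: upt_Suc)
    then obtain j where j: "j < q - 1" "?js ! j = i" unfolding in_set_conv_nth len by blast
    have "sesqui (Suc q) i (lam i) (\<lambda>as. subst_vars ((!) ((lam k + lam l) # map lam ?js)) (f (c # map ((!) as) ?js)))" for c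
      unfolding sesqui_def
    proof (intro allI impI)
      fix as :: "'a sv list" assume as: "length as = Suc q"
      have s: "sesqui q (Suc j) (lam (Suc j)) f" using f j by (simp add: sesq_def)
      have u: "c # map ((!) (as[i := a])) ?js = (c # map ((!) as) ?js)[Suc j := a]" for a
        using map_nth_update[of ?js j as a] as j len by (simp add: set_omit del: upt_Suc)
      have l: "length (c # map ((!) as) ?js) = q" using len p by simp
      show "(\<forall>a b. subst_vars ((!) ((lam k + lam l) # map lam ?js)) (f (c # map ((!) (as[i := a + b])) ?js)) =
          subst_vars ((!) ((lam k + lam l) # map lam ?js)) (f (c # map ((!) (as[i := a])) ?js)) +
          subst_vars ((!) ((lam k + lam l) # map lam ?js)) (f (c # map ((!) (as[i := b])) ?js))) \<and>
        (\<forall>r a. subst_vars ((!) ((lam k + lam l) # map lam ?js)) (f (c # map ((!) (as[i := sv_scale r a])) ?js)) =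
          SV_V.pscale (const r) (subst_vars ((!) ((lam k + lam l) # map lam ?js)) (f (c # map ((!) (as[i := a])) ?js)))) \<and>
        (\<forall>a. subst_vars ((!) ((lam k + lam l) # map lam ?js)) (f (c # map ((!) (as[i := sv_D a])) ?js)) =
          - SV_V.pscale (lam i) (subst_vars ((!) ((lam k + lam l) # map lam ?js)) (f (c # map ((!) (as[i := a])) ?js))))"
        unfolding u sesquiD[OF s l] using j len
        by (simp add: sb_add sb_pscale_C sb_minus sb_pscale_lam del: upt_Suc)
    qed
    then show ?thesis
      unfolding term2_def using False by (intro sesqui_usubst_arg) auto
  qed
qed

lemma diff_sesq:
  assumes f: "f \<in> sesq q"
  shows "SV.diff q f \<in> sesq (Suc q)"
proof -
  have v1: "vars (Suc q) (term1 q k f as)" if "k < Suc q" for k as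
  proof -
    have len: "length (omit (Suc q) {k}) = q" using that by (subst length_omit) auto
    have "lam (omit (Suc q) {k} ! i) = (lam (omit (Suc q) {k} ! i) :: 'a lpoly) \<and> omit (Suc q) {k} ! i < Suc q" if "i < q" for i
      using nth_mem[of i "omit (Suc q) {k}"] that len unfolding set_omit by auto
    then show ?thesis
      unfolding term1_def using f that len
      by (intro vars_app vars_lam vars_msubst[of q]) (auto simp: sesq_def vars_lam vars_const simp del: upt_Suc)
  qed
  have v2: "vars (Suc q) (term2 q k l f as)" if kl: "k < l" "l < Suc q" for k l as
  proof -
    have len: "length (omit (Suc q) {k, l}) = q - 1" using kl by (subst length_omit) auto
    have "omit (Suc q) {k, l} ! i < Suc q" if "i < q - 1" for i
      using nth_mem[of i "omit (Suc q) {k, l}"] that len unfolding set_omit by auto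
    then show ?thesis
      unfolding term2_def using f kl len
      by (intro vars_usubst vars_lam vars_msubst[of q])
        (auto simp: sesq_def nth_Cons vars_lam vars_const vars_add simp del: upt_Suc split: nat.splits)
  qed
  have c: "(-1) ^ k = (const ((-1) ^ k) :: 'a lpoly)" for k
    by (induction k) (simp_all add: mult_single flip: single_uminus single_one)
  have "vars (Suc q) (SV.diff q f as)" for as
    unfolding diff_eq c using v1 v2
    by (auto intro!: vars_0 vars_add vars_sum vars_pscale vars_const simp del: sum.lessThan_Suc)
  moreover have "sesqui (Suc q) i (lam i) (SV.diff q f)" if i: "i < Suc q" for i
  proof -
    have "sesqui (Suc q) i (lam i) (\<lambda>as. (\<Sum>k<Suc q. SV_V.pscale ((-1) ^ k) (term1 q k f as)) +
     (\<Sum>l<Suc q. \<Sum>k<l. SV_V.pscale ((-1) ^ (k + l)) (term2 q k l f as)))"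
      using i f by (intro sesqui_add sesqui_sum sesqui_pscale sesqui_term1 sesqui_term2) auto
    then show ?thesis
      by (rule iffD1[OF sesqui_cong, rotated]) (simp only: diff_eq if_False not_True_eq_False simp_thms)
  qed
  ultimately show ?thesis by (simp add: sesq_def diff_eq)
qed


lemma prod_list_nths:
  fixes h :: "'a \<Rightarrow> 'f::comm_monoid_mult"
  shows "prod_list (map h (nths xs (- I))) = (\<Prod>i\<in>{..<length xs} - I. h (xs ! i))"
proof -
  have "prod_list (map h (nths xs (- I))) = prod_list (map (\<lambda>i. h (xs ! i)) (omit (length xs) I))"
    unfolding nths_omit[OF refl, of xs "- I"] by (simp add: comp_def)
  also have "\<dots> = (\<Prod>i\<in>set (omit (length xs) I). h (xs ! i))"
    by (rule prod.distinct_set_conv_list[symmetric]) simp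
  finally show ?thesis by (simp only: set_omit)
qed

lemma prod_list_nth: "prod_list (map h xs) = (\<Prod>i<length xs. h (xs ! i))" for h :: "'a \<Rightarrow> 'f::comm_monoid_mult"
  using prod_list_nths[of h xs "{}"] by (simp add: nths_all)

lemma keys_nth_subset: "length ns = n \<Longrightarrow> Poly_Mapping.keys (Poly_Mapping.nth ns) \<subseteq> {..<n}" for ns :: "nat list"
  by (auto simp: in_keys_iff nth_default_def simp del: keys_nth split: if_splits)

lemma lk_nth: "i < length ns \<Longrightarrow> lk (Poly_Mapping.nth ns) i = ns ! i" for ns :: "nat list"
  by (simp add: nth_default_def)

lemma lookup_term1:
  assumes f: "f \<in> sesq q" and xs: "length xs = Suc q" and k: "k < Suc q"
  shows "sv_scale (\<Prod>x\<leftarrow>xs. fact (snd x)) (lk (term1 q k f (map (sv_of \<circ> fst) xs)) (Poly_Mapping.nth (map snd xs))) =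
    mode_act (xs ! k) (phi f (nths xs (- {k})))"
proof -
  let ?as = "map (sv_of \<circ> fst) xs :: 'a sv list" and ?m = "Poly_Mapping.nth (map snd xs)" and ?js = "omit (Suc q) {k}"
  let ?Q = "subst_vars (\<lambda>i. map lam ?js ! i) (f (map ((!) ?as) ?js))"
  have len: "length ?js = q" using k by (subst length_omit) auto
  have lQ: "lk ?Q m' = (if Poly_Mapping.keys m' \<subseteq> set ?js then lk (f (map ((!) ?as) ?js)) (Poly_Mapping.nth (map (lk m') ?js)) else 0)" for m'
    using f by (intro lookup_sb_lam) (auto simp: len sesq_def vars_def simp del: upt_Suc)
  have "\<forall>m'\<in>Poly_Mapping.keys ?Q. lk m' k = 0"
  proof
    fix m' assume "m' \<in> Poly_Mapping.keys ?Q"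
    then have "lk ?Q m' \<noteq> 0" by (simp only: in_keys_iff not_False_eq_True)
    then have "Poly_Mapping.keys m' \<subseteq> set ?js" using lQ[of m'] by metis
    then have "k \<notin> Poly_Mapping.keys m'" unfolding set_omit by auto
    then show "lk m' k = 0" by (simp add: in_keys_iff)
  qed
  then have 1: "lk (term1 q k f ?as) ?m = coeff (sv_bracket (?as ! k) (lk ?Q (erase k ?m))) (lk ?m k)"
    unfolding term1_def by (rule lookup_app_lam)
  have ke: "Poly_Mapping.keys (erase k ?m) \<subseteq> set ?js"
  proof
    fix i assume "i \<in> Poly_Mapping.keys (erase k ?m)"
    then have "i \<noteq> k \<and> i \<in> Poly_Mapping.keys ?m"
      by (simp add: in_keys_iff lookup_erase del: keys_nth lookup_nth split: if_splits)
    then show "i \<in> set ?js"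
      using keys_nth_subset[of "map snd xs" "Suc q"] xs unfolding set_omit by auto
  qed
  have a: "map ((!) ?as) ?js = map (sv_of \<circ> fst) (nths xs (- {k}))"
    unfolding nths_omit[OF xs] using xs by (auto simp: set_omit simp del: upt_Suc)
  have n: "map (lk (erase k ?m)) ?js = map snd (nths xs (- {k}))"
    unfolding nths_omit[OF xs] using xs by (auto simp: set_omit lookup_erase lk_nth simp del: upt_Suc lookup_nth)
  have p: "(\<Prod>x\<leftarrow>xs. fact (snd x)) = fact (snd (xs ! k)) * ((\<Prod>x\<leftarrow>nths xs (- {k}). fact (snd x)) :: 'a)"
    unfolding prod_list_nths prod_list_nth[of _ xs] using xs k by (intro prod.remove) auto
  have xk: "?as ! k = sv_of (fst (xs ! k))" "lk ?m k = snd (xs ! k)" using xs k by (simp_all add: lk_nth del: lookup_nth)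
  obtain g n where gn: "xs ! k = (g, n)" by (cases "xs ! k") auto
  show ?thesis
    unfolding 1 p lQ n a[symmetric] phi_def using ke
    by (simp add: xk gn SV_B.br_scale_right coeff_map_poly a del: upt_Suc lookup_nth)
qed

lemma lookup_term2:
  assumes f: "f \<in> sesq q" and xs: "length xs = Suc q" and kl: "k < l" "l < Suc q"
  shows "sv_scale (\<Prod>x\<leftarrow>xs. fact (snd x)) (lk (term2 q k l f (map (sv_of \<circ> fst) xs)) (Poly_Mapping.nth (map snd xs))) =
    sv_scale (mode_coeff (xs ! k) (xs ! l)) (phi f (mode_mul (xs ! k) (xs ! l) # nths xs (- {k, l})))"
proof -
  let ?as = "map (sv_of \<circ> fst) xs :: 'a sv list" and ?m = "Poly_Mapping.nth (map snd xs)" and ?js = "omit (Suc q) {k, l}"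
  obtain p where p: "q = Suc p" using kl by (cases q) auto
  have len: "length ?js = p" using kl p by (subst length_omit) auto
  obtain g m h n where gm: "xs ! k = (g, m)" "xs ! l = (h, n)" by (metis surj_pair)
  have xk: "?as ! k = sv_of g" "?as ! l = sv_of h" "lk ?m k = m" "lk ?m l = n"
    using xs kl gm by (simp_all add: lk_nth del: lookup_nth)
  \<comment> \<open>\<open>G c\<close> is the cochain with the bracket replaced by \<open>c\<close>\<close>
  define G where "G c = subst_vars ((!) ((lam k + lam l) # map lam ?js)) (f (c # map ((!) ?as) ?js))" for c
  have cl: "clin (lam k + lam l) G"
    using clin_sb[of f p "map ((!) ?as) ?js" "(!) ((lam k + lam l) # map lam ?js)"] f len p
    unfolding G_def by simp
  define X where "X = G (sv_of (gen_mul g h))"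
  define P where "P = f (sv_of (gen_mul g h) # map ((!) ?as) ?js)"
  define U where "U N = lk P (Poly_Mapping.nth (N # map (lk ?m) ?js))" for N
  have t: "term2 q k l f ?as = SV_V.pscale (const (dcoeff h g)) (SV_V.pscale (lam k) X) - SV_V.pscale (const (dcoeff g h)) (SV_V.pscale (lam l) X)"
    unfolding term2_def X_def xk G_def[symmetric] using cl by (intro usubst_gen_bracket) (auto simp: clin_def)
  have set_js: "set (k # l # ?js) = {..<Suc q}" using kl by (auto simp: set_omit simp del: upt_Suc)
  have X: "lk X m' = sv_scale (of_nat ((lk m' k + lk m' l) choose lk m' k)) (U (lk m' k + lk m' l))"
    if "\<And>i. i \<noteq> k \<Longrightarrow> i \<noteq> l \<Longrightarrow> lk m' i = lk ?m i" for m'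
  proof -
    have "map (lk m') ?js = map (lk ?m) ?js"
      using that by (intro map_cong refl) (auto simp: set_omit simp del: upt_Suc lookup_nth)
    moreover have "Poly_Mapping.keys m' \<subseteq> set (k # l # ?js)"
    proof
      fix i assume i: "i \<in> Poly_Mapping.keys m'"
      show "i \<in> set (k # l # ?js)"
      proof (cases "i = k \<or> i = l")
        case False
        then have "i \<in> Poly_Mapping.keys ?m" using i that[of i] by (simp add: in_keys_iff del: lookup_nth keys_nth)
        then show ?thesis unfolding set_js using keys_nth_subset[of "map snd xs" "Suc q"] xs by auto
      qed auto
    qed
    moreover have "distinct (k # l # ?js)" using kl by (auto simp: set_omit simp del: upt_Suc)
    moreover have "\<forall>m'\<in>Poly_Mapping.keys P. Poly_Mapping.keys m' \<subseteq> {..<Suc (length ?js)}"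
    proof -
      have "vars q P" using f by (simp add: P_def sesq_def)
      moreover have "Suc (length ?js) = q" by (subst len) (rule p[symmetric])
      ultimately show ?thesis by (simp only: vars_def)
    qed
    ultimately show ?thesis
      unfolding X_def G_def P_def[symmetric] U_def by (subst lookup_sb_merge) (simp_all only:)
  qed
  have "sv_scale (fact (lk ?m k) * fact (lk ?m l)) (lk (term2 q k l f ?as) ?m) =
      sv_scale ((of_nat (lk ?m k) * dcoeff h g - of_nat (lk ?m l) * dcoeff g h) * fact (lk ?m k + lk ?m l - 1)) (U (lk ?m k + lk ?m l - 1))"
    unfolding t using kl X by (intro merge_coefficient) auto
  then have 1: "sv_scale (fact m * fact n) (lk (term2 q k l f ?as) ?m) = sv_scale (mode_coeff (xs ! k) (xs ! l) * fact (m + n - 1)) (U (m + n - 1))"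
    unfolding xk by (simp add: gm)
  have a: "map ((!) ?as) ?js = map (sv_of \<circ> fst) (nths xs (- {k, l}))"
    unfolding nths_omit[OF xs] using xs by (auto simp: set_omit simp del: upt_Suc)
  have n: "map (lk ?m) ?js = map snd (nths xs (- {k, l}))"
    unfolding nths_omit[OF xs] using xs by (auto simp: set_omit lk_nth simp del: upt_Suc lookup_nth)
  have pr: "(\<Prod>x\<leftarrow>xs. fact (snd x)) = (\<Prod>x\<leftarrow>nths xs (- {k, l}). fact (snd x)) * (fact m * (fact n :: 'a))"
  proof -
    have "(\<Prod>i<length xs. fact (snd (xs ! i))) = fact (snd (xs ! k)) * (\<Prod>i\<in>{..<length xs} - {k}. fact (snd (xs ! i)) :: 'a)"
      using xs kl by (intro prod.remove) auto
    also have "(\<Prod>i\<in>{..<length xs} - {k}. fact (snd (xs ! i)) :: 'a) = fact (snd (xs ! l)) * (\<Prod>i\<in>{..<length xs} - {k} - {l}. fact (snd (xs ! i)))"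
      using xs kl by (intro prod.remove) auto
    also have "{..<length xs} - {k} - {l} = {..<length xs} - {k, l}" by auto
    finally show ?thesis unfolding prod_list_nths prod_list_nth[of _ xs] by (simp add: gm mult_ac)
  qed
  have "sv_scale (\<Prod>x\<leftarrow>xs. fact (snd x)) (lk (term2 q k l f ?as) ?m) =
      sv_scale (\<Prod>x\<leftarrow>nths xs (- {k, l}). fact (snd x)) (sv_scale (fact m * fact n) (lk (term2 q k l f ?as) ?m))"
    unfolding pr by simp
  also have "\<dots> = sv_scale (mode_coeff (xs ! k) (xs ! l)) (phi f (mode_mul (xs ! k) (xs ! l) # nths xs (- {k, l})))"
    unfolding 1 by (simp add: phi_def U_def P_def a n gm mult_ac del: upt_Suc lookup_nth)
  finally show ?thesis .
qed

lemma pscale_sign: "lk (SV_V.pscale ((-1) ^ k) P) m = sv_scale ((-1) ^ k) (lk P m)"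
proof -
  have "(-1) ^ k = (const ((-1) ^ k) :: 'a lpoly)"
    by (induction k) (simp_all add: mult_single flip: single_uminus single_one)
  then show ?thesis by (simp only: lookup_pscale_C)
qed

lemma ce_length:
  assumes "\<And>xs. length xs \<noteq> q \<Longrightarrow> F xs = 0" "length xs \<noteq> Suc q"
  shows "SVL.ce F xs = 0"
proof -
  have s: "(\<And>xs. length xs \<noteq> q \<Longrightarrow> F xs = 0) \<Longrightarrow> length xs \<noteq> q \<Longrightarrow> SVL.subst_act x F xs = 0"
    for F :: "mode list \<Rightarrow> 'a sv" and xs q and x
  proof (induction xs arbitrary: F q)
    case (Cons y ys)
    have "SVL.subst_act x (SVL.contr y F) ys = 0"
    proof (cases q)
      case 0
      then have "SVL.contr y F = (\<lambda>zs. sv_scale 0 (SVL.contr y F zs))" using Cons.prems(1) by (auto simp: SVL.contr_apply)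
      then have "SVL.subst_act x (SVL.contr y F) ys = sv_scale 0 (SVL.subst_act x (SVL.contr y F) ys)"
        using SVL.subst_act_scale by metis
      then show ?thesis by simp
    next
      case (Suc p)
      show ?thesis by (rule Cons.IH[of p]) (use Cons.prems Suc in \<open>auto simp: SVL.contr_apply\<close>)
    qed
    then show ?case using Cons.prems by simp
  qed simp
  show ?thesis
    using assms
  proof (induction xs arbitrary: F q)
    case (Cons y ys)
    have "SVL.ce (SVL.contr y F) ys = 0"
    proof (cases q)
      case 0
      then have "SVL.contr y F = (\<lambda>zs. sv_scale 0 (SVL.contr y F zs))" using Cons.prems(1) by (auto simp: SVL.contr_apply)
      then have "SVL.ce (SVL.contr y F) ys = sv_scale 0 (SVL.ce (SVL.contr y F) ys)"
        using SVL.ce_scale by metis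
      then show ?thesis by simp
    next
      case (Suc p)
      show ?thesis by (rule Cons.IH[of p]) (use Cons.prems Suc in \<open>auto simp: SVL.contr_apply\<close>)
    qed
    then show ?case using Cons.prems s[of q F ys y] by (simp add: SVL.lie_def)
  qed simp
qed

text \<open>
  The terms of the differential of cochains correspond one by one to those of \<open>ce_sum\<close>, by
  \<open>lookup_term1\<close> and \<open>lookup_term2\<close>.
\<close>

lemma phi_diff:
  assumes f: "f \<in> SV.cochains q"
  shows "phi (SV.diff q f) = SVL.ce (phi f)"
proof
  fix xs
  have fs: "f \<in> sesq q" and a: "SVL.alt (phi f)" using f by (auto simp: cochains_iff)
  show "phi (SV.diff q f) xs = SVL.ce (phi f) xs"
  proof (cases "length xs = Suc q")
    case True
    let ?as = "map (sv_of \<circ> fst) xs :: 'a sv list" and ?m = "Poly_Mapping.nth (map snd xs)" and ?c = "(\<Prod>x\<leftarrow>xs. fact (snd x)) :: 'a"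
    have "phi (SV.diff q f) xs = (\<Sum>k<Suc q. sv_scale ((-1) ^ k) (sv_scale ?c (lk (term1 q k f ?as) ?m))) +
      (\<Sum>l<Suc q. \<Sum>k<l. sv_scale ((-1) ^ (k + l)) (sv_scale ?c (lk (term2 q k l f ?as) ?m)))"
      unfolding phi_def diff_eq using True
      by (simp add: lookup_add lookup_sum pscale_sign SV_V.scale_right_distrib SV_V.scale_sum_right mult.commute
          del: sum.lessThan_Suc)
    also have "\<dots> = SVL.ce (phi f) xs"
      unfolding SVL.ce_sum[OF a] True
      by (intro arg_cong2[of _ _ _ _ "(+)"] sum.cong refl) (simp_all add: lookup_term1[OF fs True] lookup_term2[OF fs True])
    finally show ?thesis .
  next
    case False
    then show ?thesis
      using phi_length[OF diff_sesq[OF fs]] ce_length[of q "phi f"] phi_length[OF fs] by simp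
  qed
qed

lemma diff_cochains: "f \<in> SV.cochains q \<Longrightarrow> SV.diff q f \<in> SV.cochains (Suc q)"
  using phi_diff[of f q] by (simp add: cochains_iff diff_sesq SVL.alt_ce)


section \<open>The derivation in terms of coefficients\<close>

lemma (in lie_basis) subst_act_update:
  "subst_act x F ys = (\<Sum>i<length ys. s (c x (ys ! i)) (F (ys[i := mul x (ys ! i)])))"
  by (induction ys arbitrary: F) (simp_all add: sum.lessThan_Suc_shift contr_apply del: sum.lessThan_Suc)

lemma coeff_L_0: "coeff (sv_bracket (sv_of L_gen) v) 0 = sv_D v"
proof -
  have "v \<in> {v. coeff (sv_bracket (sv_of L_gen) v) 0 = sv_D v}"
    by (rule sv_span)
      (auto simp: sv_bracket_gen sv_gen_bracket_eq SV_B.br_add_right SV_B.br_scale_right coeff_map_poly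
        SV_B.br_D_right SV_V.D_add SV_V.D_scale)
  then show ?thesis by simp
qed

abbreviation "L0 \<equiv> (L_gen, 0) :: mode"
abbreviation "L1 \<equiv> (L_gen, 1) :: mode"

lemma mode_act_L0: "mode_act L0 v = sv_D v"
  by (simp add: coeff_L_0)

text \<open>
  \<open>[L\<^sub>(\<^sub>0\<^sub>), g\<^sub>(\<^sub>n\<^sub>)] = - n g\<^sub>(\<^sub>n\<^sub>-\<^sub>1\<^sub>)\<close>, so the Lie derivative along \<open>L\<^sub>(\<^sub>0\<^sub>)\<close> is \<open>\<partial>\<close> on values plus the sum over the letters of
  \<open>n\<close> times the value with \<open>n\<close> lowered by one; in coefficients of \<open>\<lambda>\<^sup>n/n!\<close>, that is the
  multiplication by \<open>\<lambda>\<close>.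
\<close>

lemma phi_del:
  assumes f: "f \<in> sesq q" and xs: "length xs = q"
  shows "phi (SV.del q f) xs = SVL.lie L0 (phi f) xs"
proof -
  let ?as = "map (sv_of \<circ> fst) xs :: 'a sv list" and ?m = "Poly_Mapping.nth (map snd xs)" and ?c = "(\<Prod>x\<leftarrow>xs. fact (snd x)) :: 'a"
  have sum: "SV_V.pscale (sum h I) P = (\<Sum>i\<in>I. SV_V.pscale (h i) P)" for h :: "nat \<Rightarrow> 'a lpoly" and I P
    by (induction I rule: infinite_finite_induct) (simp_all add: SV_V.pscale_add_left)
  have *: "sv_scale ?c (lk (SV_V.pscale (lam i) (f ?as)) ?m) =
      - sv_scale (mode_coeff L0 (xs ! i)) (phi f (xs[i := mode_mul L0 (xs ! i)]))" if i: "i < q" for i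
  proof -
    obtain g n where gn: "xs ! i = (g, n)" by (cases "xs ! i") auto
    have m: "lk ?m i = n" using i xs gn by (simp add: lk_nth del: lookup_nth)
    show ?thesis
    proof (cases n)
      case 0
      then show ?thesis using gn m by (simp add: lookup_pscale_lam del: lookup_nth)
    next
      case (Suc p)
      have upd: "xs[i := mode_mul L0 (xs ! i)] = xs[i := (g, p)]" using gn Suc by simp
      have as: "map (sv_of \<circ> fst) (xs[i := (g, p)]) = ?as"
        using gn i xs by (intro nth_equalityI) (auto simp: nth_list_update)
      have nth: "?m - sg i 1 = Poly_Mapping.nth (map snd (xs[i := (g, p)]))"
        using gn i xs Suc
        by (intro poly_mapping_eqI) (auto simp: lookup_minus lookup_single nth_default_def nth_list_update when_def)
      have "?c = fact (snd (xs ! i)) * (\<Prod>j\<in>{..<length xs} - {i}. fact (snd (xs ! j)))"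
        unfolding prod_list_nth using i xs by (intro prod.remove) auto
      moreover have "(\<Prod>x\<leftarrow>xs[i := (g, p)]. fact (snd x)) = fact (snd (xs[i := (g, p)] ! i)) * (\<Prod>j\<in>{..<length xs} - {i}. fact (snd (xs[i := (g, p)] ! j)) :: 'a)"
        unfolding prod_list_nth using i xs by (subst prod.remove[of _ i]) auto
      moreover have "(\<Prod>j\<in>{..<length xs} - {i}. fact (snd (xs[i := (g, p)] ! j)) :: 'a) = (\<Prod>j\<in>{..<length xs} - {i}. fact (snd (xs ! j)))"
        by (intro prod.cong) auto
      ultimately have c: "?c = of_nat (Suc p) * (\<Prod>x\<leftarrow>xs[i := (g, p)]. fact (snd x))"
        using gn i xs Suc by (simp del: of_nat_Suc)
      show ?thesis
        using m Suc unfolding lookup_pscale_lam phi_def c nth upd as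
        by (simp add: gn del: lookup_nth of_nat_Suc)
    qed
  qed
  have "phi (SV.del q f) xs = sv_D (phi f xs) + (\<Sum>i<q. sv_scale ?c (lk (SV_V.pscale (lam i) (f ?as)) ?m))"
    by (simp add: phi_def SV.del_def lookup_add SV_V.lookup_mapD sum lookup_sum SV_V.scale_right_distrib
        SV_V.scale_sum_right SV_V.D_scale)
  also have "\<dots> = SVL.lie L0 (phi f) xs"
    unfolding SVL.lie_def SVL.subst_act_update xs mode_act_L0 by (simp add: * sum_negf)
  finally show ?thesis .
qed

section \<open>Cochains with prescribed coefficients\<close>

text \<open>
  The functions that come from cochains. The last condition says that the coefficients at given
  generators form a polynomial.
\<close>

definition K :: "nat \<Rightarrow> (mode list \<Rightarrow> 'f::field_char_0 sv) set" where
  "K q = {F. SVL.alt F \<and> (\<forall>xs. length xs \<noteq> q \<longrightarrow> F xs = 0) \<and> (\<forall>gs. finite {xs. map fst xs = gs \<and> F xs \<noteq> 0})}"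

text \<open>
  The evaluation of a polynomial \<open>p(\<partial>)\<close> at \<open>\<partial> = - \<lambda>\<^sub>i\<close>.
\<close>

definition evm :: "'f::field_char_0 poly \<Rightarrow> nat \<Rightarrow> 'f lpoly" where
  "evm p i = (\<Sum>k\<le>Polynomial.degree p. const (coeff p k) * (- lam i) ^ k)"

lemma evm_expand: "Polynomial.degree p \<le> N \<Longrightarrow> evm p i = (\<Sum>k\<le>N. const (coeff p k) * (- lam i) ^ k)"
  unfolding evm_def by (intro sum.mono_neutral_left) (auto simp: coeff_eq_0)

lemma evm_add: "evm (p + r) i = evm p i + evm r i"
proof -
  let ?N = "max (Polynomial.degree p) (Polynomial.degree r)"
  have "Polynomial.degree (p + r) \<le> ?N" by (rule degree_add_le_max)
  then show ?thesis by (simp add: evm_expand[of _ ?N] single_add distrib_right sum.distrib)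
qed

lemma evm_smult: "evm (Polynomial.smult c p) i = const c * evm p i"
proof -
  have "const (c * d) = const c * (const d :: 'a lpoly)" for d by (simp add: mult_single)
  then show ?thesis
    by (simp add: evm_expand[of _ "Polynomial.degree p"] sum_distrib_left mult.assoc)
qed

lemma evm_pCons: "evm (pCons 0 p) i = - lam i * evm p i"
proof -
  have "evm (pCons 0 p) i = (\<Sum>k\<le>Suc (Polynomial.degree p). const (coeff (pCons 0 p) k) * (- lam i) ^ k)"
    by (intro evm_expand degree_pCons_le)
  also have "\<dots> = (\<Sum>k\<le>Polynomial.degree p. - lam i * (const (coeff p k) * (- lam i) ^ k))"
    by (simp add: sum.atMost_Suc_shift mult_ac del: sum.atMost_Suc)
  finally show ?thesis by (simp only: evm_def sum_distrib_left)
qed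

lemma evm_0: "evm 0 i = 0" and evm_1: "evm 1 i = 1"
  by (simp_all add: evm_def)

lemma vars_evm: "i < n \<Longrightarrow> vars n (evm p i)"
  unfolding evm_def by (intro vars_sum vars_mult vars_power vars_const vars_minus vars_lam)

text \<open>
  The polynomial that the cochain of \<open>F\<close> takes as value at generators.
\<close>

definition gpoly :: "(mode list \<Rightarrow> 'f::field_char_0 sv) \<Rightarrow> sv_gen list \<Rightarrow> 'f sv lpoly" where
  "gpoly F gs = (\<Sum>xs | map fst xs = gs \<and> F xs \<noteq> 0.
     sg (Poly_Mapping.nth (map snd xs)) (sv_scale (1 / (\<Prod>x\<leftarrow>xs. fact (snd x))) (F xs)))"

text \<open>
  The sesquilinear extension of \<open>gpoly F\<close> to all arguments.
\<close>

definition psi :: "nat \<Rightarrow> (mode list \<Rightarrow> 'f::field_char_0 sv) \<Rightarrow> ('f sv, 'f sv) cochain" where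
  "psi q F as = (if length as = q
     then \<Sum>gs | length gs = q. SV_V.pscale (\<Prod>i<q. evm (lk (as ! i) (gs ! i)) i) (gpoly F gs) else 0)"

lemma finite_gens: "finite {gs :: sv_gen list. length gs = q}"
proof -
  have "finite (UNIV :: sv_gen set)" by (simp add: UNIV_sv_gen)
  from finite_lists_length_eq[OF this, of q] show ?thesis by simp
qed

lemma lookup_gpoly:
  assumes "F \<in> K q" "length xs = q"
  shows "lk (gpoly F (map fst xs)) (Poly_Mapping.nth (map snd xs)) = sv_scale (1 / (\<Prod>x\<leftarrow>xs. fact (snd x))) (F xs)"
proof -
  have inj: "ys = xs" if "map fst ys = map fst xs" "Poly_Mapping.nth (map snd ys) = Poly_Mapping.nth (map snd xs)" for ys
  proof -
    have l: "length ys = length xs" using map_eq_imp_length_eq[OF that(1)] .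
    have "map snd ys = map snd xs"
    proof (rule nth_equalityI)
      fix i assume i: "i < length (map snd ys)"
      have "lk (Poly_Mapping.nth (map snd ys)) i = lk (Poly_Mapping.nth (map snd xs)) i" using that(2) by (rule arg_cong)
      then show "map snd ys ! i = map snd xs ! i" using i l by (simp add: nth_default_def)
    qed (simp add: l)
    with that(1) show ?thesis by (metis zip_map_fst_snd)
  qed
  have "lk (gpoly F (map fst xs)) (Poly_Mapping.nth (map snd xs)) =
      (\<Sum>ys | map fst ys = map fst xs \<and> F ys \<noteq> 0. if ys = xs then sv_scale (1 / (\<Prod>x\<leftarrow>ys. fact (snd x))) (F ys) else 0)"
    unfolding gpoly_def lookup_sum using inj by (intro sum.cong) (auto simp: lookup_single when_def)
  then show ?thesis using assms(1) by (auto simp: K_def)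
qed

lemma psi_gen:
  assumes "length gs = q"
  shows "psi q F (map sv_of gs) = gpoly F gs"
proof -
  have "(\<Prod>i<q. evm (lk (map sv_of gs ! i) (hs ! i)) i) = (if hs = gs then 1 else 0)"
    if hs: "length hs = q" for hs
  proof (cases "hs = gs")
    case True
    then show ?thesis using assms by (simp add: sv_of_def evm_1)
  next
    case False
    then obtain i where "i < q" "hs ! i \<noteq> gs ! i" using assms hs nth_equalityI by metis
    then have "\<exists>i\<in>{..<q}. evm (lk (map sv_of gs ! i) (hs ! i)) i = 0"
      using assms by (intro bexI[of _ i]) (auto simp: sv_of_def lookup_single when_def evm_0)
    then have "(\<Prod>i<q. evm (lk (map sv_of gs ! i) (hs ! i)) i) = 0" by (intro prod_zero) auto
    with False show ?thesis by simp
  qed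
  note pr = this
  have "psi q F (map sv_of gs) = (\<Sum>hs | length hs = q. SV_V.pscale (\<Prod>i<q. evm (lk (map sv_of gs ! i) (hs ! i)) i) (gpoly F hs))"
    using assms by (simp add: psi_def del: nth_map)
  also have "\<dots> = (\<Sum>hs | length hs = q. if hs = gs then gpoly F hs else 0)"
    by (rule sum.cong) (simp_all add: pr del: nth_map)
  finally show ?thesis using assms finite_gens by simp
qed

lemma phi_psi:
  assumes "F \<in> K q"
  shows "phi (psi q F) = F"
proof
  fix xs
  show "phi (psi q F) xs = F xs"
  proof (cases "length xs = q")
    case True
    then have "psi q F (map (sv_of \<circ> fst) xs) = gpoly F (map fst xs)"
      using psi_gen[of "map fst xs" q F] by simp
    then show ?thesis
      using prod_list_fact_nonzero[of xs, where 'f = 'a] by (simp add: phi_def lookup_gpoly[OF assms True])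
  next
    case False
    then show ?thesis using assms by (simp add: phi_def psi_def K_def)
  qed
qed

lemma psi_sesq: "psi q F \<in> sesq q"
proof -
  have "vars q (gpoly F gs)" if "length gs = q" for gs
    unfolding gpoly_def using that keys_nth_subset by (intro vars_sum vars_single) fastforce
  then have "vars q (psi q F as)" for as
    unfolding psi_def by (auto intro!: vars_0 vars_sum vars_pscale vars_prod vars_evm)
  moreover have "sesqui q i (lam i) (psi q F)" if i: "i < q" for i
    unfolding sesqui_def
  proof (intro allI impI)
    fix as :: "'a sv list" assume as: "length as = q"
    define R where "R gs = (\<Prod>j\<in>{..<q} - {i}. evm (lk (as ! j) (gs ! j)) j)" for gs
    have p: "psi q F (as[i := a]) = (\<Sum>gs | length gs = q. SV_V.pscale (evm (lk a (gs ! i)) i) (SV_V.pscale (R gs) (gpoly F gs)))" for a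
    proof -
      have "(\<Prod>j<q. evm (lk (as[i := a] ! j) (gs ! j)) j) = evm (lk a (gs ! i)) i * R gs" for gs
        unfolding R_def using i as by (subst prod.remove[of _ i]) (auto intro!: prod.cong)
      then show ?thesis using as by (simp add: psi_def SV_V.pscale_mult)
    qed
    have l: "lk (sv_scale k a) g = Polynomial.smult k (lk a g)" "lk (sv_D a) g = pCons 0 (lk a g)" for k g and a :: "'a sv"
      by (simp_all add: sv_scale_def sv_D_def lookup_sv_mult)
    show "(\<forall>a b. psi q F (as[i := a + b]) = psi q F (as[i := a]) + psi q F (as[i := b])) \<and>
      (\<forall>c a. psi q F (as[i := sv_scale c a]) = SV_V.pscale (const c) (psi q F (as[i := a]))) \<and>
      (\<forall>a. psi q F (as[i := sv_D a]) = - SV_V.pscale (lam i) (psi q F (as[i := a])))"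
      unfolding p l lookup_add evm_add evm_smult evm_pCons
      by (simp add: SV_V.pscale_add_left sum.distrib SV_V.pscale_sum_right SV_V.pscale_mult SV_V.pscale_minus_left sum_negf)
  qed
  ultimately show ?thesis by (simp add: sesq_def psi_def)
qed

lemma psi_cochains: "F \<in> K q \<Longrightarrow> psi q F \<in> SV.cochains q"
  by (simp add: cochains_iff psi_sesq phi_psi) (simp add: K_def)

lemma phi_K:
  assumes "f \<in> SV.cochains q"
  shows "phi f \<in> K q"
proof -
  have f: "f \<in> sesq q" using assms by (simp add: cochains_iff)
  have "finite {xs. map fst xs = gs \<and> phi f xs \<noteq> 0}" for gs
  proof (rule finite_subset)
    show "{xs. map fst xs = gs \<and> phi f xs \<noteq> 0} \<subseteq> (\<lambda>m. zip gs (map (lk m) [0..<q])) ` Poly_Mapping.keys (f (map sv_of gs))"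
    proof
      fix xs assume "xs \<in> {xs. map fst xs = gs \<and> phi f xs \<noteq> 0}"
      then have xs: "map fst xs = gs" "phi f xs \<noteq> 0" by auto
      then have l: "length xs = q" using phi_length[OF f] by blast
      have "map (lk (Poly_Mapping.nth (map snd xs))) [0..<q] = map snd xs"
        using l by (intro nth_equalityI) (simp_all add: nth_default_def)
      then have "xs = zip gs (map (lk (Poly_Mapping.nth (map snd xs))) [0..<q])"
        using xs(1) by (metis zip_map_fst_snd)
      moreover have "Poly_Mapping.nth (map snd xs) \<in> Poly_Mapping.keys (f (map sv_of gs))"
        using xs by (auto simp: phi_def in_keys_iff simp flip: map_map)
      ultimately show "xs \<in> (\<lambda>m. zip gs (map (lk m) [0..<q])) ` Poly_Mapping.keys (f (map sv_of gs))" by blast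
    qed
  qed simp
  then show ?thesis using assms phi_length[OF f] by (simp add: K_def cochains_iff)
qed


section \<open>Weights\<close>

definition coef :: "'f::field_char_0 sv \<Rightarrow> sv_gen \<Rightarrow> nat \<Rightarrow> 'f" where
  "coef v g p = coeff (lk v g) p"

lemma coef_eqI: "(\<And>g p. coef v g p = coef w g p) \<Longrightarrow> v = w"
  by (intro poly_mapping_eqI poly_eqI) (simp add: coef_def)

lemma coef_simps:
  "coef 0 g p = 0" "coef (v + w) g p = coef v g p + coef w g p" "coef (v - w) g p = coef v g p - coef w g p"
  "coef (- v) g p = - coef v g p" "coef (sv_scale c v) g p = c * coef v g p"
  "coef (sv_D v) g p = (case p of 0 \<Rightarrow> 0 | Suc n \<Rightarrow> coef v g n)"
  "coef (sv_of h) g p = (if h = g \<and> p = 0 then 1 else 0)"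
  by (simp_all add: coef_def lookup_add lookup_minus sv_scale_def sv_D_def lookup_sv_mult coeff_pCons
      sv_of_def lookup_single when_def split: nat.split)

definition coef_map :: "(sv_gen \<Rightarrow> nat \<Rightarrow> 'f) \<Rightarrow> 'f::field_char_0 sv \<Rightarrow> 'f sv" where
  "coef_map h v = (\<Sum>g\<in>UNIV. sg g (Poly (map (\<lambda>p. h g p * coef v g p) [0..<Suc (Polynomial.degree (lk v g))])))"

lemma coef_coef_map: "coef (coef_map h v) g p = h g p * coef v g p"
proof -
  have "finite (UNIV :: sv_gen set)" by (simp add: UNIV_sv_gen)
  then have "lk (coef_map h v) g = Poly (map (\<lambda>p. h g p * coef v g p) [0..<Suc (Polynomial.degree (lk v g))])"
    by (simp add: coef_map_def lookup_sum lookup_single when_def del: upt_Suc)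
  then have "coef (coef_map h v) g p = nth_default 0 (map (\<lambda>p. h g p * coef v g p) [0..<Suc (Polynomial.degree (lk v g))]) p"
    by (simp add: coef_def del: upt_Suc)
  also have "\<dots> = h g p * coef v g p"
    by (auto simp: nth_default_def coef_def coeff_eq_0 simp del: upt_Suc)
  finally show ?thesis .
qed

text \<open>
  All weights are doubled in order to be integers.
\<close>

fun mode_wt :: "mode \<Rightarrow> int" where
  "mode_wt (L_gen, n) = 2 * int n - 2"
| "mode_wt (M_gen, n) = 2 * int n"
| "mode_wt (Y_gen, n) = 2 * int n - 1"

fun coef_wt :: "sv_gen \<Rightarrow> nat \<Rightarrow> int" where
  "coef_wt L_gen p = 2 * int p + 4"
| "coef_wt M_gen p = 2 * int p + 2"
| "coef_wt Y_gen p = 2 * int p + 3"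

definition wt :: "mode list \<Rightarrow> int" where "wt xs = (\<Sum>x\<leftarrow>xs. mode_wt x)"

lemma coef_act_L1: "coef (mode_act L1 v) g p = of_int (coef_wt g p) / 2 * coef v g p"
proof -
  let ?A = "\<lambda>v. coeff (sv_bracket (sv_of L_gen) v) 1"
  have w: "coef_wt g (Suc n) = coef_wt g n + 2" for g n by (cases g) simp_all
  \<comment> \<open>\<open>\<partial>\<close> raises weights by one\<close>
  have AD: "?A (sv_D v) = sv_D (?A v) + sv_D v" for v :: "'a sv"
    using coeff_L_0[of v] by (simp add: SV_B.br_D_right coeff_map_poly)
  have gen: "coef (?A (sv_of h)) g p = of_int (coef_wt g p) / 2 * coef (sv_of h :: 'a sv) g p" for h g p
    unfolding sv_bracket_gen sv_gen_bracket_eq by (cases h) (simp_all add: coef_simps)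
  have "v \<in> {v. \<forall>g p. coef (?A v) g p = of_int (coef_wt g p) / 2 * coef v g p}"
  proof (rule sv_span)
    show "range sv_of \<subseteq> {v :: 'a sv. \<forall>g p. coef (?A v) g p = of_int (coef_wt g p) / 2 * coef v g p}"
      using gen by blast
  next
    fix v :: "'a sv" assume v: "v \<in> {v. \<forall>g p. coef (?A v) g p = of_int (coef_wt g p) / 2 * coef v g p}"
    then show "sv_D v \<in> {v. \<forall>g p. coef (?A v) g p = of_int (coef_wt g p) / 2 * coef v g p}"
      unfolding mem_Collect_eq AD by (auto simp: coef_simps w field_simps split: nat.split)
  qed (auto simp: SV_B.br_add_right SV_B.br_scale_right coeff_map_poly coef_simps field_simps)
  then show ?thesis by simp
qed

text \<open>
  \<open>[L\<^sub>(\<^sub>1\<^sub>), g\<^sub>(\<^sub>n\<^sub>)]\<close> is a multiple of \<open>g\<^sub>(\<^sub>n\<^sub>)\<close>, and \<open>L\<^sub>(\<^sub>1\<^sub>)\<close> acts on \<open>\<partial>\<^sup>p g\<close> by its conformal weight.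
\<close>

lemma lie_L1: "coef (SVL.lie L1 F xs) g p = of_int (wt xs + coef_wt g p) / 2 * coef (F xs) g p"
proof -
  have m: "mode_mul L1 x = x" for x by (cases x) simp
  have c: "mode_coeff L1 x = - (of_int (mode_wt x) / 2 :: 'a)" for x :: mode
  proof -
    obtain h n where "x = (h, n)" by (cases x)
    then show ?thesis by (cases h) (simp_all add: field_simps)
  qed
  have s: "SVL.subst_act L1 F xs = sv_scale (- (of_int (wt xs) / 2)) (F xs)" for F :: "mode list \<Rightarrow> 'a sv"
    by (induction xs arbitrary: F)
      (simp_all add: wt_def m c SVL.contr_apply add_divide_distrib SV_V.scale_left_diff_distrib
        del: One_nat_def mode_mul.simps)
  show ?thesis
    unfolding SVL.lie_def coef_simps coef_act_L1 s by (simp add: field_simps)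
qed

definition weight0 :: "(mode list \<Rightarrow> 'f::field_char_0 sv) \<Rightarrow> bool" where
  "weight0 F \<longleftrightarrow> SVL.lie L1 F = 0"

lemma weight0_iff: "weight0 F \<longleftrightarrow> (\<forall>xs g p. coef (F xs) g p \<noteq> 0 \<longrightarrow> wt xs + coef_wt g p = 0)"
proof -
  have "v = 0 \<longleftrightarrow> (\<forall>g p. coef v g p = 0)" for v :: "'a sv"
    using coef_eqI[of v 0] by (auto simp: coef_simps)
  then have "weight0 F \<longleftrightarrow> (\<forall>xs g p. coef (SVL.lie L1 F xs) g p = 0)"
    by (simp add: weight0_def fun_eq_iff)
  also have "\<dots> \<longleftrightarrow> (\<forall>xs g p. coef (F xs) g p \<noteq> 0 \<longrightarrow> wt xs + coef_wt g p = 0)"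
    unfolding lie_L1 mult_eq_0_iff divide_eq_0_iff of_int_eq_0_iff by auto
  finally show ?thesis .
qed

text \<open>
  A function of the Lie derivative along \<open>L\<^sub>(\<^sub>1\<^sub>)\<close>, in the sense of functional calculus.
\<close>

definition wscale :: "(int \<Rightarrow> 'f) \<Rightarrow> (mode list \<Rightarrow> 'f::field_char_0 sv) \<Rightarrow> mode list \<Rightarrow> 'f sv" where
  "wscale \<phi> F xs = coef_map (\<lambda>g p. \<phi> (wt xs + coef_wt g p)) (F xs)"

lemma coef_wscale: "coef (wscale \<phi> F xs) g p = \<phi> (wt xs + coef_wt g p) * coef (F xs) g p"
  by (simp add: wscale_def coef_coef_map)

abbreviation proj0 :: "(mode list \<Rightarrow> 'f::field_char_0 sv) \<Rightarrow> mode list \<Rightarrow> 'f sv" where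
  "proj0 \<equiv> wscale (\<lambda>t. if t = 0 then 1 else 0)"

abbreviation winv :: "(mode list \<Rightarrow> 'f::field_char_0 sv) \<Rightarrow> mode list \<Rightarrow> 'f sv" where
  "winv \<equiv> wscale (\<lambda>t. if t = 0 then 0 else 2 / of_int t)"

lemma wscale_K:
  assumes "F \<in> K q"
  shows "wscale \<phi> F \<in> K q"
proof -
  have z: "wscale \<phi> F xs = 0" if "F xs = 0" for xs
    using that by (intro coef_eqI) (simp add: coef_wscale coef_simps)
  have "SVL.alt (wscale \<phi> F)"
    unfolding SVL.alt_def
  proof (intro allI)
    fix us x y vs
    have "F (us @ x # y # vs) = - F (us @ y # x # vs)"
      using assms by (intro SVL.alt_swap) (simp add: K_def)
    then show "wscale \<phi> F (us @ x # y # vs) = - wscale \<phi> F (us @ y # x # vs)"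
      by (intro coef_eqI) (simp add: coef_wscale coef_simps wt_def algebra_simps)
  qed
  moreover have "finite {xs. map fst xs = gs \<and> wscale \<phi> F xs \<noteq> 0}" for gs
  proof (rule finite_subset)
    show "{xs. map fst xs = gs \<and> wscale \<phi> F xs \<noteq> 0} \<subseteq> {xs. map fst xs = gs \<and> F xs \<noteq> 0}" using z by auto
    show "finite {xs. map fst xs = gs \<and> F xs \<noteq> 0}" using assms by (simp add: K_def)
  qed
  ultimately show ?thesis using assms z by (simp add: K_def)
qed

lemma contr_K:
  assumes "F \<in> K (Suc q)"
  shows "SVL.contr x F \<in> K q"
proof -
  have "finite {ys. map fst ys = gs \<and> SVL.contr x F ys \<noteq> 0}" for gs
  proof (rule finite_subset)
    show "{ys. map fst ys = gs \<and> SVL.contr x F ys \<noteq> 0} \<subseteq> tl ` {xs. map fst xs = fst x # gs \<and> F xs \<noteq> 0}"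
    proof
      fix ys assume "ys \<in> {ys. map fst ys = gs \<and> SVL.contr x F ys \<noteq> 0}"
      then have "x # ys \<in> {xs. map fst xs = fst x # gs \<and> F xs \<noteq> 0}" by (simp add: SVL.contr_apply)
      then show "ys \<in> tl ` {xs. map fst xs = fst x # gs \<and> F xs \<noteq> 0}" by force
    qed
    show "finite (tl ` {xs. map fst xs = fst x # gs \<and> F xs \<noteq> 0})" using assms by (simp add: K_def)
  qed
  then show ?thesis using assms by (simp add: K_def SVL.alt_contr SVL.contr_apply)
qed

lemma ce_K:
  assumes "F \<in> K q"
  shows "SVL.ce F \<in> K (Suc q)"
  using phi_K[OF diff_cochains[OF psi_cochains[OF assms]]]
  unfolding phi_diff[OF psi_cochains[OF assms]] phi_psi[OF assms] .

abbreviation smul :: "'f::field_char_0 \<Rightarrow> (mode list \<Rightarrow> 'f sv) \<Rightarrow> mode list \<Rightarrow> 'f sv" where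
  "smul k F \<equiv> \<lambda>xs. sv_scale k (F xs)"

interpretation SM: scaled_space "smul :: 'f::field_char_0 \<Rightarrow> (mode list \<Rightarrow> 'f sv) \<Rightarrow> _"
  by unfold_locales (auto simp: SV_V.scale_right_distrib SV_V.scale_left_distrib fun_eq_iff)

lemma alt_linear:
  assumes "SVL.alt F"
  shows "SVL.alt G \<Longrightarrow> SVL.alt (F + G)" "SVL.alt (smul k F)"
proof -
  note F = SVL.alt_swap[OF assms]
  show "SVL.alt (F + G)" if "SVL.alt G"
    unfolding SVL.alt_def
  proof (intro allI)
    fix us x y vs
    show "(F + G) (us @ x # y # vs) = - (F + G) (us @ y # x # vs)"
      using F[of us x y vs] SVL.alt_swap[OF that, of us x y vs] by simp
  qed
  show "SVL.alt (smul k F)"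
    unfolding SVL.alt_def
  proof (intro allI)
    fix us x y vs
    show "smul k F (us @ x # y # vs) = - smul k F (us @ y # x # vs)"
      using F[of us x y vs] by simp
  qed
qed

lemma K_subspace: "SM.subspace (K q)"
proof (rule SM.subspaceI)
  show "0 \<in> K q" by (simp add: K_def SVL.alt_def)
  fix F G :: "mode list \<Rightarrow> 'a sv" assume FG: "F \<in> K q" "G \<in> K q"
  have "finite {xs. map fst xs = gs \<and> (F + G) xs \<noteq> 0}" for gs
  proof (rule finite_subset)
    show "{xs. map fst xs = gs \<and> (F + G) xs \<noteq> 0} \<subseteq> {xs. map fst xs = gs \<and> F xs \<noteq> 0} \<union> {xs. map fst xs = gs \<and> G xs \<noteq> 0}"
      by auto
    show "finite ({xs. map fst xs = gs \<and> F xs \<noteq> 0} \<union> {xs. map fst xs = gs \<and> G xs \<noteq> 0})" using FG by (simp add: K_def)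
  qed
  then show "F + G \<in> K q" using FG by (simp add: K_def alt_linear)
next
  fix k and F :: "mode list \<Rightarrow> 'a sv" assume F: "F \<in> K q"
  have "finite {xs. map fst xs = gs \<and> smul k F xs \<noteq> 0}" for gs
  proof (rule finite_subset)
    show "{xs. map fst xs = gs \<and> smul k F xs \<noteq> 0} \<subseteq> {xs. map fst xs = gs \<and> F xs \<noteq> 0}" by auto
    show "finite {xs. map fst xs = gs \<and> F xs \<noteq> 0}" using F by (simp add: K_def)
  qed
  then show "smul k F \<in> K q" using F by (simp add: K_def alt_linear(2))
qed

lemma ce_linear:
  fixes F G :: "mode list \<Rightarrow> 'a::field_char_0 sv"
  shows "SVL.ce (F + G) = SVL.ce F + SVL.ce G" "SVL.ce (F - G) = SVL.ce F - SVL.ce G"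
    "SVL.ce (smul k F) = smul k (SVL.ce F)" "SVL.ce (0 :: mode list \<Rightarrow> 'a sv) = 0"
proof -
  have d: "SVL.ce (F - G) = SVL.ce F - SVL.ce G" for F G :: "mode list \<Rightarrow> 'a sv"
    by (auto simp: SVL.ce_diff)
  show "SVL.ce (F + G) = SVL.ce F + SVL.ce G" "SVL.ce (smul k F) = smul k (SVL.ce F)"
    by (auto simp: SVL.ce_add SVL.ce_scale)
  show "SVL.ce (F - G) = SVL.ce F - SVL.ce G" by (rule d)
  show "SVL.ce (0 :: mode list \<Rightarrow> 'a sv) = 0" using d[of 0 0] by simp
qed

lemma lie_0: "SVL.lie x (0 :: mode list \<Rightarrow> 'a::field_char_0 sv) = 0"
  using SVL.lie_linear(2)[of x 0 "0 :: mode list \<Rightarrow> 'a sv"] by simp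

lemma lie_sum: "SVL.lie x (\<Sum>i\<in>I. smul (u i) (e i)) = (\<Sum>i\<in>I. smul (u i) (SVL.lie x (e i)))"
proof (induction I rule: infinite_finite_induct)
  case (insert x F)
  show ?case unfolding sum.insert[OF insert(1,2)] SVL.lie_linear insert(3) ..
qed (simp_all only: sum.infinite sum.empty lie_0 not_False_eq_True)

lemma lie_ce: "SVL.lie x (SVL.ce F) = SVL.ce (SVL.lie x F)"
  by (rule ext) (rule SVL.lie_ce)

lemma ce_ce: "SVL.ce (SVL.ce F) = 0"
  by (rule ext) (simp add: SVL.ce_ce)

lemma weight0_ce: "weight0 F \<Longrightarrow> weight0 (SVL.ce F)"
  by (simp add: weight0_def lie_ce ce_linear)

lemma weight0_proj0: "weight0 (proj0 F)"
  unfolding weight0_iff by (auto simp: coef_wscale split: if_splits)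

lemma proj0_weight0: "weight0 F \<Longrightarrow> proj0 F = F"
  by (intro ext coef_eqI) (auto simp: coef_wscale weight0_iff)

lemma proj0_add: "proj0 (F + G) = proj0 F + proj0 G" "proj0 0 = 0"
  by (intro ext coef_eqI; simp add: coef_wscale coef_simps)+

lemma proj0_lie_L1: "proj0 (SVL.lie L1 F) = 0"
  by (intro ext coef_eqI) (auto simp: coef_wscale lie_L1 coef_simps simp del: One_nat_def of_int_add)

lemma proj0_decompose: "F = proj0 F + SVL.lie L1 (winv F)"
  by (intro ext coef_eqI) (auto simp: coef_wscale lie_L1 coef_simps simp del: One_nat_def of_int_add)

lemma ce_decompose: "SVL.ce F = SVL.ce (proj0 F) + SVL.lie L1 (SVL.ce (winv F))"
  unfolding lie_ce ce_linear(1)[symmetric] proj0_decompose[symmetric] ..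

lemma proj0_ce: "proj0 (SVL.ce F) = SVL.ce (proj0 F)"
proof -
  have "proj0 (SVL.ce F) = proj0 (SVL.ce (proj0 F) + SVL.lie L1 (SVL.ce (winv F)))"
    by (rule arg_cong[OF ce_decompose])
  also have "\<dots> = proj0 (SVL.ce (proj0 F)) + 0" unfolding proj0_add(1) proj0_lie_L1 ..
  also have "proj0 (SVL.ce (proj0 F)) = SVL.ce (proj0 F)"
    by (rule proj0_weight0[OF weight0_ce[OF weight0_proj0]])
  finally show ?thesis by (simp only: add_0_right)
qed

text \<open>
  The differential commutes with the Lie derivative along \<open>L\<^sub>(\<^sub>1\<^sub>)\<close> and hence with the decomposition into
  its kernel and image; on the image \<open>winv\<close> is its inverse.
\<close>

lemma ce_winv:
  assumes "SVL.ce F = 0"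
  shows "SVL.ce (winv F) = 0"
proof -
  let ?G = "SVL.ce (winv F)"
  have 0: "proj0 (winv F) = 0" by (intro ext coef_eqI) (simp add: coef_wscale coef_simps)
  have "SVL.ce (proj0 F) = 0" unfolding proj0_ce[symmetric] assms by (rule proj0_add(2))
  with ce_decompose[of F] have "SVL.lie L1 ?G = 0" unfolding assms by (simp only: add_0_left)
  then have "proj0 ?G = ?G" by (intro proj0_weight0) (simp only: weight0_def)
  moreover have "proj0 ?G = 0" unfolding proj0_ce 0 by (rule ce_linear(4))
  ultimately show ?thesis by (simp only:)
qed

definition Zm :: "nat \<Rightarrow> (mode list \<Rightarrow> 'f::field_char_0 sv) set" where
  "Zm q = {F \<in> K q. SVL.ce F = 0}"

definition Bm :: "nat \<Rightarrow> (mode list \<Rightarrow> 'f::field_char_0 sv) set" where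
  "Bm q = (case q of 0 \<Rightarrow> {0} | Suc p \<Rightarrow> SVL.ce ` K p)"

lemma cartan: "SVL.ce (SVL.contr x F) + SVL.contr x (SVL.ce F) = SVL.lie x F"
  by (rule ext) (simp add: SVL.cartan[symmetric])

lemma K_0_weight0:
  assumes "F \<in> K 0" "weight0 F"
  shows "F = 0"
proof (intro ext coef_eqI)
  fix xs g p
  have "wt [] + coef_wt g p \<noteq> 0" by (cases g) (simp_all add: wt_def)
  then show "coef (F xs) g p = coef (0 xs) g p"
    using assms by (cases "xs = []") (auto simp: coef_simps weight0_iff K_def)
qed

lemma contr_K_0:
  assumes "F \<in> K 0"
  shows "SVL.contr x F = 0"
  using assms by (auto simp: K_def SVL.contr_def fun_eq_iff)

text \<open>
  The difference is \<open>\<L> (winv F)\<close> for the Lie derivative \<open>\<L> = d \<iota> + \<iota> d\<close> along \<open>L\<^sub>(\<^sub>1\<^sub>)\<close>, where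
  \<open>d (winv F) = 0\<close>.
\<close>

lemma cocycle_homologous_weight0:
  assumes F: "F \<in> Zm q"
  shows "F - proj0 F \<in> Bm q"
proof -
  have FK: "F \<in> K q" "SVL.ce F = 0" using F by (auto simp: Zm_def)
  have "SVL.lie L1 (winv F) + proj0 F = F"
    by (subst add.commute) (rule proj0_decompose[symmetric])
  then have "F - proj0 F = SVL.lie L1 (winv F)" by (rule add_implies_diff[symmetric])
  also have "\<dots> = SVL.ce (SVL.contr L1 (winv F))"
  proof -
    have "SVL.contr L1 (0 :: mode list \<Rightarrow> 'a sv) = 0" by (simp add: SVL.contr_def zero_fun_def)
    with cartan[of L1 "winv F"] show ?thesis unfolding ce_winv[OF FK(2)] by (simp only: add_0_right)
  qed
  finally have *: "F - proj0 F = SVL.ce (SVL.contr L1 (winv F))" .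
  show ?thesis
  proof (cases q)
    case 0
    then show ?thesis unfolding * using contr_K_0[of "winv F" L1] wscale_K[OF FK(1)] by (simp add: Bm_def ce_linear)
  next
    case (Suc p)
    then have "SVL.contr L1 (winv F) \<in> K p" by (intro contr_K wscale_K) (use FK in simp)
    then show ?thesis unfolding * Bm_def Suc nat.case by (rule imageI)
  qed
qed

lemma basis_mod_weight0:
  fixes e :: "nat \<Rightarrow> mode list \<Rightarrow> 'a::field_char_0 sv"
  assumes e: "\<And>i. i < n \<Longrightarrow> e i \<in> Zm q" "\<And>i. i < n \<Longrightarrow> weight0 (e i)"
    and span: "\<And>F. F \<in> Zm q \<Longrightarrow> weight0 F \<Longrightarrow> \<exists>u. F - (\<Sum>i<n. smul (u i) (e i)) \<in> Bm q"
    and indep: "\<And>u G. (\<Sum>i<n. smul (u i) (e i)) = SVL.ce G \<Longrightarrow> q \<noteq> 0 \<Longrightarrow> G \<in> K (q - 1) \<Longrightarrow> weight0 G \<Longrightarrow> \<forall>i<n. u i = 0"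
    and q0: "q = 0 \<Longrightarrow> n = 0"
  shows "SM.basis_mod (Zm q) (Bm q) n e"
proof -
  have Bsub: "SM.subspace (Bm q :: (mode list \<Rightarrow> 'a sv) set)"
  proof (cases q)
    case (Suc p)
    have "SM.subspace (SVL.ce ` (K p :: (mode list \<Rightarrow> 'a sv) set))"
    proof (rule SM.subspaceI)
      show "0 \<in> SVL.ce ` (K p :: (mode list \<Rightarrow> 'a sv) set)"
        using SM.subspace_0[OF K_subspace, of p] ce_linear(4) by (metis image_eqI)
      fix F G :: "mode list \<Rightarrow> 'a sv" assume "F \<in> SVL.ce ` K p" "G \<in> SVL.ce ` K p"
      then obtain F' G' where FG: "F' \<in> K p" "G' \<in> K p" "F = SVL.ce F'" "G = SVL.ce G'" by blast
      show "F + G \<in> SVL.ce ` K p"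
        unfolding FG(3,4) ce_linear(1)[symmetric] by (rule imageI[OF SM.subspace_add[OF K_subspace FG(1,2)]])
    next
      fix k and F :: "mode list \<Rightarrow> 'a sv" assume "F \<in> SVL.ce ` K p"
      then obtain F' where F': "F' \<in> K p" "F = SVL.ce F'" by blast
      show "smul k F \<in> SVL.ce ` K p"
        unfolding F'(2) ce_linear(3)[symmetric] by (rule imageI[OF SM.subspace_scale[OF K_subspace F'(1)]])
    qed
    then show ?thesis using Suc by (simp add: Bm_def)
  qed (simp add: Bm_def)
  show ?thesis
    unfolding SM.basis_mod_def
  proof (intro conjI ballI allI impI)
    fix F :: "mode list \<Rightarrow> 'a sv" assume F: "F \<in> Zm q"
    have "proj0 F \<in> Zm q"
      using F wscale_K proj0_ce[of F] by (auto simp: Zm_def proj0_add)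
    then obtain u where u: "proj0 F - (\<Sum>i<n. smul (u i) (e i)) \<in> Bm q" using span[OF _ weight0_proj0] by blast
    have "F - (\<Sum>i<n. smul (u i) (e i)) = (F - proj0 F) + (proj0 F - (\<Sum>i<n. smul (u i) (e i)))" by simp
    then show "\<exists>u. F - (\<Sum>i<n. smul (u i) (e i)) \<in> Bm q"
      using SM.subspace_add[OF Bsub cocycle_homologous_weight0[OF F] u] by (intro exI[of _ u]) (simp only:)
  next
    fix u i
    assume B: "(\<Sum>i<n. smul (u i) (e i)) \<in> Bm q" and i: "i < n"
    then obtain p where p: "q = Suc p" using q0 by (cases q) auto
    then obtain G where G: "G \<in> K p" "(\<Sum>i<n. smul (u i) (e i)) = SVL.ce G" using B by (auto simp: Bm_def)
    have "weight0 (\<Sum>i<n. smul (u i) (e i))"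
      unfolding weight0_def lie_sum using e(2) by (intro sum.neutral) (auto simp: weight0_def)
    then have "proj0 (\<Sum>i<n. smul (u i) (e i)) = (\<Sum>i<n. smul (u i) (e i))" by (rule proj0_weight0)
    then have "(\<Sum>i<n. smul (u i) (e i)) = SVL.ce (proj0 G)" unfolding G(2) proj0_ce by (rule sym)
    then show "u i = 0" using indep[of u "proj0 G"] p G(1) i by (simp add: wscale_K weight0_proj0)
  qed (rule e(1))
qed


section \<open>The part of weight zero\<close>

abbreviation "M0 \<equiv> (M_gen, 0) :: mode"
abbreviation "Y0 \<equiv> (Y_gen, 0) :: mode"
abbreviation "Y1 \<equiv> (Y_gen, 1) :: mode"

text \<open>
  Each word comes with the generator that spans the values there of functions of weight zero.
\<close>

definition words :: "(mode list \<times> sv_gen) list" where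
  "words = [([L0], M_gen), ([L0, L1], M_gen), ([L0, M0], M_gen), ([L0, Y0], Y_gen),
     ([L0, L1, M0], M_gen), ([L0, Y0, Y1], M_gen), ([L0, L1, Y0], Y_gen), ([L0, M0, Y0], Y_gen),
     ([L0, L1, Y0, Y1], M_gen), ([L0, M0, Y0, Y1], M_gen), ([L0, L1, M0, Y0], Y_gen), ([L0, L1, M0, Y0, Y1], M_gen)]"

lemma mode_wt_cases:
  obtains "x = L0" | "x = Y0" | "x = L1" | "x = M0" | "x = Y1" | "mode_wt x \<ge> 2"
proof -
  obtain g n where x: "x = (g, n)" by (cases x)
  have "g = L_gen \<or> g = M_gen \<or> g = Y_gen" by (cases g) auto
  moreover have "n = 0 \<or> n = 1 \<or> n \<ge> 2" by linarith
  ultimately show ?thesis using that x by (elim disjE) auto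
qed

text \<open>
  The letters \<open>L\<^sub>(\<^sub>0\<^sub>)\<close> and \<open>Y\<^sub>(\<^sub>0\<^sub>)\<close> contribute at least -3 to the doubled weight. A total of at most -2 leaves
  at most 1 for all other letters, so \<open>Y\<^sub>(\<^sub>1\<^sub>)\<close> is the only one of positive weight that can occur, and only together with
  \<open>Y\<^sub>(\<^sub>0\<^sub>)\<close>.
\<close>

lemma distinct_wt:
  assumes "distinct xs" "wt xs \<le> -2"
  shows "set xs \<in> {set w |w g. (w, g) \<in> set words}"
proof -
  define S where "S = set xs"
  have fin: "finite S" by (simp add: S_def)
  have wt: "wt xs = sum mode_wt S"
    unfolding wt_def S_def using assms(1) by (simp add: sum_list_distinct_conv_sum_set)
  define N where "N = S \<inter> {L0, Y0}"
  have SN: "sum mode_wt S = sum mode_wt N + sum mode_wt (S - {L0, Y0})"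
    using sum.Int_Diff[OF fin, of mode_wt "{L0, Y0}"] by (simp add: N_def)
  have nonneg: "mode_wt x \<ge> 0" if "x \<notin> {L0, Y0}" for x
    using that by (cases x rule: mode_wt_cases) auto
  have N: "sum mode_wt N = (if L0 \<in> S then -2 else 0) + (if Y0 \<in> S then -1 else 0)"
  proof -
    have "N = (if L0 \<in> S then {L0} else {}) \<union> (if Y0 \<in> S then {Y0} else {})" by (auto simp: N_def)
    then show ?thesis by simp
  qed
  then have N3: "-3 \<le> sum mode_wt N" by simp
  have ge: "mode_wt x \<le> sum mode_wt (S - {L0, Y0})" if "x \<in> S - {L0, Y0}" for x
    using that fin nonneg by (intro member_le_sum) auto
  have ge0: "0 \<le> sum mode_wt (S - {L0, Y0})" using nonneg by (intro sum_nonneg) auto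
  have sub: "S \<subseteq> {L0, L1, M0, Y0, Y1}"
  proof
    fix x assume x: "x \<in> S"
    show "x \<in> {L0, L1, M0, Y0, Y1}"
    proof (cases x rule: mode_wt_cases)
      case 6
      then have "x \<in> S - {L0, Y0}" using x by auto
      from ge[OF this] 6 N3 SN wt assms(2) show ?thesis by linarith
    qed simp_all
  qed
  have L: "L0 \<in> S"
  proof (rule ccontr)
    assume "L0 \<notin> S"
    then have "-1 \<le> sum mode_wt N" using N by simp
    with SN wt assms(2) ge0 show False by linarith
  qed
  have Y: "Y0 \<in> S" if "Y1 \<in> S"
  proof (rule ccontr)
    assume "Y0 \<notin> S"
    then have "-2 \<le> sum mode_wt N" using N by simp
    moreover have "1 \<le> sum mode_wt (S - {L0, Y0})" using ge[of Y1] that by simp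
    ultimately show False using SN wt assms(2) by linarith
  qed
  \<comment> \<open>the letters appear in the order used in the list of words\<close>
  define w where "w = [L0] @ (if L1 \<in> S then [L1] else []) @ (if M0 \<in> S then [M0] else []) @
    (if Y0 \<in> S then [Y0] else []) @ (if Y1 \<in> S then [Y1] else [])"
  have "S = set w" unfolding w_def using sub L by auto
  moreover have "w \<in> fst ` set words"
    unfolding w_def using Y by (cases "L1 \<in> S"; cases "M0 \<in> S"; cases "Y0 \<in> S"; cases "Y1 \<in> S") (simp_all add: words_def)
  ultimately have "\<exists>w\<in>fst ` set words. S = set w" by blast
  then show ?thesis unfolding S_def by force
qed

text \<open>
  A non-zero value has doubled weight at least 2, so it can only occur at a word of distinct letters of
  doubled weight at most -2, that is at a rearrangement of one of the twelve words.
\<close>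

lemma alt_weight0_eqI:
  assumes F: "SVL.alt F" "weight0 F" and G: "SVL.alt G" "weight0 G"
    and eq: "\<And>w g. (w, g) \<in> set words \<Longrightarrow> coef (F w) g 0 = coef (G w) g 0"
  shows "F = G"
proof -
  define H where "H = F + smul (-1) G"
  have "SVL.alt H" unfolding H_def by (rule alt_linear(1)[OF F(1) alt_linear(2)[OF G(1)]])
  moreover have "weight0 H"
    unfolding weight0_iff
  proof (intro allI impI)
    fix xs g p assume "coef (H xs) g p \<noteq> 0"
    then have "coef (F xs) g p \<noteq> 0 \<or> coef (G xs) g p \<noteq> 0" by (auto simp: H_def coef_simps)
    then show "wt xs + coef_wt g p = 0" using F(2) G(2) unfolding weight0_iff by blast
  qed
  ultimately have H: "SVL.alt H" "weight0 H" .
  have w: "H w = 0" if wg: "(w, g) \<in> set words" for w g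
  proof (rule coef_eqI)
    fix h p
    have "coef (H w) g 0 = 0" using eq[OF wg] by (simp add: H_def coef_simps)
    moreover have "h = g \<and> p = 0" if "wt w + coef_wt h p = 0"
      using wg that by (cases h; auto simp: words_def wt_def; presburger)
    ultimately show "coef (H w) h p = coef 0 h p" using H(2) unfolding weight0_iff coef_simps by blast
  qed
  have "H xs = 0" for xs
  proof (rule ccontr)
    assume n: "H xs \<noteq> 0"
    then have d: "distinct xs" using SVL.alt_not_distinct[OF H(1)] by blast
    obtain g p where "coef (H xs) g p \<noteq> 0" using n coef_eqI[of "H xs" 0] by (auto simp: coef_simps)
    then have "wt xs + coef_wt g p = 0" using H(2) unfolding weight0_iff by blast
    then have "wt xs \<le> -2" by (cases g) auto
    from distinct_wt[OF d this] obtain w g where w': "(w, g) \<in> set words" "set xs = set w" by blast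
    have "distinct w" using w'(1) by (auto simp: words_def)
    then have "mset xs = mset w" using d w'(2) by (simp add: set_eq_iff_mset_eq_distinct)
    from SVL.alt_perm[OF H(1) this] w[OF w'(1)] n show False by auto
  qed
  then have "F xs = G xs" for xs by (simp add: H_def)
  then show ?thesis by (rule ext)
qed

abbreviation dl :: "mode list \<Rightarrow> sv_gen \<Rightarrow> mode list \<Rightarrow> 'f::field_char_0 sv" where
  "dl w g \<equiv> SVL.dual w (sv_of g)"

lemma dual_scalar: "\<exists>k. SVL.dual w v xs = sv_scale k v"
proof -
  have "\<exists>k. SVL.wedge x G ys = sv_scale k v" if "\<And>ys. \<exists>k. G ys = sv_scale k v" for x ys and G :: "mode list \<Rightarrow> 'a sv"
    using that
  proof (induction ys arbitrary: G)
    case (Cons y ys)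
    obtain a where a: "G ys = sv_scale a v" using Cons.prems by blast
    obtain b where b: "SVL.wedge x (SVL.contr y G) ys = sv_scale b v"
    proof -
      have "\<exists>b. SVL.wedge x (SVL.contr y G) ys = sv_scale b v"
        by (rule Cons.IH) (unfold SVL.contr_apply, rule Cons.prems)
      then show thesis using that by blast
    qed
    show ?case
      by (rule exI[of _ "(if y = x then a else 0) - b"]) (simp add: a b SV_V.scale_left_diff_distrib)
  qed (auto intro: exI[of _ 0])
  then show ?thesis
  proof (induction w arbitrary: xs)
    case Nil
    show ?case by (cases "xs = []") (auto simp: SVL.dual_simps intro: exI[of _ 1] exI[of _ 0])
  next
    case (Cons x w)
    then show ?case by (simp add: SVL.dual_simps)
  qed
qed

lemma dl_K: "dl w g \<in> K (length w)"
proof -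
  have "finite {xs. map fst xs = gs \<and> dl w g xs \<noteq> (0 :: 'a sv)}" for gs
  proof (rule finite_subset)
    show "{xs. map fst xs = gs \<and> dl w g xs \<noteq> (0 :: 'a sv)} \<subseteq> {xs. set xs \<subseteq> set w \<and> length xs = length w}"
    proof
      fix xs assume "xs \<in> {xs. map fst xs = gs \<and> dl w g xs \<noteq> (0 :: 'a sv)}"
      then have "dl w g xs \<noteq> (0 :: 'a sv)" by blast
      then have "mset xs = mset w" by (rule SVL.dual_support)
      from mset_eq_setD[OF this] mset_eq_length[OF this]
      show "xs \<in> {xs. set xs \<subseteq> set w \<and> length xs = length w}" by simp
    qed
  qed (simp add: finite_lists_length_eq)
  moreover have "dl w g xs = (0 :: 'a sv)" if "length xs \<noteq> length w" for xs
    using SVL.dual_support[of w "sv_of g :: 'a sv" xs] that mset_eq_length[of xs w] by blast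
  ultimately show ?thesis by (simp add: K_def SVL.alt_dual)
qed

lemma dl_weight0:
  assumes "(w, g) \<in> set words"
  shows "weight0 (dl w g)"
  unfolding weight0_iff
proof (intro allI impI)
  fix xs h p assume n: "coef (dl w g xs :: 'a sv) h p \<noteq> 0"
  then have "dl w g xs \<noteq> (0 :: 'a sv)" by (auto simp: coef_simps)
  then have "mset xs = mset w" by (rule SVL.dual_support)
  then have "wt xs = wt w" unfolding wt_def by (metis mset_map sum_mset_sum_list)
  moreover obtain k where "dl w g xs = sv_scale k (sv_of g :: 'a sv)" using dual_scalar by blast
  then have "h = g \<and> p = 0" using n by (auto simp: coef_simps split: if_splits)
  ultimately show "wt xs + coef_wt h p = 0" using assms by (auto simp: words_def wt_def)
qed

lemma mode_act_gen:
  "mode_act (g, 0) (sv_of h) = sv_scale (dcoeff g h) (sv_D (sv_of (gen_mul g h)))"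
  "mode_act (g, Suc 0) (sv_of h) = sv_scale (dcoeff g h + dcoeff h g) (sv_of (gen_mul g h))"
  unfolding mode_act.simps sv_bracket_gen sv_gen_bracket_eq by simp_all

lemmas eval_simps = SVL.ce.simps SVL.lie_def SVL.subst_act.simps SVL.contr_apply SVL.dual_simps SVL.wedge.simps
  mode_act_gen coef_simps SVL.act_minus SVL.act_diff SVL.act_add SVL.act_scale

text \<open>
  The complex of weight zero.
\<close>

definition W :: "nat \<Rightarrow> (mode list \<Rightarrow> 'f::field_char_0 sv) set" where
  "W q = {F \<in> K q. weight0 F}"

lemma W_add: "F \<in> W q \<Longrightarrow> G \<in> W q \<Longrightarrow> F + G \<in> W q"
  and W_smul: "F \<in> W q \<Longrightarrow> smul k F \<in> W q"
proof -
  assume F: "F \<in> W q"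
  show "smul k F \<in> W q"
    using F SM.subspace_scale[OF K_subspace, of F q k] unfolding W_def weight0_iff
    by (auto simp: coef_simps)
  assume G: "G \<in> W q"
  have "weight0 (F + G)"
    unfolding weight0_iff
  proof (intro allI impI)
    fix xs g p assume "coef ((F + G) xs) g p \<noteq> 0"
    then have "coef (F xs) g p \<noteq> 0 \<or> coef (G xs) g p \<noteq> 0" by (auto simp: coef_simps)
    then show "wt xs + coef_wt g p = 0" using F G unfolding W_def weight0_iff by blast
  qed
  then show "F + G \<in> W q" using F G SM.subspace_add[OF K_subspace, of F q G] by (simp add: W_def)
qed

lemma W_dl: "(w, g) \<in> set words \<Longrightarrow> length w = q \<Longrightarrow> dl w g \<in> W q"
  using dl_weight0 dl_K by (auto simp: W_def)

lemma W_ce: "F \<in> W q \<Longrightarrow> SVL.ce F \<in> W (Suc q)"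
  by (auto simp: W_def ce_K weight0_ce)

lemma W_eqI:
  assumes "F \<in> W q" "G \<in> W q"
    and eq: "\<And>w g. (w, g) \<in> set words \<Longrightarrow> length w = q \<Longrightarrow> coef (F w) g 0 = coef (G w) g 0"
  shows "F = G"
proof (rule alt_weight0_eqI)
  fix w g assume w: "(w, g) \<in> set words"
  show "coef (F w) g 0 = coef (G w) g 0"
  proof (cases "length w = q")
    case False
    then have "F w = 0" "G w = 0" using assms by (auto simp: W_def K_def)
    then show ?thesis by (simp only:)
  qed (rule eq[OF w])
qed (use assms in \<open>auto simp: W_def K_def\<close>)


abbreviation "E1 \<equiv> dl [L0] M_gen"
abbreviation "E2a \<equiv> dl [L0, L1] M_gen"
abbreviation "E2b \<equiv> dl [L0, M0] M_gen"
abbreviation "E2c \<equiv> dl [L0, Y0] Y_gen"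
abbreviation "E3a \<equiv> dl [L0, L1, M0] M_gen"
abbreviation "E3b \<equiv> dl [L0, Y0, Y1] M_gen"
abbreviation "E3c \<equiv> dl [L0, L1, Y0] Y_gen"
abbreviation "E3d \<equiv> dl [L0, M0, Y0] Y_gen"
abbreviation "E4a \<equiv> dl [L0, L1, Y0, Y1] M_gen"
abbreviation "E4b \<equiv> dl [L0, M0, Y0, Y1] M_gen"
abbreviation "E4c \<equiv> dl [L0, L1, M0, Y0] Y_gen"
abbreviation "E5 \<equiv> dl [L0, L1, M0, Y0, Y1] M_gen"

lemma W_E:
  "E1 \<in> W (Suc 0)" "E2a \<in> W 2" "E2b \<in> W 2" "E2c \<in> W 2" "E3a \<in> W 3" "E3b \<in> W 3" "E3c \<in> W 3" "E3d \<in> W 3"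
  "E4a \<in> W 4" "E4b \<in> W 4" "E4c \<in> W 4" "E5 \<in> W 5"
  by (rule W_dl; simp add: words_def)+

lemma W_0: "0 \<in> W q"
  using SM.subspace_0[OF K_subspace, of q] by (simp add: W_def weight0_iff coef_simps)

lemma ce_eqI:
  assumes "F \<in> W q" "G \<in> W p" "p = Suc q"
    and "\<And>w g. (w, g) \<in> set words \<Longrightarrow> length w = p \<Longrightarrow> coef (SVL.ce F w) g 0 = coef (G w) g 0"
  shows "SVL.ce F = G"
  using assms W_eqI[of "SVL.ce F" p G] W_ce by blast

text \<open>
  The twelve-dimensional complex: each identity is verified by evaluating both sides at the words of the next length.
\<close>

lemma ce_E:
  "SVL.ce E1 = 0" "SVL.ce E2a = 0" "SVL.ce E2b = smul (-1) E3b" "SVL.ce E2c = smul 2 E3b"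
  "SVL.ce E3a = E4a" "SVL.ce E3b = 0" "SVL.ce E3c = smul (-2) E4a" "SVL.ce E3d = smul (-2) E4b"
  "SVL.ce E4a = 0" "SVL.ce E4b = 0" "SVL.ce E4c = smul 2 E5"
proof -
  note ev = words_def eval_simps
  show "SVL.ce E1 = 0"
    by (rule ce_eqI[OF W_E(1) W_0 refl]) (auto simp: ev simp del: mode_act.simps)
  show "SVL.ce E2a = 0"
    by (rule ce_eqI[OF W_E(2) W_0 refl]) (auto simp: ev simp del: mode_act.simps)
  show "SVL.ce E2b = smul (-1) E3b"
    by (rule ce_eqI[OF W_E(3) W_smul[OF W_E(6)]]) (auto simp: ev simp del: mode_act.simps)
  show "SVL.ce E2c = smul 2 E3b"
    by (rule ce_eqI[OF W_E(4) W_smul[OF W_E(6)]]) (auto simp: ev simp del: mode_act.simps)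
  show "SVL.ce E3a = E4a"
    by (rule ce_eqI[OF W_E(5) W_E(9)]) (auto simp: ev simp del: mode_act.simps)
  show "SVL.ce E3b = 0"
    by (rule ce_eqI[OF W_E(6) W_0 refl]) (auto simp: ev simp del: mode_act.simps)
  show "SVL.ce E3c = smul (-2) E4a"
    by (rule ce_eqI[OF W_E(7) W_smul[OF W_E(9)]]) (auto simp: ev simp del: mode_act.simps)
  show "SVL.ce E3d = smul (-2) E4b"
    by (rule ce_eqI[OF W_E(8) W_smul[OF W_E(10)]]) (auto simp: ev simp del: mode_act.simps)
  show "SVL.ce E4a = 0"
    by (rule ce_eqI[OF W_E(9) W_0 refl]) (auto simp: ev simp del: mode_act.simps)
  show "SVL.ce E4b = 0"
    by (rule ce_eqI[OF W_E(10) W_0 refl]) (auto simp: ev simp del: mode_act.simps)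
  show "SVL.ce E4c = smul 2 E5"
    by (rule ce_eqI[OF W_E(11) W_smul[OF W_E(12)]]) (auto simp: ev simp del: mode_act.simps)
qed

lemma W_expand:
  "F \<in> W (Suc 0) \<Longrightarrow> \<exists>a. F = smul a E1"
  "F \<in> W 2 \<Longrightarrow> \<exists>a b c. F = smul a E2a + (smul b E2b + smul c E2c)"
  "F \<in> W 3 \<Longrightarrow> \<exists>a b c d. F = smul a E3a + (smul b E3b + (smul c E3c + smul d E3d))"
  "F \<in> W 4 \<Longrightarrow> \<exists>a b c. F = smul a E4a + (smul b E4b + smul c E4c)"
  "F \<in> W 5 \<Longrightarrow> \<exists>a. F = smul a E5"
  "F \<in> W q \<Longrightarrow> 6 \<le> q \<Longrightarrow> F = 0"
proof -
  note ev = words_def eval_simps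
  show "\<exists>a. F = smul a E1" if "F \<in> W (Suc 0)"
    by (intro exI, rule W_eqI[OF that W_smul[OF W_E(1), of "coef (F [L0]) M_gen 0"]]) (auto simp: ev)
  show "\<exists>a b c. F = smul a E2a + (smul b E2b + smul c E2c)" if "F \<in> W 2"
    by (intro exI, rule W_eqI[OF that W_add[OF W_smul[OF W_E(2), of "coef (F [L0, L1]) M_gen 0"]
        W_add[OF W_smul[OF W_E(3), of "coef (F [L0, M0]) M_gen 0"] W_smul[OF W_E(4), of "coef (F [L0, Y0]) Y_gen 0"]]]])
      (auto simp: ev)
  show "\<exists>a b c d. F = smul a E3a + (smul b E3b + (smul c E3c + smul d E3d))" if "F \<in> W 3"
    by (intro exI, rule W_eqI[OF that W_add[OF W_smul[OF W_E(5), of "coef (F [L0, L1, M0]) M_gen 0"]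
        W_add[OF W_smul[OF W_E(6), of "coef (F [L0, Y0, Y1]) M_gen 0"]
        W_add[OF W_smul[OF W_E(7), of "coef (F [L0, L1, Y0]) Y_gen 0"] W_smul[OF W_E(8), of "coef (F [L0, M0, Y0]) Y_gen 0"]]]]])
      (auto simp: ev)
  show "\<exists>a b c. F = smul a E4a + (smul b E4b + smul c E4c)" if "F \<in> W 4"
    by (intro exI, rule W_eqI[OF that W_add[OF W_smul[OF W_E(9), of "coef (F [L0, L1, Y0, Y1]) M_gen 0"]
        W_add[OF W_smul[OF W_E(10), of "coef (F [L0, M0, Y0, Y1]) M_gen 0"] W_smul[OF W_E(11), of "coef (F [L0, L1, M0, Y0]) Y_gen 0"]]]])
      (auto simp: ev)
  show "\<exists>a. F = smul a E5" if "F \<in> W 5"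
    by (intro exI, rule W_eqI[OF that W_smul[OF W_E(12), of "coef (F [L0, L1, M0, Y0, Y1]) M_gen 0"]]) (auto simp: ev)
  show "F = 0" if "F \<in> W q" "6 \<le> q"
    by (rule W_eqI[OF that(1) W_0]) (use that in \<open>auto simp: words_def\<close>)
qed

text \<open>
  Representatives of the cohomology in degrees 1, 2 and 3. The coefficients 2 and 1 make the
  contributions to \<open>E3b\<close> and \<open>E4a\<close> of the two summands cancel under the differential.
\<close>

definition repr :: "nat \<Rightarrow> nat \<Rightarrow> mode list \<Rightarrow> 'f::field_char_0 sv" where
  "repr q i = (if q = 1 then E1 else if q = 3 then smul 2 E3a + E3c
     else if i = 0 then E2a else smul 2 E2b + E2c)"

definition betti :: "nat \<Rightarrow> nat" where
  "betti q = (if q = 1 \<or> q = 3 then 1 else if q = 2 then 2 else 0)"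

lemma Bm_0: "0 \<in> Bm q"
proof (cases q)
  case (Suc p)
  have "SVL.ce 0 \<in> SVL.ce ` (K p :: (mode list \<Rightarrow> 'a sv) set)"
    by (rule imageI) (rule SM.subspace_0[OF K_subspace])
  then show ?thesis unfolding Bm_def Suc nat.case ce_linear(4) .
qed (simp add: Bm_def)

lemma Bm_ce: "G \<in> W p \<Longrightarrow> F = SVL.ce G \<Longrightarrow> q = Suc p \<Longrightarrow> F \<in> Bm q"
  by (auto simp: Bm_def W_def)

lemma diff_self_Bm: "F = G \<Longrightarrow> F - G \<in> Bm q"
  using Bm_0[of q] by simp

lemma betti_sums:
  "(\<Sum>i<betti (Suc 0). h i) = h 0" "(\<Sum>i<betti 2. h i) = h 0 + h 1" "(\<Sum>i<betti 3. h i) = h 0"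
  by (simp_all add: betti_def numeral_2_eq_2)

lemma repr_simps:
  "repr (Suc 0) i = E1" "repr 2 0 = E2a" "repr 2 1 = smul 2 E2b + E2c" "repr 3 i = smul 2 E3a + E3c"
  by (simp_all add: repr_def fun_eq_iff)

lemma betti_cases:
  assumes "i < betti q"
  obtains "q = Suc 0" | "q = 2" "i = 0" | "q = 2" "i = 1" | "q = 3"
  using assms that by (cases i) (auto simp: betti_def split: if_splits)

lemma repr_W: "i < betti q \<Longrightarrow> repr q i \<in> W q"
  by (erule betti_cases) (simp_all only: repr_simps, (intro W_add W_smul W_E)+)

lemma ce_repr: "i < betti q \<Longrightarrow> SVL.ce (repr q i) = 0"
  by (erule betti_cases) (simp_all only: repr_simps ce_linear ce_E, simp_all add: fun_eq_iff)

lemma model_basis: "SM.basis_mod (Zm q) (Bm q) (betti q) (repr q :: nat \<Rightarrow> mode list \<Rightarrow> 'f::field_char_0 sv)"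
proof (rule basis_mod_weight0)
  show "repr q i \<in> Zm q" "weight0 (repr q i)" if "i < betti q" for i
    using repr_W[OF that] ce_repr[OF that] by (auto simp: Zm_def W_def)
  show "betti q = 0" if "q = 0" using that by (simp add: betti_def)
next
  fix F :: "mode list \<Rightarrow> 'f sv" assume "F \<in> Zm q" "weight0 F"
  then have F: "F \<in> W q" and "SVL.ce F = 0" by (auto simp: Zm_def W_def)
  then have c: "coef (SVL.ce F xs) g 0 = 0" for xs g by (simp add: coef_simps)
  consider "q = 0" | "q = Suc 0" | "q = 2" | "q = 3" | "q = 4" | "q = 5" | "6 \<le> q" by linarith
  then show "\<exists>u. F - (\<Sum>i<betti q. smul (u i) (repr q i)) \<in> Bm q"
  proof cases
    case 1
    then have "F = 0" using F by (intro K_0_weight0) (auto simp: W_def)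
    then show ?thesis using 1 Bm_0 by (simp add: betti_def)
  next
    case 2
    obtain a where "F = smul a E1" using W_expand(1) F 2 by blast
    then show ?thesis unfolding 2 betti_sums repr_simps by (intro exI[of _ "\<lambda>_. a"] diff_self_Bm)
  next
    case 3
    obtain x y z where F': "F = smul x E2a + (smul y E2b + smul z E2c)" using W_expand(2) F 3 by blast
    have "z * 2 = y"
      using c[of "[L0, Y0, Y1]" M_gen] unfolding F' ce_linear ce_E by (simp add: eval_simps)
    then have "y = 2 * z" by (metis mult.commute)
    then have "F = smul x E2a + smul z (smul 2 E2b + E2c)"
      unfolding F' by (simp add: fun_eq_iff SV_V.scale_right_distrib mult.commute)
    then show ?thesis
      unfolding 3 betti_sums repr_simps
      by (intro exI[of _ "\<lambda>i. if i = 0 then x else z"] diff_self_Bm) simp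
  next
    case 4
    \<comment> \<open>\<open>E3b\<close> is a coboundary, and closedness determines the rest up to a multiple of the representative\<close>
    obtain w x y z where F': "F = smul w E3a + (smul x E3b + (smul y E3c + smul z E3d))"
      using W_expand(3) F 4 by blast
    have "w = 2 * y" "z = 0"
      using c[of "[L0, L1, Y0, Y1]" M_gen] c[of "[L0, M0, Y0, Y1]" M_gen]
      unfolding F' ce_linear ce_E by (simp_all add: eval_simps)
    then have "F - smul y (smul 2 E3a + E3c) = smul x E3b"
      unfolding F' by (simp add: fun_eq_iff SV_V.scale_right_distrib mult.commute)
    also have "\<dots> = SVL.ce (smul (x / 2) E2c)" unfolding ce_linear ce_E by (simp add: fun_eq_iff)
    finally show ?thesis
      unfolding 4 betti_sums repr_simps
      by (intro exI[of _ "\<lambda>_. y"] Bm_ce[OF W_smul[OF W_E(4)]]) simp_all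
  next
    case 5
    obtain x y z where F': "F = smul x E4a + (smul y E4b + smul z E4c)" using W_expand(4) F 5 by blast
    have "z = 0"
      using c[of "[L0, L1, M0, Y0, Y1]" M_gen] unfolding F' ce_linear ce_E by (simp add: eval_simps)
    then have "F = SVL.ce (smul x E3a + smul (- y / 2) E3d)"
      unfolding F' ce_linear ce_E by (simp add: fun_eq_iff)
    then have "F \<in> Bm q"
      by (rule Bm_ce[OF W_add[OF W_smul[OF W_E(5)] W_smul[OF W_E(8)]]]) (simp add: 5)
    then show ?thesis using 5 by (simp add: betti_def)
  next
    case 6
    obtain x where F': "F = smul x E5" using W_expand(5) F 6 by blast
    then have "F = SVL.ce (smul (x / 2) E4c)"
      unfolding ce_linear ce_E by (simp add: fun_eq_iff)
    then have "F \<in> Bm q" by (rule Bm_ce[OF W_smul[OF W_E(11)]]) (simp add: 6)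
    then show ?thesis using 6 by (simp add: betti_def)
  next
    case 7
    then have "F = 0" using W_expand(6) F by blast
    then show ?thesis using 7 Bm_0 by (simp add: betti_def)
  qed
next
  fix u and G :: "mode list \<Rightarrow> 'f sv"
  assume e: "(\<Sum>i<betti q. smul (u i) (repr q i)) = SVL.ce G" and "q \<noteq> 0" "G \<in> K (q - 1)" "weight0 G"
  then have G: "G \<in> W (q - 1)" by (simp add: W_def)
  have ev: "coef ((\<Sum>i<betti q. smul (u i) (repr q i)) xs) g 0 = coef (SVL.ce G xs) g 0" for xs g by (simp only: e)
  show "\<forall>i<betti q. u i = 0"
  proof (intro allI impI)
    fix i assume i: "i < betti q"
    then show "u i = 0"
    proof (cases rule: betti_cases)
      case 1
      then have G0: "G = 0" using G by (intro K_0_weight0) (auto simp: W_def)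
      have "i = 0" using i 1 by (simp add: betti_def)
      then show ?thesis
        using ev[of "[L0]" M_gen] unfolding 1 G0 betti_sums repr_simps ce_linear by (simp add: eval_simps)
    next
      case 2
      obtain t where Gt: "G = smul t E1" using W_expand(1) G 2 by auto
      show ?thesis
        using ev[of "[L0, L1]" M_gen] unfolding 2 Gt betti_sums repr_simps ce_linear ce_E by (simp add: eval_simps)
    next
      case 3
      obtain t where Gt: "G = smul t E1" using W_expand(1) G 3 by auto
      show ?thesis
        using ev[of "[L0, Y0]" Y_gen] unfolding 3 Gt betti_sums repr_simps ce_linear ce_E by (simp add: eval_simps)
    next
      case 4
      have "G \<in> W 2" using G 4 by simp
      then obtain x y z where Gt: "G = smul x E2a + (smul y E2b + smul z E2c)" using W_expand(2) by blast
      have "i = 0" using i 4 by (simp add: betti_def)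
      then show ?thesis
        using ev[of "[L0, L1, Y0]" Y_gen] unfolding 4 Gt betti_sums repr_simps ce_linear ce_E
        by (simp add: eval_simps)
    qed
  qed
qed


section \<open>Operations on cochains\<close>

definition cochain_scale :: "'f::field_char_0 \<Rightarrow> ('f sv, 'f sv) cochain \<Rightarrow> ('f sv, 'f sv) cochain" where
  "cochain_scale c f = (\<lambda>as. Poly_Mapping.map (sv_scale c) (f as))"

lemma cochain_scale_eq: "cochain_scale c f as = SV_V.pscale (const c) (f as)"
  by (simp add: cochain_scale_def map_sv_scale)

lemma phi_add: "phi (f + g) = phi f + phi g"
  and phi_scale: "phi (cochain_scale c f) = smul c (phi f)"
  and phi_0: "phi 0 = 0"
  by (rule ext, simp add: phi_def cochain_scale_eq lookup_add lookup_pscale_C SV_V.scale_right_distrib mult.commute)+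

lemma phi_eqI: "f \<in> SV.cochains q \<Longrightarrow> g \<in> SV.cochains q \<Longrightarrow> phi f = phi g \<Longrightarrow> f = g"
  using phi_inject[of f q g] by (simp add: cochains_iff)

interpretation SC: scaled_space "cochain_scale :: 'f::field_char_0 \<Rightarrow> _"
proof
  fix a b :: 'f and f g :: "('f sv, 'f sv) cochain"
  have "const (a * b) = const a * (const b :: 'f lpoly)" by (simp add: mult_single)
  then show "cochain_scale a (cochain_scale b f) = cochain_scale (a * b) f"
    by (intro ext) (simp only: cochain_scale_eq SV_V.pscale_mult)
qed (auto simp: fun_eq_iff cochain_scale_eq SV_V.pscale_add_right SV_V.pscale_add_left single_add)

lemma cochains_subspace: "SC.subspace (SV.cochains q)"
proof (rule SC.subspaceI)
  show "0 \<in> SV.cochains q"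
    by (simp add: cochains_iff sesq_def vars_0 phi_0) (simp add: zero_fun_def sesqui_0 SVL.alt_def)
  fix f g :: "('a sv, 'a sv) cochain" assume fg: "f \<in> SV.cochains q" "g \<in> SV.cochains q"
  then have "f + g \<in> sesq q" using sesq_add[of f q g] by (simp add: cochains_iff plus_fun_def)
  then show "f + g \<in> SV.cochains q" using fg by (simp add: cochains_iff phi_add alt_linear)
next
  fix c and f :: "('a sv, 'a sv) cochain" assume f: "f \<in> SV.cochains q"
  then have "cochain_scale c f \<in> sesq q"
    using sesq_pscale[of f q c] by (simp add: cochains_iff cochain_scale_eq[abs_def])
  then show "cochain_scale c f \<in> SV.cochains q" using f by (simp add: cochains_iff phi_scale alt_linear(2))
qed

lemmas cochains_add = SC.subspace_add[OF cochains_subspace]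
lemmas cochains_scale = SC.subspace_scale[OF cochains_subspace]

lemma vars_mapD:
  assumes "vars n P"
  shows "vars n (SV_V.mapD P)"
  unfolding vars_def
proof
  fix m assume "m \<in> Poly_Mapping.keys (SV_V.mapD P)"
  then have "sv_D (lk P m) \<noteq> 0" by (simp add: in_keys_iff SV_V.lookup_mapD)
  then have "m \<in> Poly_Mapping.keys P" by (auto simp: in_keys_iff)
  then show "Poly_Mapping.keys m \<subseteq> {..<n}" using assms by (simp add: vars_def)
qed

lemma del_sesq:
  assumes f: "f \<in> sesq q"
  shows "SV.del q f \<in> sesq q"
proof -
  have "sesqui q i (lam i) (\<lambda>as. SV_V.mapD (f as))" if "i < q" for i
  proof -
    have s: "sesqui q i (lam i) f" using f that by (simp add: sesq_def)
    have m: "SV_V.mapD (- P) = - SV_V.mapD P" for P :: "'a sv lpoly"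
      using SV_V.mapD_add[of P "- P"] by (simp add: eq_neg_iff_add_eq_0 add.commute)
    show ?thesis
      unfolding sesqui_def using sesquiD[OF s] by (simp add: SV_V.mapD_add SV_V.mapD_pscale m)
  qed
  then have "sesqui q i (lam i) (SV.del q f)" if "i < q" for i
    using f that unfolding SV.del_def[abs_def] by (intro sesqui_add sesqui_pscale) (auto simp: sesq_def)
  moreover have "vars q (SV.del q f as)" for as
    using f unfolding SV.del_def by (auto intro!: vars_add vars_mapD vars_pscale vars_sum vars_lam simp: sesq_def)
  ultimately show ?thesis using f by (simp add: sesq_def SV.del_def)
qed

lemma phi_del_cochain:
  assumes f: "f \<in> SV.cochains q"
  shows "phi (SV.del q f) = SVL.lie L0 (phi f)"
proof
  fix xs
  have fs: "f \<in> sesq q" using f by (simp add: cochains_iff)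
  show "phi (SV.del q f) xs = SVL.lie L0 (phi f) xs"
  proof (cases "length xs = q")
    case False
    then have "phi f (xs[i := y]) = 0" "phi f xs = 0" for i y using phi_length[OF fs] by simp_all
    then show ?thesis
      using False phi_length[OF del_sesq[OF fs]] by (simp add: SVL.lie_def SVL.subst_act_update)
  qed (rule phi_del[OF fs])
qed

lemma del_cochains: "f \<in> SV.cochains q \<Longrightarrow> SV.del q f \<in> SV.cochains q"
  using phi_del_cochain[of f q] by (simp add: cochains_iff del_sesq SVL.alt_lie)

lemma sv_D_inject: "sv_D v = 0 \<Longrightarrow> v = 0"
proof (rule coef_eqI)
  fix g p assume "sv_D v = 0"
  then have "coef (sv_D v) g (Suc p) = 0" by (simp only: coef_simps)
  then show "coef v g p = coef 0 g p" by (simp add: coef_simps)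
qed

text \<open>
  On a word whose indices have the smallest sum among those with \<open>F \<noteq> 0\<close> the Lie derivative is just \<open>\<partial>\<close> of the
  value, since it lowers indices in all other terms; and \<open>\<partial>\<close> is injective on a free module.
\<close>

lemma lie_L0_inject:
  assumes "SVL.lie L0 F = 0"
  shows "F xs = 0"
proof (induction "\<Sum>x\<leftarrow>xs. snd x" arbitrary: xs rule: less_induct)
  case less
  have "sv_scale (mode_coeff L0 (xs ! i)) (F (xs[i := mode_mul L0 (xs ! i)])) = 0" if i: "i < length xs" for i
  proof (cases "xs ! i")
    case (Pair g n)
    show ?thesis
    proof (cases n)
      case (Suc p)
      have xs: "xs = take i xs @ (g, n) # drop (Suc i) xs" using i Pair by (metis id_take_nth_drop)
      have up: "xs[i := (g, p)] = take i xs @ (g, p) # drop (Suc i) xs" using i by (simp add: upd_conv_take_nth_drop)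
      have "(\<Sum>x\<leftarrow>xs. snd x) = (\<Sum>x\<leftarrow>take i xs @ (g, n) # drop (Suc i) xs. snd x)" using xs by (rule arg_cong)
      then have "(\<Sum>x\<leftarrow>xs[i := (g, p)]. snd x) < (\<Sum>x\<leftarrow>xs. snd x)" unfolding up by (simp add: Suc)
      from less[OF this] show ?thesis by (simp add: Pair Suc)
    qed (simp add: Pair)
  qed
  then have "SVL.subst_act L0 F xs = 0" unfolding SVL.subst_act_update by (intro sum.neutral) auto
  moreover have "SVL.lie L0 F xs = 0" using assms by (simp only: zero_fun_apply)
  ultimately have "sv_D (F xs) = 0" unfolding SVL.lie_def mode_act_L0 by (simp only: diff_zero)
  then show ?case by (rule sv_D_inject)
qed

section \<open>The cohomology\<close>

text \<open>
  The contraction with \<open>L\<^sub>(\<^sub>0\<^sub>)\<close>, which is the homotopy for \<open>\<partial>\<close>.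
\<close>

definition iota :: "nat \<Rightarrow> ('f::field_char_0 sv, 'f sv) cochain \<Rightarrow> ('f sv, 'f sv) cochain" where
  "iota q f = psi q (SVL.contr L0 (phi f))"

lemma iota_cochains: "f \<in> SV.cochains (Suc q) \<Longrightarrow> iota q f \<in> SV.cochains q"
  unfolding iota_def by (intro psi_cochains contr_K phi_K)

lemma phi_iota: "f \<in> SV.cochains (Suc q) \<Longrightarrow> phi (iota q f) = SVL.contr L0 (phi f)"
  unfolding iota_def by (intro phi_psi contr_K phi_K)

interpretation HC: homotopy_complex "cochain_scale :: 'f::field_char_0 \<Rightarrow> _" SV.cochains SV.diff SV.del iota
proof
  fix q c and f g :: "('f sv, 'f sv) cochain"
  show "SC.subspace (SV.cochains q)" by (rule cochains_subspace)
  {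
    assume f: "f \<in> SV.cochains q"
    show "SV.diff q f \<in> SV.cochains (Suc q)" by (rule diff_cochains[OF f])
    show "SV.del q f \<in> SV.cochains q" by (rule del_cochains[OF f])
    show "SV.diff q (cochain_scale c f) = cochain_scale c (SV.diff q f)"
      using f by (intro phi_eqI[where q = "Suc q"] diff_cochains cochains_scale)
        (simp_all only: phi_diff phi_scale cochains_scale ce_linear)
    show "SV.del q (cochain_scale c f) = cochain_scale c (SV.del q f)"
      using f by (intro phi_eqI[where q = q] del_cochains cochains_scale)
        (simp_all only: phi_del_cochain phi_scale cochains_scale SVL.lie_linear)
    show "SV.diff (Suc q) (SV.diff q f) = 0"
      using f by (intro phi_eqI[where q = "Suc (Suc q)"] diff_cochains SC.subspace_0[OF cochains_subspace])
        (simp_all only: phi_diff[OF diff_cochains] phi_diff phi_0 ce_ce)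
    show "f = 0" if "SV.del q f = 0"
    proof (rule phi_eqI[OF f SC.subspace_0[OF cochains_subspace]])
      have "SVL.lie L0 (phi f) = 0" using phi_del_cochain[OF f] that by (simp only: phi_0)
      then show "phi f = phi 0" unfolding phi_0 by (intro ext) (simp add: lie_L0_inject)
    qed
    assume g: "g \<in> SV.cochains q"
    show "SV.diff q (f + g) = SV.diff q f + SV.diff q g"
      using f g by (intro phi_eqI[where q = "Suc q"] diff_cochains cochains_add)
        (simp_all only: phi_diff phi_add cochains_add ce_linear)
    show "SV.del q (f + g) = SV.del q f + SV.del q g"
      using f g by (intro phi_eqI[where q = q] del_cochains cochains_add)
        (simp_all only: phi_del_cochain phi_add cochains_add SVL.lie_linear)
  }
  {
    assume f: "f \<in> SV.cochains (Suc q)"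
    show "iota q f \<in> SV.cochains q" by (rule iota_cochains[OF f])
    show "iota q (cochain_scale c f) = cochain_scale c (iota q f)"
      using f by (intro phi_eqI[where q = q] iota_cochains cochains_scale)
        (simp_all only: phi_iota phi_scale cochains_scale SVL.contr_linear)
    show "SV.diff q (iota q f) + iota (Suc q) (SV.diff (Suc q) f) = SV.del (Suc q) f"
    proof (rule phi_eqI[where q = "Suc q"])
      show "phi (SV.diff q (iota q f) + iota (Suc q) (SV.diff (Suc q) f)) = phi (SV.del (Suc q) f)"
        unfolding phi_add phi_diff[OF iota_cochains[OF f]] phi_iota[OF f] phi_iota[OF diff_cochains[OF f]]
          phi_diff[OF f] phi_del_cochain[OF f] by (rule cartan)
    qed (use f in \<open>intro cochains_add diff_cochains iota_cochains del_cochains; assumption\<close>)+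
    assume g: "g \<in> SV.cochains (Suc q)"
    show "iota q (f + g) = iota q f + iota q g"
      using f g by (intro phi_eqI[where q = q] iota_cochains cochains_add)
        (simp_all only: phi_iota phi_add cochains_add SVL.contr_linear)
  }
  assume f: "f \<in> SV.cochains 0"
  show "iota 0 (SV.diff 0 f) = SV.del 0 f"
  proof (rule phi_eqI[where q = 0])
    have "SVL.contr L0 (phi f) = 0" by (rule contr_K_0[OF phi_K[OF f]])
    then show "phi (iota 0 (SV.diff 0 f)) = phi (SV.del 0 f)"
      using cartan[of L0 "phi f"]
      unfolding phi_iota[OF diff_cochains[OF f]] phi_diff[OF f] phi_del_cochain[OF f]
      by (simp only: ce_linear add_0_left)
  qed (use f in \<open>intro diff_cochains iota_cochains del_cochains; assumption\<close>)+
qed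

lemma phi_sum: "phi (\<Sum>i\<in>I. cochain_scale (u i) (f i)) = (\<Sum>i\<in>I. smul (u i) (phi (f i)))"
proof (induction I rule: infinite_finite_induct)
  case (insert x F)
  show ?case unfolding sum.insert[OF insert(1,2)] phi_add phi_scale insert(3) ..
qed (simp_all only: sum.infinite sum.empty phi_0 not_False_eq_True)

lemma phi_B:
  assumes f: "f \<in> SV.cochains q"
  shows "phi f \<in> Bm q \<longleftrightarrow> f \<in> HC.B q"
proof (cases q)
  case 0
  then show ?thesis
    using phi_eqI[OF f SC.subspace_0[OF cochains_subspace]] by (auto simp: Bm_def HC.B_def phi_0)
next
  case (Suc p)
  show ?thesis
  proof
    assume "phi f \<in> Bm q"
    then obtain G where G: "G \<in> K p" "phi f = SVL.ce G" by (auto simp: Bm_def Suc)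
    have "f = SV.diff p (psi p G)"
    proof (rule phi_eqI[OF f])
      show "SV.diff p (psi p G) \<in> SV.cochains q" unfolding Suc by (rule diff_cochains[OF psi_cochains[OF G(1)]])
      show "phi f = phi (SV.diff p (psi p G))" unfolding phi_diff[OF psi_cochains[OF G(1)]] phi_psi[OF G(1)] by (rule G(2))
    qed
    then show "f \<in> HC.B q" using psi_cochains[OF G(1)] by (auto simp: HC.B_def Suc)
  next
    assume "f \<in> HC.B q"
    then obtain h where h: "h \<in> SV.cochains p" "f = SV.diff p h" by (auto simp: HC.B_def Suc)
    show "phi f \<in> Bm q"
      unfolding h(2) phi_diff[OF h(1)] Bm_def Suc nat.case by (rule imageI[OF phi_K[OF h(1)]])
  qed
qed

lemma phi_Z:
  assumes f: "f \<in> SV.cochains q"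
  shows "phi f \<in> Zm q \<longleftrightarrow> f \<in> HC.Z q"
proof -
  have "SVL.ce (phi f) = 0 \<longleftrightarrow> SV.diff q f = 0"
    unfolding phi_diff[OF f, symmetric]
    using phi_eqI[OF diff_cochains[OF f] SC.subspace_0[OF cochains_subspace]] by (auto simp: phi_0)
  then show ?thesis using f phi_K[OF f] by (simp add: Zm_def HC.Z_def)
qed

text \<open>
  The dictionary between cochains and functions of words carries \<open>model_basis\<close> over.
\<close>

lemma basic_basis: "SC.basis_mod (HC.Z q) (HC.B q) (betti q) (\<lambda>i. psi q (repr q i :: mode list \<Rightarrow> 'f::field_char_0 sv))"
proof -
  note b = model_basis[of q, where 'f = 'f, unfolded SM.basis_mod_def]
  have rK: "(repr q i :: mode list \<Rightarrow> 'f sv) \<in> K q" if "i < betti q" for i using b that by (auto simp: Zm_def)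
  have sumc: "(\<Sum>i<betti q. cochain_scale (u i) (psi q (repr q i))) \<in> SV.cochains q" for u :: "nat \<Rightarrow> 'f"
    by (rule SC.subspace_sum[OF cochains_subspace]) (use rK in \<open>auto intro!: cochains_scale psi_cochains\<close>)
  have phis: "phi (\<Sum>i<betti q. cochain_scale (u i) (psi q (repr q i))) = (\<Sum>i<betti q. smul (u i) (repr q i))" for u :: "nat \<Rightarrow> 'f"
    unfolding phi_sum by (rule sum.cong[OF refl]) (simp add: phi_psi rK)
  show ?thesis
    unfolding SC.basis_mod_def
  proof (intro conjI ballI allI impI)
    fix i assume i: "i < betti q"
    then have "(repr q i :: mode list \<Rightarrow> 'f sv) \<in> Zm q" using b by blast
    then show "psi q (repr q i :: mode list \<Rightarrow> 'f sv) \<in> HC.Z q"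
      using phi_Z[OF psi_cochains[OF rK[OF i]]] unfolding phi_psi[OF rK[OF i]] by blast
  next
    fix z :: "('f sv, 'f sv) cochain" assume z: "z \<in> HC.Z q"
    then have zc: "z \<in> SV.cochains q" by (simp add: HC.Z_def)
    then have "phi z \<in> Zm q" using z by (simp add: phi_Z)
    then obtain u where u: "phi z - (\<Sum>i<betti q. smul (u i) (repr q i)) \<in> Bm q" using b by blast
    let ?y = "z - (\<Sum>i<betti q. cochain_scale (u i) (psi q (repr q i)))"
    have "phi ?y + phi (\<Sum>i<betti q. cochain_scale (u i) (psi q (repr q i))) = phi z"
      unfolding phi_add[symmetric] by simp
    then have "phi ?y = phi z - (\<Sum>i<betti q. smul (u i) (repr q i))" unfolding phis by (rule add_implies_diff)
    then have "?y \<in> HC.B q"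
      using u phi_B[OF SC.subspace_diff[OF cochains_subspace zc sumc[of u]]] by simp
    then show "\<exists>u. z - (\<Sum>i<betti q. cochain_scale (u i) (psi q (repr q i))) \<in> HC.B q" by blast
  next
    fix u :: "nat \<Rightarrow> 'f" and i
    assume "(\<Sum>i<betti q. cochain_scale (u i) (psi q (repr q i))) \<in> HC.B q" and i: "i < betti q"
    then have "(\<Sum>i<betti q. smul (u i) (repr q i)) \<in> Bm q" using phi_B[OF sumc] by (simp only: phis)
    then show "u i = 0" using b i by blast
  qed
qed

lemma cochain_space_eq: "SV.cochain_space = HC.space"
  by (rule ext) (simp add: SV.cochain_space_def cochain_scale_def[abs_def])

theorem theorem4p11:
  fixes q :: nat
  shows
    "has_dimension
       (SV.basic_cohomology q ::
         ('f::field_char_0, ('f sv, 'f sv) cochain set) module)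
       (if q = 1 \<or> q = 3 then 1 else if q = 2 then 2 else 0) \<and>
     has_dimension
       (SV.reduced_cohomology q ::
         ('f::field_char_0, ('f sv, 'f sv) cochain set set) module)
       (if q = 0 \<or> q = 3 then 1 else if q = 1 \<or> q = 2 then 3 else 0)"
proof
  have "has_dimension (cohomology HC.space SV.diff q) (betti q)"
    by (rule HC.has_dimension_cohomology[OF basic_basis])
  then show "has_dimension (SV.basic_cohomology q :: ('f, ('f sv, 'f sv) cochain set) module)
      (if q = 1 \<or> q = 3 then 1 else if q = 2 then 2 else 0)"
    by (simp only: SV.basic_cohomology_def cochain_space_eq betti_def)
  have "SV.reduced_space = (HC.red_space :: nat \<Rightarrow> ('f, ('f sv, 'f sv) cochain set) module)"
    by (rule ext) (simp only: SV.reduced_space_def HC.red_space_def cochain_space_eq)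
  moreover have "SV.reduced_diff = (HC.red_diff :: nat \<Rightarrow> ('f sv, 'f sv) cochain set \<Rightarrow> ('f sv, 'f sv) cochain set)"
    by (intro ext) (simp only: SV.reduced_diff_def HC.red_diff_def cochain_space_eq)
  moreover have "has_dimension (cohomology (HC.red_space :: nat \<Rightarrow> ('f, ('f sv, 'f sv) cochain set) module) HC.red_diff q) (betti q + betti (Suc q))"
    by (rule HC.has_dimension_reduced_cohomology[OF basic_basis basic_basis])
  moreover have "betti q + betti (Suc q) = (if q = 0 \<or> q = 3 then 1 else if q = 1 \<or> q = 2 then 3 else 0)"
    by (auto simp: betti_def)
  ultimately show "has_dimension (SV.reduced_cohomology q :: ('f, ('f sv, 'f sv) cochain set set) module)
      (if q = 0 \<or> q = 3 then 1 else if q = 1 \<or> q = 2 then 3 else 0)"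
    by (simp only: SV.reduced_cohomology_def)
qed

end
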